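(* Let $G$ be a compact group. Then the following two assertions are equivalent: (i) $G$ contains a dense subgroup which is a free group of finite rank; (ii) $G$ contains a dense subgroup which is a surface group.
   Context: Topological groups are assumed to be Hausdorff. A free group means a nonabelian free group, i.e. a free group on at least two generators (so "finite rank" means rank $r$ with $2\le r<\infty$). A surface group is a group isomorphic to the fundamental group of a closed oriented surface of genus at least $2$. Subgroups are abstract subgroups; density is with respect to the topology of $G$. *)

theory Defs
  imports "HOL-Analysis.Analysis" "HOL-Algebra.Generated_Groups"
begin

section \<open>Topological groups\<close>

locale hausdorff_topological_group = group G
  for G :: "('a, 'b) monoid_scheme" (structure) and T :: "'a topology" +
  assumes topspace_eq: "topspace T = carrier G"
    and continuous_mult: "continuous_map (prod_topology T T) T (\<lambda>(x, y). x \<otimes> y)"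
    and continuous_inv: "continuous_map T T (\<lambda>x. inv x)"
    and hausdorff: "Hausdorff_space T"

locale compact_group = hausdorff_topological_group +
  assumes compact: "compact_space T"

definition dense_subgroup :: "'a set \<Rightarrow> ('a, 'b) monoid_scheme \<Rightarrow> 'a topology \<Rightarrow> bool" where
  "dense_subgroup H G T \<longleftrightarrow> subgroup H G \<and> T closure_of H = topspace T"

section \<open>Free groups\<close>

text \<open>A word is a list of letters \<open>(x, e)\<close>, where \<open>(x, True)\<close> stands for \<open>x\<close> and
  \<open>(x, False)\<close> for the inverse of \<open>x\<close>.\<close>

definition word_value :: "('a, 'b) monoid_scheme \<Rightarrow> ('a \<times> bool) list \<Rightarrow> 'a" where
  "word_value G w =
     foldr (\<lambda>(x, e) y. (if e then x else inv\<^bsub>G\<^esub> x) \<otimes>\<^bsub>G\<^esub> y) w \<one>\<^bsub>G\<^esub>"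

definition reduced_word :: "('a \<times> bool) list \<Rightarrow> bool" where
  "reduced_word w \<longleftrightarrow> successively (\<lambda>(x, e) (y, d). x = y \<longrightarrow> e = d) w"

definition free_basis :: "('a, 'b) monoid_scheme \<Rightarrow> 'a set \<Rightarrow> bool" where
  "free_basis G S \<longleftrightarrow>
     S \<subseteq> carrier G \<and> generate G S = carrier G \<and>
     (\<forall>w. fst ` set w \<subseteq> S \<and> reduced_word w \<and> w \<noteq> [] \<longrightarrow> word_value G w \<noteq> \<one>\<^bsub>G\<^esub>)"

definition free_group_of_rank :: "('a, 'b) monoid_scheme \<Rightarrow> nat \<Rightarrow> bool" where
  "free_group_of_rank G r \<longleftrightarrow> group G \<and> (\<exists>S. finite S \<and> card S = r \<and> free_basis G S)"

section \<open>The fundamental group\<close>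

text \<open>Loops are functions on all of \<open>real\<close>, of which only the restriction to \<open>{0..1}\<close>
  matters: \<open>homotopic_with\<close> does not distinguish functions that agree on \<open>{0..1}\<close>, so each
  homotopy class contains all extensions of its members.\<close>

definition loop_at :: "'a topology \<Rightarrow> 'a \<Rightarrow> (real \<Rightarrow> 'a) \<Rightarrow> bool" where
  "loop_at X x p \<longleftrightarrow> pathin X p \<and> p 0 = x \<and> p 1 = x"

definition loop_homotopic ::
    "'a topology \<Rightarrow> 'a \<Rightarrow> (real \<Rightarrow> 'a) \<Rightarrow> (real \<Rightarrow> 'a) \<Rightarrow> bool" where
  "loop_homotopic X x =
     homotopic_with (\<lambda>h. h 0 = x \<and> h 1 = x) (subtopology euclideanreal {0..1}) X"

definition loop_class :: "'a topology \<Rightarrow> 'a \<Rightarrow> (real \<Rightarrow> 'a) \<Rightarrow> (real \<Rightarrow> 'a) set" where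
  "loop_class X x p = {q. loop_at X x q \<and> loop_homotopic X x p q}"

text \<open>The library's \<open>+++\<close> is not usable for abstract topologies, as it requires the
  points to belong to a type of class \<open>topological_space\<close>.\<close>

definition loop_join :: "(real \<Rightarrow> 'a) \<Rightarrow> (real \<Rightarrow> 'a) \<Rightarrow> real \<Rightarrow> 'a" where
  "loop_join p q = (\<lambda>t. if t \<le> 1/2 then p (2 * t) else q (2 * t - 1))"

definition fundamental_group :: "'a topology \<Rightarrow> 'a \<Rightarrow> (real \<Rightarrow> 'a) set monoid" where
  "fundamental_group X x =
     \<lparr>carrier = loop_class X x ` Collect (loop_at X x),
      mult = (\<lambda>A B. \<Union>p\<in>A. \<Union>q\<in>B. loop_class X x (loop_join p q)),
      one = loop_class X x (\<lambda>t. x)\<rparr>"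

section \<open>Closed oriented surfaces\<close>

text \<open>The closed oriented surface of genus \<open>g \<ge> 1\<close> (the connected sum of \<open>g\<close> tori) is
  obtained from a polygon with \<open>4 * g\<close> sides by gluing sides in pairs. The polygon is
  represented by the closed unit disc in the complex plane, its \<open>k\<close>-th side, for
  \<open>k < 4 * g\<close>, by the arc \<open>t \<mapsto> polygon_side g k t\<close> with \<open>t\<close> in \<open>{0..1}\<close>. Read
  counterclockwise, the sides are labelled
  \<open>a\<^sub>0 b\<^sub>0 a\<^sub>0\<^sup>-\<^sup>1 b\<^sub>0\<^sup>-\<^sup>1 a\<^sub>1 b\<^sub>1 a\<^sub>1\<^sup>-\<^sup>1 b\<^sub>1\<^sup>-\<^sup>1 \<dots>\<close>; the two sides with the same
  letter are glued with opposite directions, which makes the surface orientable.\<close>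

definition polygon_side :: "nat \<Rightarrow> nat \<Rightarrow> real \<Rightarrow> complex" where
  "polygon_side g k t = cis (2 * pi * (real k + t) / real (4 * g))"

inductive glued :: "nat \<Rightarrow> complex \<Rightarrow> complex \<Rightarrow> bool" for g :: nat where
  a: "\<lbrakk>i < g; 0 \<le> t; t \<le> 1\<rbrakk>
        \<Longrightarrow> glued g (polygon_side g (4 * i) t) (polygon_side g (4 * i + 2) (1 - t))"
| b: "\<lbrakk>i < g; 0 \<le> t; t \<le> 1\<rbrakk>
        \<Longrightarrow> glued g (polygon_side g (4 * i + 1) t) (polygon_side g (4 * i + 3) (1 - t))"

text \<open>\<open>X\<close> is, up to homeomorphism, the quotient space of the polygon by the equivalence
  relation that the side gluings generate.\<close>

definition closed_oriented_surface :: "nat \<Rightarrow> 'a topology \<Rightarrow> bool" where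
  "closed_oriented_surface g X \<longleftrightarrow>
     (\<exists>f. quotient_map (subtopology euclidean (cball 0 1)) X f \<and>
          (\<forall>z\<in>cball 0 1. \<forall>w\<in>cball 0 1. f z = f w \<longleftrightarrow> equivclp (glued g) z w))"

text \<open>The topology \<open>X\<close> is an arbitrary one, not the standard one of \<open>complex\<close>; the type
  \<open>complex\<close> serves only as a supply of points. As a surface has the cardinality of the
  continuum, every closed oriented surface has a homeomorphic copy \<open>X\<close> of this type.\<close>

definition surface_group :: "('a, 'b) monoid_scheme \<Rightarrow> bool" where
  "surface_group \<Gamma> \<longleftrightarrow> group \<Gamma> \<and>
     (\<exists>g\<ge>2. \<exists>(X :: complex topology) x.
        closed_oriented_surface g X \<and> x \<in> topspace X \<and> \<Gamma> \<cong> fundamental_group X x)"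

end

theory Submission
  imports Defs
begin

text \<open>Both directions deform a generating tuple of a dense subgroup by an element \<open>s\<close> of the closure of
  the cyclic group generated by some \<open>c\<close>. The group generated by the deformed tuple remains dense,
  and by Baire's theorem \<open>s\<close> avoids countably many closed sets as soon as each of them contains
  only finitely many powers of \<open>c\<close>; so relations have to be excluded only for \<open>s = c\<^sup>n\<close> with
  \<open>n\<close> large, which is combinatorics of words.

  A surface group maps onto a free group of rank 2, with generators that are sent to free generators
  \<open>c\<close> and \<open>y\<^sub>i\<close> (the latter need not be distinct). Replacing \<open>y\<^sub>i\<close> by
  \<open>s\<^sup>i y\<^sub>i s\<^sup>-\<^sup>i\<close> makes the generators free. The same trick changes the rank of a dense
  free subgroup to an even number \<open>2 * r\<close>. Then the free group is the fundamental group of a surface of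
  genus \<open>r\<close> with one boundary curve \<open>c\<close>, and the closed surface of genus \<open>2 * r\<close> is the
  double of this surface. As \<open>s\<close> commutes with \<open>c\<close>, the identity on one half and conjugation by
  \<open>s\<close> on the other one fit together to a homomorphism of the surface group; it is injective for
  \<open>s = c\<^sup>n\<close>, \<open>n\<close> large, up to any given finite set of elements, by a ping-pong argument.

  Of the fundamental group of the glued polygon only this is needed: the side generators generate it
  and satisfy the surface relation, and any elements of a group that satisfy the surface relation are
  the images of the side generators under a homomorphism, the holonomy of a covering.\<close>

subsection \<open>Reduced words\<close>

text \<open>A closed set with interior in the closure of the powers of \<open>c\<close> contains a
  power of \<open>c\<close>, and recurrence in a compact group turns one power into infinitely many.
  This is why finiteness for each single relation is enough. The obstacle on the surface side is to
  recognize the trivial element of the surface group. \<open>double_dichotomy\<close> gets around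
  it: a formal product from the two halves either can be rewritten until it is trivial in every
  group in which both halves agree on the boundary word, or it is nontrivial after twisting by
  \<open>c\<close> to the power \<open>n\<close> for all but finitely many \<open>n\<close>. With
  the surface group itself as the test group, a product that is nontrivial there has only finitely
  many bad powers. The rank becomes \<open>2 * r\<close> since each half of the closed surface of
  genus \<open>2 * r\<close>, cut along a separating curve, has a free fundamental group of this
  rank. The exponent \<open>i\<close> in the twist of the \<open>i\<close>-th generator is what
  makes equal generators independent.\<close>

definition inv_letter :: "'x \<times> bool \<Rightarrow> 'x \<times> bool" where
  "inv_letter l = (fst l, \<not> snd l)"

definition inv_word :: "('x \<times> bool) list \<Rightarrow> ('x \<times> bool) list" where
  "inv_word w = rev (map inv_letter w)"

lemma inv_letter_inv_letter [simp]: "inv_letter (inv_letter l) = l"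
  by (simp add: inv_letter_def)

lemma inv_letter_eq_iff [simp]: "inv_letter l = inv_letter m \<longleftrightarrow> l = m"
  by (metis inv_letter_inv_letter)

lemma inv_word_simps [simp]:
  "inv_word [] = []" "inv_word (l # w) = inv_word w @ [inv_letter l]"
  "inv_word (u @ v) = inv_word v @ inv_word u" "inv_word (inv_word w) = w"
  "length (inv_word w) = length w" "inv_word w = [] \<longleftrightarrow> w = []"
  by (simp_all add: inv_word_def rev_map comp_def)

lemma fst_set_inv_word [simp]: "fst ` set (inv_word w) = fst ` set w"
  by (simp add: inv_word_def inv_letter_def image_image)

lemma reduced_word_iff: "reduced_word w \<longleftrightarrow> successively (\<lambda>l m. m \<noteq> inv_letter l) w"
  unfolding reduced_word_def
  by (rule successively_cong) (auto simp: inv_letter_def)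

lemma reduced_word_Nil [simp]: "reduced_word []"
  by (simp add: reduced_word_def)

lemma reduced_word_single [simp]: "reduced_word [l]"
  by (simp add: reduced_word_def)

lemma reduced_word_Cons:
  "reduced_word (l # w) \<longleftrightarrow> reduced_word w \<and> (w \<noteq> [] \<longrightarrow> hd w \<noteq> inv_letter l)"
  by (auto simp: reduced_word_iff successively_Cons)

lemma reduced_word_append:
  "reduced_word (u @ v) \<longleftrightarrow>
     reduced_word u \<and> reduced_word v \<and> (u \<noteq> [] \<and> v \<noteq> [] \<longrightarrow> hd v \<noteq> inv_letter (last u))"
  by (auto simp: reduced_word_iff successively_append_iff)

lemma reduced_word_inv_word [simp]: "reduced_word (inv_word w) \<longleftrightarrow> reduced_word w"
proof -
  have "reduced_word (inv_word w)" if "reduced_word w" for w :: "('a \<times> bool) list"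
    using that
  proof (induction w)
    case (Cons l w)
    then show ?case
      by (cases w) (auto simp: reduced_word_Cons reduced_word_append)
  qed simp
  from this[of w] this[of "inv_word w"] show ?thesis by auto
qed

text \<open>Left multiplication by a letter in the free group of reduced words. As in van der
  Waerden's construction, letters act as permutations of the reduced words, so the group law is at
  hand before associativity is known.\<close>

definition cons_letter :: "'x \<times> bool \<Rightarrow> ('x \<times> bool) list \<Rightarrow> ('x \<times> bool) list" where
  "cons_letter l w = (if w \<noteq> [] \<and> hd w = inv_letter l then tl w else l # w)"

definition act_word :: "('x \<times> bool) list \<Rightarrow> ('x \<times> bool) list \<Rightarrow> ('x \<times> bool) list" where
  "act_word u w = foldr cons_letter u w"

abbreviation reduce_word :: "('x \<times> bool) list \<Rightarrow> ('x \<times> bool) list" where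
  "reduce_word u \<equiv> act_word u []"

lemma act_word_simps [simp]:
  "act_word [] w = w" "act_word (l # u) w = cons_letter l (act_word u w)"
  "act_word (u @ v) w = act_word u (act_word v w)"
  by (simp_all add: act_word_def)

lemma reduced_cons_letter [intro]: "reduced_word w \<Longrightarrow> reduced_word (cons_letter l w)"
  by (cases w) (auto simp: cons_letter_def reduced_word_Cons)

lemma reduced_act_word [intro]: "reduced_word w \<Longrightarrow> reduced_word (act_word u w)"
  by (induction u) auto

lemma cons_letter_cancel [simp]:
  "reduced_word w \<Longrightarrow> cons_letter (inv_letter l) (cons_letter l w) = w"
  "reduced_word w \<Longrightarrow> cons_letter l (cons_letter (inv_letter l) w) = w"
  by (cases w; force simp: cons_letter_def reduced_word_Cons)+

lemma act_inv_word_cancel [simp]: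
  "reduced_word w \<Longrightarrow> act_word (inv_word u) (act_word u w) = w"
  "reduced_word w \<Longrightarrow> act_word u (act_word (inv_word u) w) = w"
  by (induction u arbitrary: w) (auto simp: reduced_act_word reduced_cons_letter)

lemma act_reduced: "reduced_word (u @ w) \<Longrightarrow> act_word u w = u @ w"
  by (induction u) (auto simp: reduced_word_Cons cons_letter_def)

lemma reduce_reduced [simp]: "reduced_word u \<Longrightarrow> reduce_word u = u"
  using act_reduced[of u "[]"] by simp

text \<open>The germ of associativity. It has content only if \<open>l\<close> cancels against the
  first letter of \<open>v\<close>; then it says that a letter and its inverse act as inverse
  permutations of the reduced words.\<close>

lemma act_cons_letter:
  "reduced_word v \<Longrightarrow> reduced_word w \<Longrightarrow>
    act_word (cons_letter l v) w = cons_letter l (act_word v w)"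
proof (cases "v \<noteq> [] \<and> hd v = inv_letter l")
  case True
  then obtain v' where "v = inv_letter l # v'" by (cases v) auto
  moreover assume "reduced_word w"
  moreover from calculation have "cons_letter l v = v'" by (simp add: cons_letter_def)
  ultimately show ?thesis by (simp add: reduced_act_word)
next
  case False
  then have "cons_letter l v = l # v" by (auto simp: cons_letter_def)
  then show ?thesis by simp
qed

lemma act_reduce_word:
  "reduced_word w \<Longrightarrow> act_word (reduce_word u) w = act_word u w"
  by (induction u) (auto simp: act_cons_letter reduced_act_word)

text \<open>Makes the cancelled part \<open>r\<close> explicit; the arguments about powers of a word
  below compare the lengths of \<open>a\<close> and \<open>r\<close>.\<close>

lemma act_word_decomp:
  assumes "reduced_word u" "reduced_word w"
  obtains a b r where "u = a @ inv_word r" "w = r @ b" "act_word u w = a @ b"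
  using assms
proof (induction u arbitrary: w thesis rule: rev_induct)
  case Nil
  from Nil(1)[of "[]" "[]" w] show ?case by simp
next
  case (snoc l u)
  show ?case
  proof (cases "w \<noteq> [] \<and> hd w = inv_letter l")
    case True
    then obtain w' where w: "w = inv_letter l # w'" by (cases w) auto
    have "reduced_word u" "reduced_word w'"
      using snoc.prems w by (auto simp: reduced_word_append reduced_word_Cons)
    then obtain a b r where 1: "u = a @ inv_word r" "w' = r @ b" "act_word u w' = a @ b"
      using snoc.IH[of w'] by metis
    have "act_word (u @ [l]) w = a @ b"
      using 1 w by (simp add: cons_letter_def)
    moreover have "u @ [l] = a @ inv_word (inv_letter l # r)" "w = (inv_letter l # r) @ b"
      using 1 w by auto
    ultimately show ?thesis using snoc.prems(1) by metis
  next
    case False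
    then have "reduced_word (l # w)"
      using snoc.prems by (auto simp: reduced_word_Cons)
    then have "reduced_word (u @ l # w)"
      using snoc.prems by (auto simp: reduced_word_append)
    then have "act_word (u @ [l]) w = (u @ [l]) @ w"
      using act_reduced[of "u @ [l]" w] by (simp del: act_word_simps)
    then show ?thesis using snoc.prems(1)[of "u @ [l]" "[]" w] by (simp del: act_word_simps)
  qed
qed

lemma set_act_word_subset:
  "set (act_word u w) \<subseteq> set u \<union> set w"
  by (induction u) (auto simp: cons_letter_def dest: list.set_sel(2) split: if_splits)

lemma fst_act_word_subset: "fst ` set (act_word u w) \<subseteq> fst ` set u \<union> fst ` set w"
  using set_act_word_subset[of u w] by blast

lemma length_act_word: "length (act_word u w) \<le> length u + length w"
  by (induction u) (auto simp: cons_letter_def)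

subsection \<open>Evaluation of words\<close>

definition eval_word :: "('a, 'b) monoid_scheme \<Rightarrow> ('x \<Rightarrow> 'a) \<Rightarrow> ('x \<times> bool) list \<Rightarrow> 'a" where
  "eval_word G z w = word_value G (map (\<lambda>(x, e). (z x, e)) w)"

definition eval_letter :: "('a, 'b) monoid_scheme \<Rightarrow> ('x \<Rightarrow> 'a) \<Rightarrow> 'x \<times> bool \<Rightarrow> 'a" where
  "eval_letter G z l = (if snd l then z (fst l) else inv\<^bsub>G\<^esub> (z (fst l)))"

lemma eval_word_Nil [simp]: "eval_word G z [] = \<one>\<^bsub>G\<^esub>"
  by (simp add: eval_word_def word_value_def)

lemma eval_word_Cons:
  "eval_word G z (l # w) = eval_letter G z l \<otimes>\<^bsub>G\<^esub> eval_word G z w"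
  by (cases l) (simp add: eval_word_def word_value_def eval_letter_def)

lemma eval_letter_True [simp]: "eval_letter G z (x, True) = z x"
  and eval_letter_False [simp]: "eval_letter G z (x, False) = inv\<^bsub>G\<^esub> (z x)"
  by (simp_all add: eval_letter_def)

lemma eval_word_cong:
  "(\<And>l. l \<in> set w \<Longrightarrow> z (fst l) = z' (fst l)) \<Longrightarrow> eval_word G z w = eval_word G z' w"
proof (induction w)
  case (Cons l w)
  have "z (fst l) = z' (fst l)" by (rule Cons.prems) simp
  moreover have "eval_word G z w = eval_word G z' w" by (rule Cons.IH, rule Cons.prems) simp
  ultimately show ?case by (simp add: eval_word_Cons eval_letter_def)
qed simp

context group
begin

lemma eval_letter_closed [intro, simp]: "z (fst l) \<in> carrier G \<Longrightarrow> eval_letter G z l \<in> carrier G"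
  by (simp add: eval_letter_def)

lemma eval_letter_inv_letter:
  "z (fst l) \<in> carrier G \<Longrightarrow> eval_letter G z (inv_letter l) = inv (eval_letter G z l)"
  by (simp add: eval_letter_def inv_letter_def)

lemma eval_word_closed: "z ` fst ` set w \<subseteq> carrier G \<Longrightarrow> eval_word G z w \<in> carrier G"
  by (induction w) (auto simp: eval_word_Cons)

lemma eval_word_append:
  "z ` fst ` set u \<subseteq> carrier G \<Longrightarrow> z ` fst ` set v \<subseteq> carrier G \<Longrightarrow>
    eval_word G z (u @ v) = eval_word G z u \<otimes> eval_word G z v"
  by (induction u) (auto simp: eval_word_Cons m_assoc eval_word_closed)

lemma eval_inv_word:
  "z ` fst ` set u \<subseteq> carrier G \<Longrightarrow> eval_word G z (inv_word u) = inv (eval_word G z u)"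
proof (induction u)
  case (Cons l u)
  then have "z ` fst ` set (inv_word u) \<subseteq> carrier G" by simp
  moreover have "z ` fst ` set [inv_letter l] \<subseteq> carrier G"
    using Cons.prems by (simp add: inv_letter_def)
  ultimately show ?case using Cons
    by (simp add: eval_word_append eval_word_Cons eval_word_closed inv_mult_group
        eval_letter_inv_letter)
qed simp

lemma eval_cons_letter:
  assumes "z (fst l) \<in> carrier G" "z ` fst ` set w \<subseteq> carrier G"
  shows "eval_word G z (cons_letter l w) = eval_letter G z l \<otimes> eval_word G z w"
proof (cases w)
  case (Cons m v)
  have "eval_letter G z l \<otimes> (inv (eval_letter G z l) \<otimes> eval_word G z v) = eval_word G z v"
    using assms Cons by (simp add: eval_word_closed m_assoc[symmetric])
  then show ?thesis using assms Cons
    by (auto simp: cons_letter_def eval_word_Cons eval_letter_inv_letter)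
qed (auto simp: cons_letter_def eval_word_Cons)

lemma eval_act_word:
  assumes "z ` fst ` set u \<subseteq> carrier G" "z ` fst ` set w \<subseteq> carrier G"
  shows "eval_word G z (act_word u w) = eval_word G z u \<otimes> eval_word G z w"
  using assms
proof (induction u)
  case (Cons l u)
  have "z ` fst ` set (act_word u w) \<subseteq> carrier G"
    using fst_act_word_subset[of u w] Cons.prems(1,2) unfolding list.set by blast
  then show ?case
    using Cons by (simp add: eval_cons_letter eval_word_Cons m_assoc eval_word_closed)
qed (simp add: eval_word_closed)

lemma eval_reduce_word:
  assumes "z ` fst ` set u \<subseteq> carrier G"
  shows "eval_word G z (reduce_word u) = eval_word G z u"
  using eval_act_word[of z u "[]"] assms by (simp add: eval_word_closed)

end

lemma (in group_hom) hom_eval_word: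
  "z ` fst ` set w \<subseteq> carrier G \<Longrightarrow> h (eval_word G z w) = eval_word H (\<lambda>x. h (z x)) w"
  by (induction w) (auto simp: eval_word_Cons eval_letter_def G.eval_word_closed)

text \<open>The values of \<open>z\<close> on \<open>X\<close> freely generate a subgroup; for \<open>X\<close> with more than one element
  this includes that \<open>z\<close> is injective.\<close>

definition free_family :: "('a, 'b) monoid_scheme \<Rightarrow> ('x \<Rightarrow> 'a) \<Rightarrow> 'x set \<Rightarrow> bool" where
  "free_family G z X \<longleftrightarrow> z ` X \<subseteq> carrier G \<and>
     (\<forall>w. fst ` set w \<subseteq> X \<and> reduced_word w \<and> w \<noteq> [] \<longrightarrow> eval_word G z w \<noteq> \<one>\<^bsub>G\<^esub>)"

lemma (in group) free_family_inj:
  assumes "free_family G z X"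
  shows "inj_on z X"
proof (rule inj_onI, rule ccontr)
  fix x y assume xy: "x \<in> X" "y \<in> X" "z x = z y" "x \<noteq> y"
  then have "reduced_word [(x, True), (y, False)]"
    by (simp add: reduced_word_def)
  moreover have "eval_word G z [(x, True), (y, False)] = \<one>"
    using xy assms by (auto simp: eval_word_Cons free_family_def)
  ultimately show False
    using assms xy unfolding free_family_def by (auto dest!: spec[of _ "[(x, True), (y, False)]"])
qed

lemma (in group) free_family_free_basis:
  assumes "free_family G z X" "generate G (z ` X) = carrier G"
  shows "free_basis G (z ` X)"
  unfolding free_basis_def
proof (intro conjI allI impI)
  show "z ` X \<subseteq> carrier G" "generate G (z ` X) = carrier G"
    using assms by (auto simp: free_family_def)
  fix w assume w: "fst ` set w \<subseteq> z ` X \<and> reduced_word w \<and> w \<noteq> []"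
  define u where "u = map (\<lambda>(x, e). (the_inv_into X z x, e)) w"
  have inj: "inj_on z X" using assms free_family_inj by blast
  have "fst ` set u \<subseteq> X"
    using w the_inv_into_into[OF inj] by (fastforce simp: u_def)
  moreover have wu: "w = map (\<lambda>(x, e). (z x, e)) u"
    unfolding u_def map_map using w f_the_inv_into_f[OF inj]
    by (intro sym[OF map_idI]) force
  moreover have "reduced_word u"
  proof -
    have "successively (\<lambda>(x, e) (y, d). x = y \<longrightarrow> e = d) w" using w by (simp add: reduced_word_def)
    then have "successively (\<lambda>(x, e) (y, d). z x = z y \<longrightarrow> e = d) u"
      unfolding wu successively_map by (rule successively_mono) auto
    then show ?thesis unfolding reduced_word_def by (rule successively_mono) auto
  qed
  moreover have "u \<noteq> []" using w by (simp add: u_def)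
  ultimately have "eval_word G z u \<noteq> \<one>" using assms by (auto simp: free_family_def)
  then show "word_value G w \<noteq> \<one>" using wu by (simp add: eval_word_def)
qed

subsection \<open>Dense free subgroups of compact groups\<close>

definition power_word :: "'x \<Rightarrow> int \<Rightarrow> ('x \<times> bool) list" where
  "power_word c k = replicate (nat \<bar>k\<bar>) (c, k > 0)"

lemma power_word_0 [simp]: "power_word c 0 = []"
  by (simp add: power_word_def)

lemma power_word_Nil_iff [simp]: "power_word c k = [] \<longleftrightarrow> k = 0"
  by (simp add: power_word_def)

lemma fst_hd_power_word: "k \<noteq> 0 \<Longrightarrow> hd (power_word c k @ u) = (c, k > 0)"
  by (cases "nat \<bar>k\<bar>") (auto simp: power_word_def)

lemma fst_set_power_word: "fst ` set (power_word c k) \<subseteq> {c}"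
  by (auto simp: power_word_def)

lemma cons_letter_power_word:
  assumes "u \<noteq> [] \<Longrightarrow> fst (hd u) \<noteq> c"
  shows "cons_letter (c, e) (power_word c k @ u) = power_word c (k + (if e then 1 else -1)) @ u"
proof -
  consider "k = 0" | "k > 0" | "k < 0" by linarith
  then show ?thesis
  proof cases
    case 1
    then show ?thesis using assms
      by (auto simp: cons_letter_def power_word_def inv_letter_def)
  next
    case 2
    then have "nat k = Suc (nat (k - 1))" "nat (k + 1) = Suc (nat k)" by auto
    then show ?thesis using 2
      by (cases "k = 1") (auto simp: cons_letter_def power_word_def inv_letter_def eval_nat_numeral)
  next
    case 3
    then have "nat (- k) = Suc (nat (- k - 1))" "nat (1 - k) = Suc (nat (- k))" by auto
    then show ?thesis using 3
      by (cases "k = -1") (auto simp: cons_letter_def power_word_def inv_letter_def eval_nat_numeral)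
  qed
qed

text \<open>With integer exponents, cancellation between powers of one letter becomes addition. The
  condition on \<open>u\<close> says that the second power does not continue into
  \<open>u\<close>.\<close>

lemma act_power_word:
  assumes "u \<noteq> [] \<Longrightarrow> fst (hd u) \<noteq> c"
  shows "act_word (power_word c j) (power_word c k @ u) = power_word c (j + k) @ u"
proof -
  have "act_word (replicate n (c, e)) (power_word c k @ u) =
      power_word c ((if e then int n else - int n) + k) @ u" for n e
    by (induction n) (auto simp: cons_letter_power_word[OF assms] algebra_simps)
  from this[of "nat \<bar>j\<bar>" "j > 0"] show ?thesis
    by (auto simp: power_word_def[of c j])
qed

text \<open>The conjugate of the letter \<open>t i\<close> by the power \<open>i * n\<close> of
  \<open>t 0\<close>; for \<open>i = 0\<close> it is a single letter. The different exponents
  separate letters that \<open>t\<close> identifies.\<close>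

definition conj_word :: "(nat \<Rightarrow> 'x) \<Rightarrow> nat \<Rightarrow> nat \<times> bool \<Rightarrow> ('x \<times> bool) list" where
  "conj_word t n l =
     power_word (t 0) (int (fst l * n)) @ [(t (fst l), snd l)] @ power_word (t 0) (- int (fst l * n))"

lemma fst_set_conj_word: "fst ` set (conj_word t n l) \<subseteq> {t 0, t (fst l)}"
  using fst_set_power_word[of "t 0"] unfolding conj_word_def set_append image_Un Un_subset_iff
  by (auto simp: power_word_def)

lemma fst_set_concat_conj_word:
  "fst ` set w \<subseteq> {..m} \<Longrightarrow> fst ` set (concat (map (conj_word t n) w)) \<subseteq> t ` {..m}"
proof (induction w)
  case (Cons l w)
  then have "{t 0, t (fst l)} \<subseteq> t ` {..m}" by auto
  with fst_set_conj_word[of t n l] have "fst ` set (conj_word t n l) \<subseteq> t ` {..m}"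
    by (rule subset_trans)
  with Cons show ?case by (simp add: image_Un)
qed simp

text \<open>If \<open>n\<close> exceeds the length of \<open>w\<close>, no letter \<open>t i\<close> with \<open>i > 0\<close> is ever cancelled.\<close>

lemma reduce_conj_word:
  assumes "reduced_word w" "length w < n" "fst ` set w \<subseteq> {..m}"
    and t: "\<And>i. 1 \<le> i \<Longrightarrow> i \<le> m \<Longrightarrow> t i \<noteq> t 0"
  shows "\<exists>l. \<bar>l\<bar> \<le> int (length w) \<and>
     (w = power_word 0 l \<and> reduce_word (concat (map (conj_word t n) w)) = power_word (t 0) l \<or>
      (\<exists>i e w' u. w = power_word 0 l @ (i, e) # w' \<and> 1 \<le> i \<and>
         reduce_word (concat (map (conj_word t n) w)) = 
           power_word (t 0) (l + int (i * n)) @ (t i, e) # u))"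
  using assms(1-3)
proof (induction w)
  case (Cons le w)
  obtain i e where le: "le = (i, e)" by (cases le)
  let ?R = "reduce_word (concat (map (conj_word t n) w))"
  have red: "reduced_word w" "w \<noteq> [] \<Longrightarrow> hd w \<noteq> (i, \<not> e)" and im: "i \<le> m"
    using Cons.prems le by (auto simp: reduced_word_Cons inv_letter_def)
  obtain l where l: "\<bar>l\<bar> \<le> int (length w)"
    and cases: "w = power_word 0 l \<and> ?R = power_word (t 0) l \<or>
      (\<exists>j d w' u. w = power_word 0 l @ (j, d) # w' \<and> 1 \<le> j \<and>
         ?R = power_word (t 0) (l + int (j * n)) @ (t j, d) # u)"
    using Cons.IH red Cons.prems by auto
  \<comment> \<open>A pure power of the letter \<open>0\<close> is treated as \<open>j = 0\<close>,
    \<open>v = []\<close>, so that both cases give \<open>?R\<close> the same shape.\<close>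
  from cases obtain j d v where w: "?R = power_word (t 0) (l + int (j * n)) @ v"
    and v: "v = [] \<and> j = 0 \<and> w = power_word 0 l \<or>
      (\<exists>w' u. v = (t j, d) # u \<and> w = power_word 0 l @ (j, d) # w' \<and> 1 \<le> j)"
    by force
  have v0: "fst (hd v) \<noteq> t 0" if "v \<noteq> []"
    using v that Cons.prems t by auto
  show ?case
  proof (cases "i = 0")
    case True
    let ?l = "l + (if e then 1 else - 1)"
    have 1: "reduce_word (concat (map (conj_word t n) (le # w))) 
        = power_word (t 0) (?l + int (j * n)) @ v"
      using w v0 True le by (simp add: conj_word_def cons_letter_power_word algebra_simps)
    have "(0 < l) = e" if "l \<noteq> 0"
    proof -
      have "hd w = (0, 0 < l)"
        using v fst_hd_power_word[OF that, of 0] fst_hd_power_word[OF that, of 0 "[]"] that by auto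
      moreover have "w \<noteq> []" using v that power_word_Nil_iff by (metis append_is_Nil_conv)
      ultimately show ?thesis using red(2) True by auto
    qed
    then have 2: "(0 :: nat, e) # power_word 0 l = power_word 0 ?l"
      using cons_letter_power_word[of "[]" "0::nat" e l] fst_hd_power_word[of l "0::nat" "[]"]
      by (cases "l = 0"; cases e) (simp_all add: cons_letter_def inv_letter_def)
    have "\<bar>?l\<bar> \<le> int (length (le # w))" using l by auto
    moreover have "le # power_word 0 l @ x = power_word 0 ?l @ x" for x
      using 2 le True by (metis append_Cons)
    moreover from v have
      "le # w = power_word 0 ?l \<and> power_word (t 0) (?l + int (j * n)) @ v = power_word (t 0) ?l \<or>
       (\<exists>i e w' u. le # w = power_word 0 ?l @ (i, e) # w' \<and> 1 \<le> i \<and>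
         power_word (t 0) (?l + int (j * n)) @ v = power_word (t 0) (?l + int (i * n)) @ (t i, e) # u)"
    proof (elim disjE exE conjE)
      assume "v = []" "j = 0" "w = power_word 0 l"
      then show ?thesis using 2 le True by simp
    next
      fix w' u assume "v = (t j, d) # u" "w = power_word 0 l @ (j, d) # w'" "1 \<le> j"
      then show ?thesis using calculation(2)[of "(j, d) # w'"] by blast
    qed
    ultimately show ?thesis using 1 by (intro exI[of _ ?l]) simp
  next
    case False
    let ?k = "l + int (j * n) - int (i * n)"
    let ?X = "power_word (t 0) ?k @ v"
    \<comment> \<open>Cancellation requires \<open>?k = 0\<close>. As
      \<open>\<bar>l\<bar> < n\<close>, this forces \<open>i = j\<close> and \<open>l = 0\<close>;
      then \<open>(i, e)\<close> stands directly before \<open>(i, d)\<close> in a reduced word, and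
      the signs agree.\<close>
    have "cons_letter (t i, e) ?X = (t i, e) # ?X"
    proof (cases "?k = 0")
      case True
      then have "l = (int i - int j) * int n" by (simp add: algebra_simps)
      moreover have "\<bar>l\<bar> < int n" using l Cons.prems(2) by simp
      ultimately have "\<bar>int i - int j\<bar> * int n < 1 * int n" by (simp add: abs_mult)
      then have "\<bar>int i - int j\<bar> < 1" by (rule mult_right_less_imp_less) simp
      then have ij: "i = j" by simp
      then have "l = 0" using \<open>l = _\<close> by simp
      then have "v \<noteq> []" "w = (i, d) # tl w" "hd v = (t i, d)" using v False ij by auto
      then have "hd w = (i, d)" "w \<noteq> []" by (metis list.sel(1), metis list.distinct(1))
      then have "d = e" using red(2) by auto
      then have "hd v = (t i, e)" using \<open>hd v = (t i, d)\<close> by simp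
      then show ?thesis using True \<open>v \<noteq> []\<close> by (auto simp: cons_letter_def inv_letter_def)
    next
      case neq: False
      show ?thesis using fst_hd_power_word[OF neq, of "t 0" v] t[of i] False im
        by (auto simp: cons_letter_def inv_letter_def)
    qed
    then have "reduce_word (concat (map (conj_word t n) (le # w))) 
        = power_word (t 0) (0 + int (i * n)) @ (t i, e) # ?X"
      using w v0 le act_power_word[of "(t i, e) # ?X" "t 0" "int (i * n)" 0] t[of i] False im
      by (simp add: conj_word_def act_power_word algebra_simps)
    then show ?thesis using False le by (intro exI[of _ 0]) auto
  qed
qed auto

lemma reduce_conj_word_neq_Nil:
  assumes "reduced_word w" "length w < n" "fst ` set w \<subseteq> {..m}" "w \<noteq> []"
    and "\<And>i. 1 \<le> i \<Longrightarrow> i \<le> m \<Longrightarrow> t i \<noteq> t 0"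
  shows "reduce_word (concat (map (conj_word t n) w)) \<noteq> []"
proof -
  have *: "power_word 0 l = [] \<longleftrightarrow> power_word (t 0) l = []" for l by simp
  show ?thesis using reduce_conj_word[of w n m t] assms * by fastforce
qed

context group
begin

lemma eval_power_word:
  assumes "z c \<in> carrier G"
  shows "eval_word G z (power_word c k) = z c [^] k"
proof -
  have "eval_word G z (replicate n (c, True)) = z c [^] n" for n :: nat
  proof (induction n)
    case (Suc n)
    then show ?case using assms nat_pow_Suc2[of "z c" n] by (simp add: eval_word_Cons)
  qed simp
  moreover have "eval_word G z (replicate n (c, False)) = inv (z c [^] n)" for n :: nat
    using assms by (induction n) (simp_all add: eval_word_Cons inv_mult_group)
  moreover obtain n where "k = int n \<and> n > 0 \<or> k = - int n"
    by (metis int_cases2 neq0_conv of_nat_0 minus_zero)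
  ultimately show ?thesis using assms
    by (elim disjE) (simp_all add: power_word_def int_pow_int int_pow_neg)
qed

lemma eval_concat_conj_word:
  assumes "z ` t ` {..m} \<subseteq> carrier G" "fst ` set w \<subseteq> {..m}"
  shows "eval_word G z (concat (map (conj_word t n) w)) =
    eval_word G (\<lambda>i. (z (t 0) [^] n) [^] i \<otimes> z (t i) \<otimes> inv ((z (t 0) [^] n) [^] i)) w"
  using assms(2)
proof (induction w)
  case (Cons l w)
  let ?z = "\<lambda>i. (z (t 0) [^] n) [^] i \<otimes> z (t i) \<otimes> inv ((z (t 0) [^] n) [^] i)"
  have zt: "z (t i) \<in> carrier G" if "i \<le> m" for i using assms(1) that by auto
  have l: "fst l \<le> m" using Cons.prems by auto
  have sub: "z ` fst ` set (conj_word t n l) \<subseteq> carrier G" if "fst l \<le> m" for l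
    using image_mono[OF fst_set_conj_word[of t n l], of z] by (rule subset_trans) (simp add: zt that)
  have "z ` fst ` set (concat (map (conj_word t n) w)) \<subseteq> z ` t ` {..m}"
    by (rule image_mono, rule fst_set_concat_conj_word) (use Cons.prems in auto)
  then have *: "z ` fst ` set (concat (map (conj_word t n) w)) \<subseteq> carrier G"
    using assms(1) by (rule subset_trans)
  have "eval_word G z (conj_word t n l) = eval_letter G ?z l"
  proof -
    obtain i e where le: "l = (i, e)" by (cases l)
    define c y where "c = z (t 0)" and "y = z (t i)"
    have cy: "c \<in> carrier G" "y \<in> carrier G" using zt[of 0] zt[of i] l le by (auto simp: c_def y_def)
    define p where "p = (c [^] n) [^] i"
    have p: "p \<in> carrier G" "c [^] int (i * n) = p" "c [^] (- int (i * n)) = inv p"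
      using cy by (simp_all only: int_pow_neg int_pow_int nat_pow_closed p_def nat_pow_pow mult.commute)
    have pw: "z ` fst ` set (power_word (t 0) k) \<subseteq> carrier G" for k
      using fst_set_power_word[of "t 0" k] zt[of 0] by auto
    have "eval_word G z (conj_word t n l) = p \<otimes> (eval_letter G z (t i, e) \<otimes> inv p)"
      using pw cy(2) le p cy(1) unfolding conj_word_def y_def c_def
      by (simp add: eval_word_append eval_power_word eval_word_Cons eval_word_closed image_Un)
    also have "\<dots> = eval_letter G ?z l"
      using p(1) cy unfolding le
      by (cases e) (simp_all add: c_def[symmetric] y_def[symmetric] p_def[symmetric] m_assoc inv_mult_group)
    finally show ?thesis .
  qed
  then show ?case using Cons * sub[OF l] by (simp add: eval_word_append eval_word_Cons)
qed simp

end


section \<open>Subgroups generated by free families\<close>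

lemma (in group) subgroup_nat_pow_closed:
  assumes "subgroup H G" "x \<in> H"
  shows "x [^] (n :: nat) \<in> H"
  by (induction n) (simp_all add: assms subgroup.one_closed subgroup.m_closed)

lemma (in group) eval_word_subgroup:
  assumes "subgroup H G" "z ` fst ` set w \<subseteq> H"
  shows "eval_word (G\<lparr>carrier := H\<rparr>) z w = eval_word G z w"
  using assms(2)
proof (induction w)
  case (Cons l w)
  then have "z (fst l) \<in> H" by simp
  then have "eval_letter (G\<lparr>carrier := H\<rparr>) z l = eval_letter G z l"
    using m_inv_consistent[OF assms(1)] by (simp add: eval_letter_def)
  then show ?case using Cons by (simp add: eval_word_Cons)
qed simp

lemma (in group) free_group_of_rank_generate:
  assumes "free_family G z X" "finite X"
  shows "free_group_of_rank (G\<lparr>carrier := generate G (z ` X)\<rparr>) (card X)"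
proof -
  let ?H = "generate G (z ` X)"
  have sub: "z ` X \<subseteq> carrier G" using assms(1) by (simp add: free_family_def)
  then have H: "subgroup ?H G" by (rule generate_is_subgroup)
  then interpret H: group "G\<lparr>carrier := ?H\<rparr>" by (rule subgroup_imp_group)
  have zH: "z ` X \<subseteq> ?H" using generate.incl by (metis subsetI)
  have "eval_word (G\<lparr>carrier := ?H\<rparr>) z w = eval_word G z w" if "fst ` set w \<subseteq> X" for w
    using image_mono[OF that, of z] zH by (intro eval_word_subgroup[OF H]) simp
  then have "free_family (G\<lparr>carrier := ?H\<rparr>) z X"
    using assms(1) zH by (simp add: free_family_def)
  moreover have "generate (G\<lparr>carrier := ?H\<rparr>) (z ` X) = ?H"
    using generate_consistent[OF zH H] by simp
  ultimately have "free_basis (G\<lparr>carrier := ?H\<rparr>) (z ` X)"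
    by (intro H.free_family_free_basis) auto
  moreover have "card (z ` X) = card X"
    using free_family_inj[OF assms(1)] by (rule card_image)
  ultimately show ?thesis unfolding free_group_of_rank_def
    using assms(2) H.group_axioms by blast
qed

section \<open>Continuity of word maps and closures of subgroups\<close>

context hausdorff_topological_group
begin

lemma continuous_map_mult:
  "continuous_map X T f \<Longrightarrow> continuous_map X T g \<Longrightarrow> continuous_map X T (\<lambda>x. f x \<otimes> g x)"
  using continuous_map_compose[OF _ continuous_mult, of X "\<lambda>x. (f x, g x)"]
  by (simp add: continuous_map_pairwise comp_def)

lemma continuous_map_inverse:
  "continuous_map X T f \<Longrightarrow> continuous_map X T (\<lambda>x. inv (f x))"
  using continuous_map_compose[OF _ continuous_inv, of X f] by (simp add: comp_def)

lemma continuous_map_const_carrier: "a \<in> carrier G \<Longrightarrow> continuous_map X T (\<lambda>x. a)"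
  by (simp add: topspace_eq)

lemma continuous_map_nat_power:
  "continuous_map X T f \<Longrightarrow> continuous_map X T (\<lambda>x. f x [^] (n :: nat))"
  by (induction n) (simp_all add: continuous_map_mult topspace_eq)

lemma continuous_map_eval_word:
  assumes "\<And>i. i \<in> fst ` set w \<Longrightarrow> continuous_map X T (\<lambda>x. z x i)"
  shows "continuous_map X T (\<lambda>x. eval_word G (z x) w)"
  using assms
proof (induction w)
  case (Cons l w)
  then show ?case
    by (cases l; cases "snd l")
      (simp_all add: eval_word_Cons continuous_map_mult continuous_map_inverse)
qed (simp add: topspace_eq)

lemma closedin_eval_word_eq_one:
  assumes "\<And>i. i \<in> fst ` set w \<Longrightarrow> continuous_map T T (\<lambda>x. z x i)"
  shows "closedin T {x \<in> topspace T. eval_word G (z x) w = \<one>}"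
proof -
  have "closedin T {\<one>}"
    using hausdorff by (simp add: closedin_Hausdorff_sing_eq topspace_eq)
  from closedin_continuous_map_preimage[OF continuous_map_eval_word[OF assms] this]
  show ?thesis by simp
qed

lemma closure_of_mult_closed:
  assumes "subgroup H G" "x \<in> T closure_of H" "y \<in> T closure_of H"
  shows "x \<otimes> y \<in> T closure_of H"
proof -
  have "(\<lambda>(x, y). x \<otimes> y) ` (prod_topology T T closure_of (H \<times> H)) \<subseteq>
      T closure_of ((\<lambda>(x, y). x \<otimes> y) ` (H \<times> H))"
    by (rule continuous_map_image_closure_subset[OF continuous_mult])
  also have "\<dots> \<subseteq> T closure_of H"
    using subgroup.m_closed[OF assms(1)] by (intro closure_of_mono) auto
  finally show ?thesis using assms by (auto simp: closure_of_Times)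
qed

lemma subgroup_closure_of:
  assumes "subgroup H G"
  shows "subgroup (T closure_of H) G"
proof
  show "T closure_of H \<subseteq> carrier G"
    using closure_of_subset_topspace[of T H] topspace_eq by simp
  show "\<one> \<in> T closure_of H"
    using closure_of_subset[of H T] subgroup.subset[OF assms] subgroup.one_closed[OF assms]
    by (auto simp: topspace_eq)
  show "x \<otimes> y \<in> T closure_of H" if "x \<in> T closure_of H" "y \<in> T closure_of H" for x y
    using that closure_of_mult_closed assms by blast
  show "inv x \<in> T closure_of H" if "x \<in> T closure_of H" for x
  proof -
    have "(\<lambda>x. inv x) ` (T closure_of H) \<subseteq> T closure_of ((\<lambda>x. inv x) ` H)"
      by (rule continuous_map_image_closure_subset[OF continuous_inv])
    also have "\<dots> \<subseteq> T closure_of H"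
      using subgroup.m_inv_closed[OF assms] by (intro closure_of_mono) auto
    finally show ?thesis using that by blast
  qed
qed

lemma dense_subgroup_supset:
  assumes "dense_subgroup H G T" "subgroup K G" "H \<subseteq> T closure_of K"
  shows "dense_subgroup K G T"
  using assms closure_of_mono[of H "T closure_of K" T]
  by (simp add: dense_subgroup_def closure_of_subset_topspace subset_antisym)

end

section \<open>Recurrence and Baire category in compact groups\<close>

context compact_group
begin

text \<open>Pigeonhole: finitely many sets \<open>V p\<close> with
  \<open>inv x \<otimes> y \<in> U\<close> for all \<open>x\<close>, \<open>y\<close> in
  \<open>V p\<close> cover the group, so two powers of \<open>c\<close> lie in the same one and
  their quotient lies in \<open>U\<close>.\<close>

lemma recurrence:
  assumes c: "c \<in> carrier G" and U: "openin T U" "\<one> \<in> U" and N: "N \<ge> 1"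
  shows "\<exists>k\<ge>N. c [^] (k :: nat) \<in> U"
proof -
  have div: "continuous_map (prod_topology T T) T (\<lambda>q. inv (fst q) \<otimes> snd q)"
    by (intro continuous_map_mult continuous_map_inverse continuous_map_fst continuous_map_snd)
  have "\<exists>V. openin T V \<and> p \<in> V \<and> (\<forall>x\<in>V. \<forall>y\<in>V. inv x \<otimes> y \<in> U)" if p: "p \<in> topspace T" for p
  proof -
    define W where "W = {q \<in> topspace (prod_topology T T). inv (fst q) \<otimes> snd q \<in> U}"
    have "openin (prod_topology T T) W"
      unfolding W_def by (rule openin_continuous_map_preimage[OF div U(1)])
    moreover have "(p, p) \<in> W" using p U topspace_eq by (simp add: W_def)
    ultimately obtain V1 V2 where "openin T V1" "openin T V2" "p \<in> V1" "p \<in> V2" "V1 \<times> V2 \<subseteq> W"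
      unfolding openin_prod_topology_alt by metis
    then show ?thesis by (intro exI[of _ "V1 \<inter> V2"]) (auto simp: W_def)
  qed
  then obtain V where V: "\<And>p. p \<in> topspace T \<Longrightarrow> openin T (V p) \<and> p \<in> V p \<and>
      (\<forall>x\<in>V p. \<forall>y\<in>V p. inv x \<otimes> y \<in> U)" by metis
  have "\<exists>F. finite F \<and> F \<subseteq> V ` topspace T \<and> topspace T \<subseteq> \<Union>F"
    using V by (intro compact[unfolded compact_space_alt, rule_format]) auto
  then obtain F where F: "finite F" "F \<subseteq> V ` topspace T" "topspace T \<subseteq> \<Union>F" by blast
  then obtain P where P: "finite P" "P \<subseteq> topspace T" "topspace T \<subseteq> \<Union>(V ` P)"
    using finite_subset_image[OF F(1,2)] by blast
  \<comment> \<open>Only exponents that are multiples of \<open>N\<close> are distributed, so that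
    two distinct ones differ by at least \<open>N\<close>.\<close>
  have cN: "c [^] (j * N) \<in> topspace T" for j :: nat using c topspace_eq by simp
  then have "\<forall>j :: nat. \<exists>p\<in>P. c [^] (j * N) \<in> V p" using P(3) by blast
  then obtain g where g: "\<And>j :: nat. g j \<in> P \<and> c [^] (j * N) \<in> V (g j)" by metis
  have "\<not> inj g"
    using P(1) g finite_subset[of "range g" P] finite_imageD[of g UNIV] by auto
  then obtain i j where ij: "i < j" "g i = g j" unfolding inj_def by (metis linorder_neqE_nat)
  have "j * N = i * N + (j - i) * N" using ij by (simp flip: add_mult_distrib)
  then have "c [^] (j * N) = c [^] (i * N) \<otimes> c [^] ((j - i) * N)"
    using c nat_pow_mult by simp
  then have "inv (c [^] (i * N)) \<otimes> c [^] (j * N) = c [^] ((j - i) * N)"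
    using c by (simp add: m_assoc[symmetric])
  moreover have "g i \<in> topspace T" "c [^] (i * N) \<in> V (g i)" "c [^] (j * N) \<in> V (g i)"
    using g[of i] g[of j] P(2) ij by auto
  ultimately have "c [^] ((j - i) * N) \<in> U" using V[of "g i"] by metis
  moreover have "(j - i) * N \<ge> N" using ij by (cases "j - i") auto
  ultimately show ?thesis by blast
qed

text \<open>Recurrence at the unit, translated by \<open>c [^] n\<close>.\<close>

lemma infinite_powers_in_open:
  assumes c: "c \<in> carrier G" and U: "openin T U" "c [^] (n :: nat) \<in> U"
  shows "infinite {n :: nat. c [^] n \<in> U}"
proof -
  let ?V = "{x \<in> topspace T. c [^] n \<otimes> x \<in> U}"
  have V: "openin T ?V"
    using c topspace_eq
    by (intro openin_continuous_map_preimage[OF _ U(1)] continuous_map_mult) simp_all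
  have V1: "\<one> \<in> ?V" using c U topspace_eq by simp
  have "\<exists>m\<ge>N. c [^] (m :: nat) \<in> U" for N
  proof -
    obtain k where "k \<ge> Suc N" "c [^] k \<in> ?V" using recurrence[OF c V V1, of "Suc N"] by auto
    then show ?thesis using nat_pow_mult[OF c, of n k] by (intro exI[of _ "n + k"]) simp
  qed
  then show ?thesis by (simp add: infinite_nat_iff_unbounded_le)
qed

text \<open>Baire category in the compact Hausdorff space \<open>?A\<close>. If
  \<open>?A \<inter> E w\<close> had interior there, some open set of the group would meet
  \<open>?A\<close> inside \<open>E w\<close>; by density it would contain a power of
  \<open>c\<close>, and then infinitely many.\<close>

lemma generic_element:
  assumes c: "c \<in> carrier G" and W: "countable W"
    and E: "\<And>w. w \<in> W \<Longrightarrow> closedin T (E w)"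
    and fin: "\<And>w. w \<in> W \<Longrightarrow> finite {n :: nat. c [^] n \<in> E w}"
  obtains s where "s \<in> T closure_of range (\<lambda>n :: nat. c [^] n)" "\<And>w. w \<in> W \<Longrightarrow> s \<notin> E w"
proof -
  let ?C = "range (\<lambda>n :: nat. c [^] n)"
  let ?A = "T closure_of ?C"
  let ?X = "subtopology T ?A"
  have CA: "?C \<subseteq> ?A" using c topspace_eq by (intro closure_of_subset) auto
  have X: "topspace ?X = ?A" using closure_of_subset_topspace by fastforce
  have "compact_space ?X" using compact by (simp add: closedin_compact_space compact_space_subtopology)
  moreover have "Hausdorff_space ?X" using hausdorff by (rule Hausdorff_space_subtopology)
  ultimately have "locally_compact_space ?X" "regular_space ?X"
    by (simp_all add: compact_imp_locally_compact_space compact_Hausdorff_imp_regular_space)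
  then have "?X interior_of \<Union>((\<lambda>w. ?A \<inter> E w) ` W) = {}"
  proof (intro Baire_category_alt conjI disjI2)
    show "countable ((\<lambda>w. ?A \<inter> E w) ` W)" using W by simp
    fix S assume "S \<in> (\<lambda>w. ?A \<inter> E w) ` W"
    then obtain w where w: "w \<in> W" "S = ?A \<inter> E w" by blast
    show "closedin ?X S" using E[OF w(1)] w(2) by (metis closedin_subtopology_Int_closed)
    show "?X interior_of S = {}"
    proof (rule ccontr)
      assume "?X interior_of S \<noteq> {}"
      then obtain U x where U: "openin ?X U" "U \<subseteq> S" "x \<in> U" unfolding interior_of_def by blast
      then obtain O' where O: "openin T O'" "U = O' \<inter> ?A" by (metis openin_subtopology)
      then have "x \<in> O'" "x \<in> ?A" using U(3) by auto
      then have "\<exists>y\<in>?C. y \<in> O'" using O(1) unfolding in_closure_of by blast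
      then obtain n where "c [^] (n :: nat) \<in> O'" by blast
      then have "infinite {n :: nat. c [^] n \<in> O'}" using infinite_powers_in_open[OF c O(1)] by blast
      moreover have "{n :: nat. c [^] n \<in> O'} \<subseteq> {n. c [^] n \<in> E w}"
        using O U w CA by blast
      ultimately show False using fin[OF w(1)] infinite_super by blast
    qed
  qed simp_all
  moreover have "?X interior_of ?A = ?A" using X interior_of_topspace by metis
  moreover have "?A \<noteq> {}" using CA by blast
  ultimately have "\<not> ?A \<subseteq> \<Union>((\<lambda>w. ?A \<inter> E w) ` W)"
    by (metis interior_of_mono subset_empty)
  then show ?thesis using that by blast
qed

text \<open>Since \<open>c\<close> is among the new generators, the closure of the group that they generate contains \<open>s\<close>,
  hence all \<open>\<eta> i\<close>. That the \<open>\<psi> (\<eta> i)\<close> with \<open>i > 0\<close> need not be distinct allows for any number of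
  generators.\<close>

lemma dense_free_subgroup:
  fixes \<eta> :: "nat \<Rightarrow> 'a" and t :: "nat \<Rightarrow> 'x"
  assumes H: "dense_subgroup H G T" "generate G (\<eta> ` {..m}) = H" and \<eta>: "\<eta> ` {..m} \<subseteq> H"
    and K: "group K" and \<psi>: "\<psi> \<in> hom (G\<lparr>carrier := H\<rparr>) K"
    and b: "free_family K b X" and t: "t ` {..m} \<subseteq> X" "\<And>i. i \<le> m \<Longrightarrow> \<psi> (\<eta> i) = b (t i)"
    and t0: "\<And>i. 1 \<le> i \<Longrightarrow> i \<le> m \<Longrightarrow> t i \<noteq> t 0"
  shows "\<exists>H'. dense_subgroup H' G T \<and> free_group_of_rank (G\<lparr>carrier := H'\<rparr>) (Suc m)"
proof -
  define c where "c = \<eta> 0"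
  have HG: "subgroup H G" using H by (simp add: dense_subgroup_def)
  have \<eta>G: "\<eta> i \<in> H" "\<eta> i \<in> carrier G" if "i \<le> m" for i
    using \<eta> that subgroup.subset[OF HG] by auto
  have c: "c \<in> carrier G" "c \<in> H" using \<eta>G[of 0] by (auto simp: c_def)
  interpret H: group "G\<lparr>carrier := H\<rparr>" using HG by (rule subgroup_imp_group)
  interpret K: group K by (rule K)
  interpret \<psi>: group_hom "G\<lparr>carrier := H\<rparr>" K \<psi> by unfold_locales (rule \<psi>)
  define z where "z = (\<lambda>s i. s [^] i \<otimes> \<eta> i \<otimes> inv (s [^] i))"
  define W where "W = {w :: (nat \<times> bool) list. fst ` set w \<subseteq> {..m} \<and> reduced_word w \<and> w \<noteq> []}"
  define E where "E = (\<lambda>w. {s \<in> topspace T. eval_word G (z s) w = \<one>})"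
  have "closedin T (E w)" if "w \<in> W" for w
    unfolding E_def
  proof (rule closedin_eval_word_eq_one)
    fix i assume "i \<in> fst ` set w"
    then have "i \<le> m" using that by (auto simp: W_def)
    then show "continuous_map T T (\<lambda>x. z x i)"
      unfolding z_def
      by (intro continuous_map_mult continuous_map_inverse continuous_map_nat_power)
        (simp_all add: \<eta>G topspace_eq)
  qed
  \<comment> \<open>If \<open>n\<close> exceeds the length of \<open>w\<close>, a relation
    \<open>w\<close> between the elements \<open>z (c [^] n) i\<close> would be carried by
    \<open>\<psi>\<close> to a word in the free family \<open>b\<close> whose reduced form is
    nonempty.\<close>
  moreover have "finite {n :: nat. c [^] n \<in> E w}" if w: "w \<in> W" for w
  proof -
    have "n \<le> length w" if n: "c [^] n \<in> E w" for n :: nat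
    proof (rule ccontr)
      assume "\<not> n \<le> length w"
      then have ne: "reduce_word (concat (map (conj_word t n) w)) \<noteq> []"
        using w t0 by (intro reduce_conj_word_neq_Nil[of w n m]) (auto simp: W_def)
      have wm: "fst ` set w \<subseteq> {..m}" using w by (simp add: W_def)
      have bK: "b ` t ` {..m} \<subseteq> carrier K" "b ` X \<subseteq> carrier K"
        using b t(1) by (auto simp: free_family_def)
      let ?v = "concat (map (conj_word t n) w)"
      have v: "fst ` set ?v \<subseteq> X" using fst_set_concat_conj_word[OF wm, of t n] t(1) by blast
      have zH: "z (c [^] n) i \<in> H" if "i \<le> m" for i
        unfolding z_def
        by (intro subgroup.m_closed[OF HG] subgroup.m_inv_closed[OF HG]
            subgroup_nat_pow_closed[OF HG] c(2) \<eta>G(1) that)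
      have "\<psi> (eval_word G (z (c [^] n)) w) = \<psi> (eval_word (G\<lparr>carrier := H\<rparr>) (z (c [^] n)) w)"
        using zH wm by (subst eval_word_subgroup[OF HG]) auto
      also have "\<dots> = eval_word K (\<lambda>i. \<psi> (z (c [^] n) i)) w"
        using zH wm by (intro \<psi>.hom_eval_word) auto
      also have "\<dots> = eval_word K (\<lambda>i. (b (t 0) [^]\<^bsub>K\<^esub> n) [^]\<^bsub>K\<^esub> i \<otimes>\<^bsub>K\<^esub> b (t i) \<otimes>\<^bsub>K\<^esub>
          inv\<^bsub>K\<^esub> ((b (t 0) [^]\<^bsub>K\<^esub> n) [^]\<^bsub>K\<^esub> i)) w"
      proof (rule eval_word_cong)
        fix l assume "l \<in> set w"
        then have l: "fst l \<le> m" using wm by auto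
        define p where "p = (c [^] n) [^] fst l"
        have p: "p \<in> H" "p = (c [^]\<^bsub>G\<lparr>carrier := H\<rparr>\<^esub> n) [^]\<^bsub>G\<lparr>carrier := H\<rparr>\<^esub> fst l"
          unfolding p_def nat_pow_consistent[symmetric]
          by (intro subgroup_nat_pow_closed[OF HG] c(2) refl)+
        let ?H = "G\<lparr>carrier := H\<rparr>"
        have pH: "p \<in> carrier ?H" "\<eta> (fst l) \<in> carrier ?H" "c \<in> carrier ?H"
          using p(1) \<eta>G(1)[OF l] c(2) by simp_all
        have "z (c [^] n) (fst l) = p \<otimes>\<^bsub>?H\<^esub> \<eta> (fst l) \<otimes>\<^bsub>?H\<^esub> inv\<^bsub>?H\<^esub> p"
          using m_inv_consistent[OF HG p(1)] by (simp add: z_def p_def)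
        also have "\<psi> \<dots> = \<psi> p \<otimes>\<^bsub>K\<^esub> \<psi> (\<eta> (fst l)) \<otimes>\<^bsub>K\<^esub> inv\<^bsub>K\<^esub> (\<psi> p)"
          using pH by (simp only: \<psi>.hom_mult \<psi>.hom_inv H.m_closed H.inv_closed)
        also have "\<psi> p = (b (t 0) [^]\<^bsub>K\<^esub> n) [^]\<^bsub>K\<^esub> fst l"
          using pH(3) t(2)[of 0] unfolding p(2)
          by (simp only: \<psi>.hom_nat_pow H.nat_pow_closed c_def le0)
        finally show "\<psi> (z (c [^] n) (fst l)) = (b (t 0) [^]\<^bsub>K\<^esub> n) [^]\<^bsub>K\<^esub> fst l \<otimes>\<^bsub>K\<^esub>
            b (t (fst l)) \<otimes>\<^bsub>K\<^esub> inv\<^bsub>K\<^esub> ((b (t 0) [^]\<^bsub>K\<^esub> n) [^]\<^bsub>K\<^esub> fst l)"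
          using t(2)[OF l] by simp
      qed
      also have "\<dots> = eval_word K b ?v"
        using K.eval_concat_conj_word[OF bK(1) wm, of n] by simp
      also have "\<dots> = eval_word K b (reduce_word ?v)"
        using image_mono[OF v, of b] bK(2) by (intro K.eval_reduce_word[symmetric]) simp
      also have "\<dots> \<noteq> \<one>\<^bsub>K\<^esub>"
      proof -
        have "fst ` set (reduce_word ?v) \<subseteq> X"
          using fst_act_word_subset[of ?v "[]"] v by (simp only: list.set image_empty Un_empty_right)
        then show ?thesis
          using b ne reduced_act_word[OF reduced_word_Nil, of ?v] unfolding free_family_def by blast
      qed
      finally show False using n \<psi>.hom_one by (simp add: E_def)
    qed
    then show ?thesis by (meson finite_nat_set_iff_bounded_le mem_Collect_eq)
  qed
  ultimately obtain s where s: "s \<in> T closure_of range (\<lambda>n :: nat. c [^] n)"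
    and sE: "\<And>w. w \<in> W \<Longrightarrow> s \<notin> E w"
    using generic_element[OF c(1), of W E] by blast
  have sG: "s \<in> carrier G" using s closure_of_subset_topspace[of T] topspace_eq by auto
  have zG: "z s ` {..m} \<subseteq> carrier G" using sG \<eta>G by (auto simp: z_def)
  have free: "free_family G (z s) {..m}"
    unfolding free_family_def
    using sE sG zG by (auto simp: W_def E_def topspace_eq)
  let ?H = "generate G (z s ` {..m})"
  have H': "subgroup ?H G" using zG by (rule generate_is_subgroup)
  let ?S = "T closure_of ?H"
  have S: "subgroup ?S G" using subgroup_closure_of[OF H'] .
  have zS: "z s i \<in> ?S" if "i \<le> m" for i
    using that generate.incl[of "z s i" "z s ` {..m}" G] subgroup.subset[OF H'] topspace_eq
      closure_of_subset[of ?H T] by auto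
  have "z s 0 = c" using c sG by (simp add: z_def c_def)
  then have "c \<in> ?H" using generate.incl[of "z s 0" "z s ` {..m}" G] by auto
  then have "range (\<lambda>n :: nat. c [^] n) \<subseteq> ?H"
    using subgroup_nat_pow_closed[OF H'] by auto
  then have "s \<in> ?S" using s by (rule subsetD[OF closure_of_mono])
  then have si: "s [^] (i :: nat) \<in> ?S" for i
    using subgroup_nat_pow_closed[OF S] by simp
  have "\<eta> i \<in> ?S" if "i \<le> m" for i
  proof -
    have "\<eta> i = inv (s [^] i) \<otimes> z s i \<otimes> s [^] i"
    proof -
      define p where "p = s [^] i"
      have p: "p \<in> carrier G" using sG by (simp add: p_def)
      have "inv p \<otimes> z s i \<otimes> p = (inv p \<otimes> p) \<otimes> \<eta> i \<otimes> (inv p \<otimes> p)"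
        using p \<eta>G(2)[OF that] unfolding z_def p_def[symmetric]
        by (simp only: m_assoc m_closed inv_closed)
      also have "\<dots> = \<eta> i" using p \<eta>G(2)[OF that] by simp
      finally show ?thesis by (simp add: p_def)
    qed
    moreover have "\<dots> \<in> ?S"
      by (intro subgroup.m_closed[OF S] subgroup.m_inv_closed[OF S] si zS that)
    ultimately show ?thesis by (simp only:)
  qed
  then have "H \<subseteq> ?S"
    using generate_subgroup_incl[OF _ S, of "\<eta> ` {..m}"] H(2) by (simp add: image_subset_iff)
  then have "dense_subgroup ?H G T" by (rule dense_subgroup_supset[OF H(1) H'])
  moreover have "free_group_of_rank (G\<lparr>carrier := ?H\<rparr>) (Suc m)"
    using free_group_of_rank_generate[OF free finite_atMost] by (simp only: card_atMost)
  ultimately show ?thesis by (intro exI[of _ ?H] conjI)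
qed

end

subsection \<open>Doubles of free groups\<close>

definition word_power :: "('x \<times> bool) list \<Rightarrow> nat \<Rightarrow> ('x \<times> bool) list" where
  "word_power u n = concat (replicate n u)"

lemma word_power_simps [simp]:
  "word_power u 0 = []" "word_power u (Suc n) = u @ word_power u n"
  by (simp_all add: word_power_def)

lemma word_power_add: "word_power u (m + n) = word_power u m @ word_power u n"
  by (induction m) simp_all

lemma word_power_Suc2: "word_power u (Suc n) = word_power u n @ u"
  using word_power_add[of u n 1] by simp

lemma inv_word_power: "inv_word (word_power u n) = word_power (inv_word u) n"
proof (induction n)
  case (Suc n)
  then show ?case using word_power_Suc2[of "inv_word u" n] by simp
qed simp

lemma length_word_power [simp]: "length (word_power u n) = n * length u"
  by (induction n) simp_all

lemma fst_set_word_power: "fst ` set (word_power u n) \<subseteq> fst ` set u"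
  by (induction n) auto

lemma nth_word_power:
  assumes "i < n * length u"
  shows "word_power u n ! i = u ! (i mod length u)"
  using assms
proof (induction n arbitrary: i)
  case (Suc n)
  show ?case
  proof (cases "i < length u")
    case False
    then have "i - length u < n * length u" using Suc.prems by auto
    then show ?thesis using Suc.IH[of "i - length u"] False
      by (simp add: nth_append le_mod_geq)
  qed (simp add: nth_append)
qed simp

lemma take_word_power:
  assumes "i \<le> n * length u"
  shows "take i (word_power u n) = word_power u (i div length u) @ take (i mod length u) u"
  using assms
proof (induction n arbitrary: i)
  case (Suc n)
  show ?case
  proof (cases "i < length u")
    case False
    then have le: "length u \<le> i" by simp
    show ?thesis
    proof (cases "u = []")
      case False
      then have "i div length u = Suc ((i - length u) div length u)"
        using le by (simp add: le_div_geq)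
      moreover have "i - length u \<le> n * length u" using Suc.prems by auto
      ultimately show ?thesis using Suc.IH[of "i - length u"] le
        by (simp add: le_mod_geq)
    qed (use Suc in auto)
  qed (use Suc.prems in simp)
qed simp

text \<open>Modelled on the word of a boundary curve, in which no signed letter occurs
  twice.\<close>

locale cyclic_word =
  fixes u :: "('x \<times> bool) list"
  assumes nonempty: "u \<noteq> []" and distinct: "distinct u" and cyclically_reduced: "reduced_word (u @ u)"
begin

lemma cyclic_word_inv: "cyclic_word (inv_word u)"
proof
  show "distinct (inv_word u)"
    using distinct by (simp add: inv_word_def distinct_map inj_on_def)
  show "reduced_word (inv_word u @ inv_word u)"
    using cyclically_reduced reduced_word_inv_word[of "u @ u"] by simp
qed (use nonempty in simp)

lemma reduced_word_power: "reduced_word (word_power u n)"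
proof (induction n)
  case (Suc n)
  have "reduced_word u" "hd u \<noteq> inv_letter (last u)"
    using cyclically_reduced nonempty by (auto simp: reduced_word_append)
  moreover have "hd (word_power u n) = hd u" if "word_power u n \<noteq> []"
    using that nonempty by (cases n) auto
  ultimately show ?case using Suc by (auto simp: reduced_word_append)
qed simp

text \<open>Membership in the cyclic group generated by \<open>u\<close>, as an equation between
  actions on reduced words. Two natural exponents stand for one integer exponent, and
  \<open>f\<close> itself may be unreduced.\<close>

definition is_power :: "('x \<times> bool) list \<Rightarrow> bool" where
  "is_power f \<longleftrightarrow> (\<exists>a b. \<forall>w. reduced_word w \<longrightarrow>
     act_word f (act_word (word_power u b) w) = act_word (word_power u a) w)"

lemma is_powerI:
  assumes "act_word f (act_word (word_power u b) []) = act_word (word_power u a) []"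
  shows "is_power f"
proof -
  have "act_word f (act_word (word_power u b) w) = act_word (word_power u a) w" if "reduced_word w" for w
    using assms act_reduce_word[OF that, of "f @ word_power u b"] act_reduce_word[OF that, of "word_power u a"]
    by simp
  then show ?thesis unfolding is_power_def by blast
qed

lemma word_power_comm:
  "act_word (word_power u m) (act_word (word_power u n) w) =
   act_word (word_power u n) (act_word (word_power u m) w)"
  by (metis act_word_simps(3) add.commute word_power_add)

text \<open>The powers of \<open>u\<close> form a subgroup. In \<open>push\<close> this keeps a
  syllable outside the subgroup when a power of \<open>u\<close> is absorbed into it.\<close>

lemma is_power_append_cancel_left: 
  assumes "is_power f" "is_power (f @ g)" 
  shows "is_power g"
proof -
  obtain a b a' b' where
    f: "\<And>w. reduced_word w \<Longrightarrow> act_word f (act_word (word_power u b) w) = act_word (word_power u a) w" and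
    g: "\<And>w. reduced_word w \<Longrightarrow> act_word f (act_word g (act_word (word_power u b') w)) = act_word (word_power u a') w"
    using assms unfolding is_power_def by force
  have "act_word f (act_word g (act_word (word_power u (b' + a)) [])) =
      act_word f (act_word (word_power u (b + a')) [])"
    using f g by (simp add: word_power_add reduced_act_word word_power_comm[of a' a])
  then have "act_word g (act_word (word_power u (b' + a)) []) = act_word (word_power u (b + a')) []"
    by (metis act_inv_word_cancel(1) reduced_act_word reduced_word_Nil)
  then show ?thesis by (rule is_powerI)
qed

text \<open>Lets the lemmas about \<open>u\<close> be applied to \<open>inv_word u\<close>, which
  supplies the other half of the ping-pong.\<close>

lemma is_power_inv: "is_power f \<Longrightarrow> cyclic_word.is_power (inv_word u) f"
proof -
  interpret inv: cyclic_word "inv_word u" by (rule cyclic_word_inv)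
  assume "is_power f"
  then obtain a b where
    f: "\<And>w. reduced_word w \<Longrightarrow> act_word f (act_word (word_power u b) w) = act_word (word_power u a) w"
    unfolding is_power_def by metis
  let ?V = "word_power (inv_word u)"
  have "act_word f (act_word (?V a) []) =
      act_word f (act_word (word_power u b) (act_word (?V b) (act_word (?V a) [])))"
    by (simp flip: inv_word_power add: reduced_act_word)
  also have "\<dots> = act_word (word_power u a) (act_word (?V b) (act_word (?V a) []))"
    by (rule f) (simp add: reduced_act_word)
  also have "\<dots> = act_word (word_power u a) (act_word (?V a) (act_word (?V b) []))"
    by (simp only: inv.word_power_comm)
  also have "\<dots> = act_word (?V b) []"
    by (simp flip: inv_word_power add: reduced_act_word)
  finally show ?thesis by (rule inv.is_powerI)
qed

text \<open>As the letters of \<open>u\<close> are distinct, a letter of an infinite power of \<open>u\<close> determines its position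
  modulo the length of \<open>u\<close>; so if \<open>f\<close> maps a long power of \<open>u\<close> to a word that starts with a long power
  of \<open>u\<close>, then it shifts by a multiple of the length.\<close>

lemma not_is_power_act:
  assumes f: "\<not> is_power f" and w: "reduced_word (word_power u K @ w)" and K: "length f < K" "length f < k"
  shows "act_word f (word_power u K @ w) \<noteq> word_power u k @ v"
proof
  assume eq: "act_word f (word_power u K @ w) = word_power u k @ v"
  let ?L = "length u"
  have L: "?L > 0" using nonempty by simp
  define f0 where "f0 = reduce_word f"
  have f0: "reduced_word f0" "length f0 \<le> length f"
    using length_act_word[of f "[]"] by (auto simp: f0_def)
  obtain a b r where 1: "f0 = a @ inv_word r" "word_power u K @ w = r @ b"
    "act_word f0 (word_power u K @ w) = a @ b"
    using act_word_decomp[OF f0(1) w] by metis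
  have ab: "a @ b = word_power u k @ v" using 1(3) eq act_reduce_word[OF w, of f] by (simp add: f0_def)
  have "length a \<le> length f" "length r \<le> length f" using f0(2) 1(1) by auto
  moreover have "K \<le> K * ?L" "k \<le> k * ?L" using L by (cases ?L; simp)+
  ultimately have len: "length a < k * ?L" "length r < K * ?L" using K by linarith+
  have r: "r = take (length r) (word_power u K)"
    using arg_cong[OF 1(2), of "take (length r)"] len by simp
  have a: "a = take (length a) (word_power u k)"
    using arg_cong[OF ab, of "take (length a)"] len by simp
  have "length r + length b = K * ?L + length w" using arg_cong[OF 1(2), of length] by simp
  then have "length b > 0" using len(2) by linarith
  \<comment> \<open>The first letter that survives the cancellation is read at position
    \<open>length r\<close> of the old power and at position \<open>length a\<close> of the new
    one.\<close>
  then have "b ! 0 = u ! (length r mod ?L)" "b ! 0 = u ! (length a mod ?L)"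
    using arg_cong[OF 1(2), of "\<lambda>x. x ! length r"] arg_cong[OF ab, of "\<lambda>x. x ! length a"] len
    by (simp_all add: nth_append nth_word_power)
  then have "length r mod ?L = length a mod ?L"
    using distinct L by (metis mod_less_divisor nth_eq_iff_index_eq)
  \<comment> \<open>Both prefixes end with the same piece \<open>x\<close> of \<open>u\<close>, so
    it cancels in \<open>a @ inv_word r\<close>, and \<open>f\<close> acts as the power
    \<open>i - j\<close> of \<open>u\<close>.\<close>
  then obtain x i j where x: "a = word_power u i @ x" "r = word_power u j @ x"
    using a r take_word_power len by (metis less_imp_le)
  have "act_word f (act_word (word_power u j) []) = act_word f0 (act_word (word_power u j) [])"
    unfolding f0_def by (rule act_reduce_word[symmetric]) auto
  also have "\<dots> = act_word (word_power u i) []"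
    using 1(1) x by (simp add: reduced_act_word)
  finally show False using f is_powerI by blast
qed

text \<open>The cancelled part \<open>r\<close> is a common prefix of \<open>w\<close> and of a
  power of \<open>inv_word u\<close>; by hypothesis it is shorter than \<open>k\<close> copies of
  \<open>u\<close>.\<close>

lemma act_word_power:
  assumes w: "reduced_word w" "\<And>v. w \<noteq> word_power (inv_word u) k @ v" and n: "k \<le> n"
  shows "\<exists>v. act_word (word_power u n) w = word_power u (n - k) @ v"
proof -
  let ?L = "length u"
  obtain a b r where 1: "word_power u n = a @ inv_word r" "w = r @ b"
    "act_word (word_power u n) w = a @ b"
    using act_word_decomp[OF reduced_word_power w(1)] by metis
  have len: "length a + length r = n * ?L" using arg_cong[OF 1(1), of length] by simp
  have "word_power (inv_word u) n = r @ inv_word a"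
    using arg_cong[OF 1(1), of inv_word] by (simp add: inv_word_power)
  then have r: "word_power (inv_word u) k @ word_power (inv_word u) (n - k) = r @ inv_word a"
    using n by (simp flip: word_power_add)
  have "\<not> length r \<ge> k * ?L"
  proof
    assume "length r \<ge> k * ?L"
    then have "word_power (inv_word u) k = take (k * ?L) r"
      using arg_cong[OF r, of "take (k * ?L)"] by simp
    then have "w = word_power (inv_word u) k @ drop (k * ?L) r @ b"
      using 1(2) by (metis append.assoc append_take_drop_id)
    then show False using w(2) by blast
  qed
  then have "length a \<ge> (n - k) * ?L" using len by (simp add: diff_mult_distrib)
  moreover have "word_power u (n - k) @ word_power u k = a @ inv_word r"
    using 1(1) n by (simp flip: word_power_add)
  ultimately have "word_power u (n - k) = take ((n - k) * ?L) a"
    using arg_cong[of _ _ "take ((n - k) * ?L)"] by (metis append_eq_conv_conj length_word_power take_append take_all diff_is_0_eq' take_0 append_Nil2 order_refl)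
  then have "a @ b = word_power u (n - k) @ drop ((n - k) * ?L) a @ b"
    by (metis append.assoc append_take_drop_id)
  then show ?thesis using 1(3) by metis
qed

end

text \<open>A word in the free product of two copies of the free group is a list of syllables \<open>(b, f)\<close>, where
  \<open>b\<close> indicates the copy. In \<open>twisted_word u n\<close> the second copy is conjugated by the \<open>n\<close>-th power of \<open>u\<close>,
  up to an initial such power.\<close>

fun twisted_word :: "('x \<times> bool) list \<Rightarrow> nat \<Rightarrow> (bool \<times> ('x \<times> bool) list) list \<Rightarrow> ('x \<times> bool) list" where
  "twisted_word u n [] = []"
| "twisted_word u n [(b, f)] = f @ (if b then [] else inv_word (word_power u n))"
| "twisted_word u n ((b, f) # y # l) =
     f @ (if b then word_power u n else inv_word (word_power u n)) @ twisted_word u n (y # l)"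

abbreviation alternating :: "(bool \<times> 'y) list \<Rightarrow> bool" where
  "alternating l \<equiv> successively (\<lambda>x y. fst x \<noteq> fst y) l"

section \<open>Ping-pong for twisted words\<close>

context cyclic_word
begin

text \<open>The ping-pong invariant, with the word built from right to left. A power put in front of
  the word obtained so far loses at most \<open>k\<close> of its \<open>n\<close> copies. The next
  syllable \<open>f\<close> then meets at least \<open>n - k \<ge> k > length f\<close> copies and,
  not being a power of \<open>u\<close>, cannot produce a long power of the same sign, so the
  following power of opposite sign again loses little.\<close>

lemma twisted_word_prefix:
  assumes "alternating l" "l \<noteq> []" "\<And>x. x \<in> set l \<Longrightarrow> \<not> is_power (snd x) \<and> length (snd x) < k" "2 * k \<le> n"
  shows "if fst (hd l) then \<forall>v. reduce_word (twisted_word u n l) \<noteq> word_power u k @ v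
         else \<forall>v. reduce_word (twisted_word u n l) \<noteq> word_power (inv_word u) k @ v"
  using assms(1-3)
proof (induction l rule: induct_list012)
  case (2 x)
  obtain b f where x: "x = (b, f)" by (cases x)
  interpret inv: cyclic_word "inv_word u" by (rule cyclic_word_inv)
  have f: "\<not> is_power f" "length f < k" using 2 x by auto
  show ?case
  proof (cases b)
    case True
    have "length (reduce_word f) < k" using f length_act_word[of f "[]"] by simp
    moreover have "k \<le> k * length u" using nonempty by (cases u) auto
    ultimately have "length (reduce_word f) < length (word_power u k @ v)" for v
      unfolding length_append length_word_power by linarith
    then have "reduce_word f \<noteq> word_power u k @ v" for v
      by (metis less_irrefl)
    then show ?thesis using True x by simp
  next
    case False
    have "\<not> inv.is_power f" using f(1) inv.is_power_inv[of f] by auto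
    then have "act_word f (word_power (inv_word u) n @ []) \<noteq> word_power (inv_word u) k @ v" for v
      using f(2) assms(4) inv.reduced_word_power[of n] by (intro inv.not_is_power_act) simp_all
    then show ?thesis using False x inv.reduced_word_power[of n] by (simp add: inv_word_power)
  qed
next
  case (3 x y l)
  obtain b f where x: "x = (b, f)" by (cases x)
  interpret inv: cyclic_word "inv_word u" by (rule cyclic_word_inv)
  have f: "\<not> is_power f" "length f < k" using 3(5)[of x] x by auto
  have y: "fst y \<noteq> b" using 3(3) x by simp
  let ?X = "reduce_word (twisted_word u n (y # l))"
  have X: "reduced_word ?X" by auto
  have IH: "if fst y then \<forall>v. ?X \<noteq> word_power u k @ v else \<forall>v. ?X \<noteq> word_power (inv_word u) k @ v"
    using 3(2) 3(3) 3(5) by (auto simp: successively_Cons)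
  show ?case
  proof (cases b)
    case True
    then have "\<forall>v. ?X \<noteq> word_power (inv_word u) k @ v" using IH y by simp
    then obtain w where w: "act_word (word_power u n) ?X = word_power u (n - k) @ w"
      using act_word_power[OF X, of k n] assms(4) by auto
    then have "reduced_word (word_power u (n - k) @ w)" using X by (metis reduced_act_word)
    then have "act_word f (word_power u (n - k) @ w) \<noteq> word_power u k @ v" for v
      using f assms(4) by (intro not_is_power_act) auto
    then show ?thesis using True x w by simp
  next
    case False
    then have "\<forall>v. ?X \<noteq> word_power (inv_word (inv_word u)) k @ v" using IH y by simp
    then obtain w where w: "act_word (word_power (inv_word u) n) ?X = word_power (inv_word u) (n - k) @ w"
      using inv.act_word_power[OF X, of k n] assms(4) by auto
    then have "reduced_word (word_power (inv_word u) (n - k) @ w)" using X by (metis reduced_act_word)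
    moreover have "\<not> inv.is_power f" using f(1) inv.is_power_inv[of f] by auto
    ultimately have "act_word f (word_power (inv_word u) (n - k) @ w) \<noteq> word_power (inv_word u) k @ v" for v
      using f assms(4) by (intro inv.not_is_power_act) auto
    then show ?thesis using False x w by (simp add: inv_word_power)
  qed
qed simp

text \<open>The initial power is the one that \<open>twisted_word\<close> omits if the first
  syllable lies in the second copy. In that case a power of \<open>u\<close> survives as a prefix;
  otherwise the first syllable is too short to cancel the long word behind it.\<close>

lemma twisted_word_nontrivial:
  assumes "alternating l" "length l \<ge> 2" "\<And>x. x \<in> set l \<Longrightarrow> \<not> is_power (snd x) \<and> length (snd x) < k" "2 * k \<le> n"
  shows "reduce_word ((if fst (hd l) then [] else word_power u n) @ twisted_word u n l) \<noteq> []"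
proof -
  obtain b f y l' where l: "l = (b, f) # y # l'"
    using assms(2) by (metis One_nat_def Suc_1 Suc_le_length_iff surj_pair)
  have f: "length f < k" using assms(3)[of "(b, f)"] l by simp
  have kL: "k \<le> k * length u" using nonempty by (cases u) auto
  show ?thesis
  proof (cases b)
    case False
    let ?X = "reduce_word (twisted_word u n l)"
    have "?X \<noteq> word_power (inv_word u) k @ v" for v
      using twisted_word_prefix[OF assms(1) _ assms(3,4)] l False by auto
    moreover have "reduced_word ?X" by auto
    ultimately obtain w where "act_word (word_power u n) ?X = word_power u (n - k) @ w"
      using act_word_power[of ?X k n] assms(4) by auto
    moreover have "word_power u (n - k) \<noteq> []"
      using f assms(4) nonempty by (cases "n - k") auto
    ultimately show ?thesis using l False by simp
  next
    case True
    let ?X = "reduce_word (twisted_word u n (y # l'))"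
    have "?X \<noteq> word_power (inv_word u) k @ v" for v
      using twisted_word_prefix[of "y # l'" k n] assms l True by (auto simp: successively_Cons)
    moreover have X: "reduced_word ?X" by auto
    ultimately obtain w where w: "act_word (word_power u n) ?X = word_power u (n - k) @ w"
      using act_word_power[of ?X k n] assms(4) by auto
    let ?Y = "act_word (word_power u n) ?X"
    have "length f < n - k" using f assms(4) by simp
    also have "n - k \<le> (n - k) * length u" using nonempty by (cases u) auto
    also have "\<dots> \<le> length ?Y" using w by simp
    finally have Y: "length f < length ?Y" .
    have "act_word f ?Y \<noteq> []"
    proof
      assume "act_word f ?Y = []"
      then have "?Y = act_word (inv_word f) []"
        using X by (metis act_inv_word_cancel(1) reduced_act_word)
      then show False using Y length_act_word[of "inv_word f" "[]"] by simp
    qed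
    then show ?thesis using l True by simp
  qed
qed

end


section \<open>Syllables and their values in a group\<close>

lemma (in group) eval_word_power:
  "z ` fst ` set u \<subseteq> carrier G \<Longrightarrow> eval_word G z (word_power u n) = eval_word G z u [^] n"
proof (induction n)
  case (Suc n)
  then have "z ` fst ` set (word_power u n) \<subseteq> carrier G" 
    using image_mono[OF fst_set_word_power[of u n], of z] by simp
  with Suc show ?case
    using nat_pow_Suc2[of "eval_word G z u" n] by (simp add: eval_word_append eval_word_closed)
qed simp

lemma (in group) eval_word_conjugate:
  assumes "s \<in> carrier G" "z ` fst ` set w \<subseteq> carrier G"
  shows "eval_word G (\<lambda>x. s \<otimes> z x \<otimes> inv s) w = s \<otimes> eval_word G z w \<otimes> inv s"
  using assms(2)
proof (induction w)
  case (Cons l w)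
  have l: "eval_letter G z l \<in> carrier G" using Cons.prems by simp
  have "eval_letter G (\<lambda>x. s \<otimes> z x \<otimes> inv s) l = s \<otimes> eval_letter G z l \<otimes> inv s"
    using assms(1) Cons.prems by (simp add: eval_letter_def inv_mult_group m_assoc)
  moreover have "inv s \<otimes> (s \<otimes> (eval_word G z w \<otimes> inv s)) = eval_word G z w \<otimes> inv s"
    using assms(1) Cons.prems by (simp add: eval_word_closed flip: m_assoc)
  ultimately show ?case
    using Cons l assms(1) by (simp add: eval_word_Cons eval_word_closed m_assoc)
qed (use assms in simp)

text \<open>The maps \<open>p True\<close> and \<open>p False\<close> interpret the two copies in
  one group. If they give a word \<open>u\<close> the same value, this evaluates a homomorphism from
  the double of the free group along \<open>u\<close>.\<close>

definition syllable_value ::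
    "('a, 'b) monoid_scheme \<Rightarrow> (bool \<Rightarrow> 'x \<Rightarrow> 'a) \<Rightarrow> (bool \<times> ('x \<times> bool) list) list \<Rightarrow> 'a" where
  "syllable_value G p l = foldr (\<lambda>x y. eval_word G (p (fst x)) (snd x) \<otimes>\<^bsub>G\<^esub> y) l \<one>\<^bsub>G\<^esub>"

lemma syllable_value_simps [simp]:
  "syllable_value G p [] = \<one>\<^bsub>G\<^esub>"
  "syllable_value G p (x # l) = eval_word G (p (fst x)) (snd x) \<otimes>\<^bsub>G\<^esub> syllable_value G p l"
  by (simp_all add: syllable_value_def)

definition syllables_over :: "'x set \<Rightarrow> (bool \<times> ('x \<times> bool) list) list \<Rightarrow> bool" where
  "syllables_over X l \<longleftrightarrow> (\<forall>x\<in>set l. fst ` set (snd x) \<subseteq> X)"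

lemma syllables_over_simps [simp]:
  "syllables_over X []"
  "syllables_over X (x # l) \<longleftrightarrow> fst ` set (snd x) \<subseteq> X \<and> syllables_over X l"
  by (auto simp: syllables_over_def)

lemma (in group) syllable_value_closed:
  assumes "\<And>b. p b ` X \<subseteq> carrier G" "syllables_over X l"
  shows "syllable_value G p l \<in> carrier G"
  using assms(2)
proof (induction l)
  case (Cons x l)
  have "p (fst x) ` fst ` set (snd x) \<subseteq> carrier G" using assms(1)[of "fst x"] Cons.prems by auto
  then show ?case using Cons by (simp add: eval_word_closed)
qed simp

lemma fst_set_twisted_word:
  assumes "fst ` set u \<subseteq> X" "syllables_over X l"
  shows "fst ` set (twisted_word u n l) \<subseteq> X"
proof -
  have p: "fst ` set (word_power u n) \<subseteq> X"
    using fst_set_word_power assms(1) by (rule subset_trans)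
  show ?thesis using assms(2)
  proof (induction l rule: induct_list012)
    case (2 x)
    then show ?case using p by (cases x) (simp add: image_Un)
  next
    case (3 x y l)
    then show ?case using p by (cases x) (simp add: image_Un)
  qed simp
qed

definition conjugate_copy ::
    "('a, 'b) monoid_scheme \<Rightarrow> ('x \<Rightarrow> 'a) \<Rightarrow> 'a \<Rightarrow> bool \<Rightarrow> 'x \<Rightarrow> 'a" where
  "conjugate_copy G z s b x = (if b then z x else s \<otimes>\<^bsub>G\<^esub> z x \<otimes>\<^bsub>G\<^esub> inv\<^bsub>G\<^esub> s)"

section \<open>Normal forms in the double of a free group along a cyclic subgroup\<close>

context cyclic_word
begin

text \<open>Prepends a syllable and restores the normal form of an amalgamated product: neighbours
  in the same copy merge, and a syllable that is a power of \<open>u\<close> belongs to both copies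
  and is absorbed by its neighbour. A list of one syllable may consist of such a power, which is why
  \<open>push x [y]\<close> also inspects \<open>y\<close>.\<close>

fun push :: "bool \<times> ('x \<times> bool) list \<Rightarrow> (bool \<times> ('x \<times> bool) list) list \<Rightarrow> (bool \<times> ('x \<times> bool) list) list" where
  "push x [] = [x]"
| "push x [y] =
    (if is_power (snd y) \<or> fst x = fst y then [(fst x, snd x @ snd y)]
     else if is_power (snd x) then [(fst y, snd x @ snd y)]
     else [x, y])"
| "push x (y # z # l) =
    (if fst x = fst y then
       if is_power (snd x @ snd y) then (fst z, (snd x @ snd y) @ snd z) # l
       else (fst x, snd x @ snd y) # z # l
     else if is_power (snd x) then (fst y, snd x @ snd y) # z # l
     else x # y # z # l)"

definition normalized :: "(bool \<times> ('x \<times> bool) list) list \<Rightarrow> bool" where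
  "normalized l \<longleftrightarrow> alternating l \<and> (length l \<ge> 2 \<longrightarrow> (\<forall>x\<in>set l. \<not> is_power (snd x)))"

text \<open>A syllable that absorbs a power of \<open>u\<close> stays outside the powers of
  \<open>u\<close>, as these form a subgroup; when a merged syllable becomes such a power, it is
  passed on to the next one.\<close>

lemma normalized_push: "normalized l \<Longrightarrow> normalized (push x l)"
proof (induction x l rule: push.induct)
  case (3 x y z l)
  have alt: "fst y \<noteq> fst z" "alternating (z # l)"
    and np: "\<not> is_power (snd y)" "\<not> is_power (snd z)" "\<And>v. v \<in> set l \<Longrightarrow> \<not> is_power (snd v)"
    using 3 by (auto simp: normalized_def)
  consider "fst x = fst y" "is_power (snd x @ snd y)" | "fst x = fst y" "\<not> is_power (snd x @ snd y)"
    | "fst x \<noteq> fst y" "is_power (snd x)" | "fst x \<noteq> fst y" "\<not> is_power (snd x)" by blast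
  then show ?case
  proof cases
    case 1
    have "\<not> is_power ((snd x @ snd y) @ snd z)"
      using is_power_append_cancel_left 1(2) np(2) by blast
    moreover have "alternating ((fst z, (snd x @ snd y) @ snd z) # l)"
      using alt(2) by (cases l) auto
    ultimately show ?thesis using 1 np(3) by (auto simp: normalized_def)
  next
    case 2
    then show ?thesis using alt np by (auto simp: normalized_def)
  next
    case 3
    have "\<not> is_power (snd x @ snd y)"
      using is_power_append_cancel_left 3(2) np(1) by blast
    then show ?thesis using 3 alt np by (auto simp: normalized_def)
  next
    case 4
    then show ?thesis using alt np by (auto simp: normalized_def)
  qed
qed (auto simp: normalized_def)

lemma syllables_over_push:
  "fst ` set (snd x) \<subseteq> X \<Longrightarrow> syllables_over X l \<Longrightarrow> syllables_over X (push x l)"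
  by (induction x l rule: push.induct) (simp_all add: image_Un)

text \<open>The equation between \<open>f\<close> and powers of \<open>u\<close> can be evaluated in
  either copy, and \<open>u\<close> has the same value \<open>d\<close> in both.\<close>

lemma eval_is_power:
  assumes "group K" "\<And>b. p b ` X \<subseteq> carrier K" "fst ` set u \<subseteq> X"
    and c: "eval_word K (p True) u = eval_word K (p False) u"
    and f: "is_power f" "fst ` set f \<subseteq> X"
  shows "eval_word K (p b) f = eval_word K (p b') f"
proof -
  interpret K: group K by (rule assms(1))
  have X: "p b ` fst ` set w \<subseteq> carrier K" if "fst ` set w \<subseteq> X" for b w
    using assms(2)[of b] image_mono[OF that, of "p b"] by simp
  have pu: "fst ` set (word_power u n) \<subseteq> X" for n
    using fst_set_word_power[of u n] assms(3) by simp
  obtain i j where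
    "\<And>w. reduced_word w \<Longrightarrow> act_word f (act_word (word_power u j) w) = act_word (word_power u i) w"
    using f(1) unfolding is_power_def by metis
  from this[of "[]"] have 1: "reduce_word (f @ word_power u j) = reduce_word (word_power u i)" by simp
  define d where "d = eval_word K (p True) u"
  have d: "d \<in> carrier K" using X[OF assms(3)] by (simp add: d_def K.eval_word_closed)
  have "eval_word K (p b) u = d" for b using c by (cases b) (simp_all add: d_def)
  then have e: "eval_word K (p b) (word_power u n) = d [^]\<^bsub>K\<^esub> n" for b n
    using K.eval_word_power[OF X[OF assms(3)]] by simp
  have "eval_word K (p b) f = d [^]\<^bsub>K\<^esub> i \<otimes>\<^bsub>K\<^esub> inv\<^bsub>K\<^esub> (d [^]\<^bsub>K\<^esub> j)" for b
  proof -
    have cl: "eval_word K (p b) f \<in> carrier K" using X[OF f(2)] by (rule K.eval_word_closed)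
    have "eval_word K (p b) (f @ word_power u j) = eval_word K (p b) (word_power u i)"
      using arg_cong[OF 1, of "eval_word K (p b)"] K.eval_reduce_word[of "p b" "f @ word_power u j"]
        K.eval_reduce_word[OF X[OF pu[of i]], of b] X[OF f(2), of b] X[OF pu, of b]
      by (simp add: image_Un)
    then have "eval_word K (p b) f \<otimes>\<^bsub>K\<^esub> d [^]\<^bsub>K\<^esub> j = d [^]\<^bsub>K\<^esub> i"
      using K.eval_word_append[OF X[OF f(2)] X[OF pu[of j]]] by (simp add: e)
    then show ?thesis using d cl by (metis K.inv_solve_right K.nat_pow_closed)
  qed
  then show ?thesis by simp
qed

lemma syllable_value_push:
  assumes K: "group K" "\<And>b. p b ` X \<subseteq> carrier K" "fst ` set u \<subseteq> X"
    "eval_word K (p True) u = eval_word K (p False) u"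
    and "fst ` set (snd x) \<subseteq> X" "syllables_over X l"
  shows "syllable_value K p (push x l) = eval_word K (p (fst x)) (snd x) \<otimes>\<^bsub>K\<^esub> syllable_value K p l"
proof -
  interpret K: group K by (rule K)
  have cl: "eval_word K (p b) w \<in> carrier K" if "fst ` set w \<subseteq> X" for b w
    using K(2)[of b] image_mono[OF that, of "p b"] by (intro K.eval_word_closed) simp
  have app: "eval_word K (p b) (v @ w) = eval_word K (p b) v \<otimes>\<^bsub>K\<^esub> eval_word K (p b) w"
    if "fst ` set v \<subseteq> X" "fst ` set w \<subseteq> X" for b v w
    using K(2)[of b] image_mono[OF that(1), of "p b"] image_mono[OF that(2), of "p b"]
    by (intro K.eval_word_append) simp_all
  have scl: "syllable_value K p l \<in> carrier K" if "syllables_over X l" for l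
    using K(2) that by (rule K.syllable_value_closed)
  note swap = eval_is_power[OF K]
  show ?thesis using assms(5,6)
  proof (induction x l rule: push.induct)
    case (1 x)
    then show ?case by simp
  next
    case (2 x y)
    then show ?case
      using swap[of "snd y" "fst x" "fst y"] swap[of "snd x" "fst x" "fst y"]
      by (auto simp: app cl)
  next
    case (3 x y z l)
    have xyz: "fst ` set (snd x) \<subseteq> X" "fst ` set (snd y) \<subseteq> X" "fst ` set (snd z) \<subseteq> X" "syllables_over X l"
      using 3 by auto
    then have xy: "fst ` set (snd x @ snd y) \<subseteq> X" by (simp add: image_Un)
    note cl' = cl[OF xyz(1)] cl[OF xyz(2)] cl[OF xyz(3)] scl[OF xyz(4)]
    show ?case
    proof (cases "fst x = fst y \<and> is_power (snd x @ snd y)")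
      case True
      define S where "S = eval_word K (p (fst z)) (snd z) \<otimes>\<^bsub>K\<^esub> syllable_value K p l"
      have S: "S \<in> carrier K" using cl' by (simp add: S_def)
      have "eval_word K (p (fst z)) ((snd x @ snd y) @ snd z) \<otimes>\<^bsub>K\<^esub> syllable_value K p l =
          eval_word K (p (fst z)) (snd x @ snd y) \<otimes>\<^bsub>K\<^esub> S"
        unfolding app[OF xy xyz(3)] S_def using cl[OF xy] cl' by (simp only: K.m_assoc)
      also have "\<dots> = eval_word K (p (fst x)) (snd x @ snd y) \<otimes>\<^bsub>K\<^esub> S"
        using swap[of "snd x @ snd y" "fst z" "fst x"] True xy by simp
      also have "\<dots> = eval_word K (p (fst x)) (snd x) \<otimes>\<^bsub>K\<^esub> (eval_word K (p (fst y)) (snd y) \<otimes>\<^bsub>K\<^esub> S)"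
        unfolding app[OF xyz(1,2)] using True S cl' by (simp add: K.m_assoc)
      finally show ?thesis using True by (simp add: S_def)
    next
      case False
      then show ?thesis
        using xyz swap[of "snd x" "fst x" "fst y"] by (auto simp: app cl scl K.m_assoc)
    qed
  qed
qed

definition normalize :: "(bool \<times> ('x \<times> bool) list) list \<Rightarrow> (bool \<times> ('x \<times> bool) list) list" where
  "normalize l = foldr push l []"

lemma normalized_normalize: "normalized (normalize l)"
proof (induction l)
  case Nil
  then show ?case by (simp add: normalize_def normalized_def)
qed (simp add: normalize_def normalized_push)

lemma syllables_over_normalize: "syllables_over X l \<Longrightarrow> syllables_over X (normalize l)"
  by (induction l) (simp_all add: normalize_def syllables_over_push)

lemma syllable_value_normalize:
  assumes K: "group K" "\<And>b. p b ` X \<subseteq> carrier K" "fst ` set u \<subseteq> X"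
    "eval_word K (p True) u = eval_word K (p False) u"
    and "syllables_over X l"
  shows "syllable_value K p (normalize l) = syllable_value K p l"
  using assms(5)
proof (induction l)
  case (Cons x l)
  then show ?case
    using syllable_value_push[OF K, of x "normalize l"] syllables_over_normalize[of X l]
    by (simp add: normalize_def)
qed (simp add: normalize_def)

text \<open>When every syllable of the second copy is written as a conjugate by \<open>s\<close>,
  one factor remains between neighbours: \<open>s\<close> before a syllable of the second copy,
  \<open>inv s\<close> behind it. The statement \<open>main\<close> accounts for the leading
  \<open>s\<close>, which \<open>twisted_word\<close> leaves out.\<close>

lemma eval_twisted_word:
  assumes "group G" "z ` X \<subseteq> carrier G" "fst ` set u \<subseteq> X"
    and "alternating l" "l \<noteq> []" "syllables_over X l"
  shows "eval_word G z ((if fst (hd l) then [] else word_power u n) @ twisted_word u n l) =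
    syllable_value G (conjugate_copy G z (eval_word G z u [^]\<^bsub>G\<^esub> n)) l"
proof -
  interpret group G by (rule assms(1))
  define s where "s = eval_word G z u [^]\<^bsub>G\<^esub> n"
  have X: "z ` fst ` set w \<subseteq> carrier G" if "fst ` set w \<subseteq> X" for w
    using assms(2) image_mono[OF that, of z] by simp
  have cl: "eval_word G z w \<in> carrier G" if "fst ` set w \<subseteq> X" for w
    using X[OF that] by (rule eval_word_closed)
  have app: "eval_word G z (v @ w) = eval_word G z v \<otimes>\<^bsub>G\<^esub> eval_word G z w"
    if "fst ` set v \<subseteq> X" "fst ` set w \<subseteq> X" for v w
    using X that by (intro eval_word_append) simp_all
  have s: "s \<in> carrier G" unfolding s_def using cl[OF assms(3)] by simp
  have pX: "fst ` set (word_power u n) \<subseteq> X" "fst ` set (inv_word (word_power u n)) \<subseteq> X"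
    using fst_set_word_power[of u n] assms(3) by simp_all
  have ps: "eval_word G z (word_power u n) = s" "eval_word G z (inv_word (word_power u n)) = inv\<^bsub>G\<^esub> s"
    using eval_word_power[OF X[OF assms(3)], of n] eval_inv_word[OF X[OF pX(1)]] by (simp_all add: s_def)
  let ?p = "conjugate_copy G z s"
  have p: "?p b ` X \<subseteq> carrier G" for b
    using s assms(2) by (auto simp: conjugate_copy_def image_subset_iff)
  have pf: "eval_word G (?p b) f = (if b then eval_word G z f else s \<otimes>\<^bsub>G\<^esub> eval_word G z f \<otimes>\<^bsub>G\<^esub> inv\<^bsub>G\<^esub> s)"
    if "fst ` set f \<subseteq> X" for f b
    using eval_word_conjugate[OF s X[OF that]] by (simp add: conjugate_copy_def[abs_def])
  have canc: "inv\<^bsub>G\<^esub> s \<otimes>\<^bsub>G\<^esub> (s \<otimes>\<^bsub>G\<^esub> y) = y" "s \<otimes>\<^bsub>G\<^esub> (inv\<^bsub>G\<^esub> s \<otimes>\<^bsub>G\<^esub> y) = y" if "y \<in> carrier G" for y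
    using s that by (simp_all flip: m_assoc)
  have tw: "fst ` set (twisted_word u n l) \<subseteq> X" if "syllables_over X l" for l
    using assms(3) that by (rule fst_set_twisted_word)
  have main: "eval_word G z (twisted_word u n l) =
      (if fst (hd l) then \<one>\<^bsub>G\<^esub> else inv\<^bsub>G\<^esub> s) \<otimes>\<^bsub>G\<^esub> syllable_value G ?p l"
    using assms(4-6)
  proof (induction l rule: induct_list012)
    case (2 x)
    obtain b f where x: "x = (b, f)" by (cases x)
    then show ?case using 2 s pX
      by (cases b) (simp_all add: app cl pf ps canc m_assoc)
  next
    case (3 x y l)
    obtain b f where x: "x = (b, f)" by (cases x)
    have f: "fst ` set f \<subseteq> X" and sy: "syllables_over X (y # l)" and yb: "fst y = (\<not> b)"
      using 3 x by auto
    have IH: "eval_word G z (twisted_word u n (y # l)) =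
        (if \<not> b then \<one>\<^bsub>G\<^esub> else inv\<^bsub>G\<^esub> s) \<otimes>\<^bsub>G\<^esub> syllable_value G ?p (y # l)"
      using 3 x yb by simp
    have scl: "syllable_value G ?p (y # l) \<in> carrier G" using syllable_value_closed[OF p sy] .
    define S where "S = syllable_value G ?p (y # l)"
    have "eval_word G z (twisted_word u n (x # y # l)) = 
       eval_word G z f \<otimes>\<^bsub>G\<^esub> ((if b then s else inv\<^bsub>G\<^esub> s) \<otimes>\<^bsub>G\<^esub> eval_word G z (twisted_word u n (y # l)))"
      using x f pX tw[OF sy] ps by (simp add: app image_Un)
    also have "\<dots> = (if b then \<one>\<^bsub>G\<^esub> else inv\<^bsub>G\<^esub> s) \<otimes>\<^bsub>G\<^esub> (eval_word G (?p b) f \<otimes>\<^bsub>G\<^esub> S)"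
      using scl s f cl[OF f] unfolding IH S_def[symmetric] pf[OF f]
      by (cases b) (simp_all add: canc m_assoc)
    finally show ?case using x by (simp add: S_def)
  qed simp
  have "syllable_value G ?p l \<in> carrier G" using syllable_value_closed[OF p assms(6)] .
  then show ?thesis
    using main s pX tw[OF assms(6)] by (simp add: app ps canc flip: s_def)
qed

text \<open>Normalization keeps the value in \<open>K\<close> and, as \<open>c\<close> commutes with
  its powers, also in \<open>G\<close> twisted by any power of \<open>c\<close>. The normal form is
  then either trivial for a reason that holds in every such group, or survives in \<open>G\<close>:
  a single syllable as a nontrivial element of the free group, a longer list by ping-pong for large
  \<open>n\<close>.\<close>

lemma double_dichotomy:
  assumes G: "group G" "free_family G z X" and X: "fst ` set u \<subseteq> X"
    and K: "group K" "\<And>b. p b ` X \<subseteq> carrier K" "eval_word K (p True) u = eval_word K (p False) u"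
    and l: "syllables_over X l"
  shows "syllable_value K p l = \<one>\<^bsub>K\<^esub> \<or>
    finite {n :: nat. syllable_value G (conjugate_copy G z (eval_word G z u [^]\<^bsub>G\<^esub> n)) l = \<one>\<^bsub>G\<^esub>}"
proof -
  interpret G: group G by (rule G)
  interpret K: group K by (rule K)
  have zX: "z ` X \<subseteq> carrier G" using G(2) by (simp add: free_family_def)
  have zu: "z ` fst ` set u \<subseteq> carrier G" using zX image_mono[OF X, of z] by simp
  define c where "c = eval_word G z u"
  have c: "c \<in> carrier G" using zu by (simp add: c_def G.eval_word_closed)
  let ?p = "\<lambda>n :: nat. conjugate_copy G z (c [^]\<^bsub>G\<^esub> n)"
  have p: "?p n b ` X \<subseteq> carrier G" for n b
    using c zX by (auto simp: conjugate_copy_def image_subset_iff)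
  have pu: "eval_word G (?p n True) u = eval_word G (?p n False) u" for n
  proof -
    have "c [^]\<^bsub>G\<^esub> n \<otimes>\<^bsub>G\<^esub> c = c \<otimes>\<^bsub>G\<^esub> c [^]\<^bsub>G\<^esub> n" using c G.nat_pow_Suc2[of c n] by simp
    then show ?thesis using G.eval_word_conjugate[OF _ zu, of "c [^]\<^bsub>G\<^esub> n"] c
      by (simp add: conjugate_copy_def[abs_def] G.m_assoc flip: c_def)
  qed
  define l' where "l' = normalize l"
  have l': "normalized l'" "syllables_over X l'"
    unfolding l'_def using normalized_normalize syllables_over_normalize[OF l] by auto
  have vK: "syllable_value K p l' = syllable_value K p l"
    unfolding l'_def by (rule syllable_value_normalize[OF K(1,2) X K(3) l])
  have vG: "syllable_value G (?p n) l' = syllable_value G (?p n) l" for n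
    unfolding l'_def by (rule syllable_value_normalize[OF G(1) p X pu l])
  consider "l' = []" | b f where "l' = [(b, f)]" | "length l' \<ge> 2"
  proof (cases l')
    case (Cons x l)
    then show ?thesis by (cases l; cases x) (auto intro: that)
  qed (rule that(1))
  then show ?thesis
  proof cases
    case 1
    then show ?thesis using vK by simp
  next
    case 2
    have f: "fst ` set f \<subseteq> X" using l' 2 by simp
    show ?thesis
    proof (cases "reduce_word f = []")
      case True
      have "p b ` fst ` set f \<subseteq> carrier K" using K(2)[of b] image_mono[OF f, of "p b"] by simp
      then have "eval_word K (p b) f = \<one>\<^bsub>K\<^esub>" using K.eval_reduce_word[of "p b" f] True by simp
      then show ?thesis using vK 2 by simp
    next
      case False
      have zf: "z ` fst ` set f \<subseteq> carrier G" using zX image_mono[OF f, of z] by simp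
      have "fst ` set (reduce_word f) \<subseteq> X"
        using fst_act_word_subset[of f "[]"] f by (simp only: list.set image_empty Un_empty_right)
      then have "eval_word G z (reduce_word f) \<noteq> \<one>\<^bsub>G\<^esub>"
        using G(2) False reduced_act_word[OF reduced_word_Nil, of f] unfolding free_family_def by blast
      then have "eval_word G z f \<noteq> \<one>\<^bsub>G\<^esub>" using G.eval_reduce_word[OF zf] by simp
      moreover have "eval_word G z f = \<one>\<^bsub>G\<^esub>" if "syllable_value G (?p n) l' = \<one>\<^bsub>G\<^esub>" for n
      proof (cases b)
        case True
        then show ?thesis using that 2 zf G.eval_word_closed[OF zf] by (simp add: conjugate_copy_def[abs_def])
      next
        case False
        let ?s = "c [^]\<^bsub>G\<^esub> n"
        have "?s \<otimes>\<^bsub>G\<^esub> eval_word G z f \<otimes>\<^bsub>G\<^esub> inv\<^bsub>G\<^esub> ?s = \<one>\<^bsub>G\<^esub>"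
          using that 2 False c zf G.eval_word_closed[OF zf] G.eval_word_conjugate[of ?s z f]
          by (simp add: conjugate_copy_def[abs_def])
        moreover define y where "y = eval_word G z f"
        ultimately have "inv\<^bsub>G\<^esub> ?s \<otimes>\<^bsub>G\<^esub> (?s \<otimes>\<^bsub>G\<^esub> y \<otimes>\<^bsub>G\<^esub> inv\<^bsub>G\<^esub> ?s) \<otimes>\<^bsub>G\<^esub> ?s = \<one>\<^bsub>G\<^esub>"
          using c by simp
        moreover have y: "y \<in> carrier G" using G.eval_word_closed[OF zf] by (simp add: y_def)
        then have "inv\<^bsub>G\<^esub> ?s \<otimes>\<^bsub>G\<^esub> (?s \<otimes>\<^bsub>G\<^esub> y \<otimes>\<^bsub>G\<^esub> inv\<^bsub>G\<^esub> ?s) \<otimes>\<^bsub>G\<^esub> ?s =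
            (inv\<^bsub>G\<^esub> ?s \<otimes>\<^bsub>G\<^esub> ?s) \<otimes>\<^bsub>G\<^esub> y \<otimes>\<^bsub>G\<^esub> (inv\<^bsub>G\<^esub> ?s \<otimes>\<^bsub>G\<^esub> ?s)"
          using c by (simp only: G.m_assoc G.m_closed G.inv_closed G.nat_pow_closed)
        ultimately show ?thesis using c y by (simp add: y_def)
      qed
      ultimately have "{n. syllable_value G (?p n) l' = \<one>\<^bsub>G\<^esub>} = {}" by auto
      then show ?thesis using vG by (simp add: c_def)
    qed
  next
    case 3
    \<comment> \<open>As \<open>k\<close> exceeds all syllable lengths, the ping-pong works from
      \<open>n = 2 * k\<close> on.\<close>
    define k where "k = Suc (Max (length ` snd ` set l'))"
    have k: "\<not> is_power (snd x) \<and> length (snd x) < k" if "x \<in> set l'" for x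
      using l'(1) 3 that by (auto simp: normalized_def k_def less_Suc_eq_le intro!: Max_ge)
    have "syllable_value G (?p n) l' \<noteq> \<one>\<^bsub>G\<^esub>" if n: "2 * k \<le> n" for n
    proof -
      let ?w = "(if fst (hd l') then [] else word_power u n) @ twisted_word u n l'"
      have alt: "alternating l'" using l'(1) by (simp add: normalized_def)
      have ne: "reduce_word ?w \<noteq> []" by (rule twisted_word_nontrivial[OF alt 3 k n])
      have tw: "fst ` set (twisted_word u n l) \<subseteq> X" if "syllables_over X l" for l
        using X that by (rule fst_set_twisted_word)
      have wX: "fst ` set ?w \<subseteq> X"
        using tw[OF l'(2)] subset_trans[OF fst_set_word_power[of u n] X] by (simp add: image_Un)
      have zw: "z ` fst ` set ?w \<subseteq> carrier G" using zX image_mono[OF wX, of z] by simp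
      have "fst ` set (reduce_word ?w) \<subseteq> X"
        using fst_act_word_subset[of ?w "[]"] wX by (simp only: list.set image_empty Un_empty_right)
      then have "eval_word G z (reduce_word ?w) \<noteq> \<one>\<^bsub>G\<^esub>"
        using G(2) ne reduced_act_word[OF reduced_word_Nil, of ?w] unfolding free_family_def by blast
      then have "eval_word G z ?w \<noteq> \<one>\<^bsub>G\<^esub>" unfolding G.eval_reduce_word[OF zw] .
      moreover have "l' \<noteq> []" using 3 by auto
      ultimately show ?thesis
        using eval_twisted_word[OF G(1) zX X alt _ l'(2), of n] by (simp add: c_def)
    qed
    then have "{n. syllable_value G (?p n) l' = \<one>\<^bsub>G\<^esub>} \<subseteq> {..<2 * k}" by (auto simp: not_le[symmetric])
    then have "finite {n. syllable_value G (?p n) l' = \<one>\<^bsub>G\<^esub>}" by (rule finite_subset) simp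
    then show ?thesis using vG by (simp add: c_def)
  qed
qed

end

subsection \<open>Homotopy classes of paths\<close>

lemma continuous_map_compose_euclidean:
  assumes "continuous_map (top_of_set S) X h" "continuous_on T \<phi>" "\<phi> ` T \<subseteq> S"
  shows "continuous_map (top_of_set T) X (\<lambda>x. h (\<phi> x))"
  using continuous_map_compose[of "top_of_set T" "top_of_set S" \<phi> X h] assms
  by (simp add: comp_def image_subset_iff_funcset)

lemma continuous_map_cong_on:
  assumes "continuous_map (top_of_set S) X f" "\<And>x. x \<in> S \<Longrightarrow> f x = g x"
  shows "continuous_map (top_of_set S) X g"
  using assms continuous_map_eq[of "top_of_set S" X f g] by simp

lemma continuous_map_glue:
  fixes \<theta> :: "'q :: topological_space \<Rightarrow> real"
  assumes "continuous_on S \<theta>"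
    and "continuous_map (top_of_set {x \<in> S. \<theta> x \<le> c}) X f"
    and "continuous_map (top_of_set {x \<in> S. c \<le> \<theta> x}) X g"
    and "\<And>x. x \<in> S \<Longrightarrow> \<theta> x = c \<Longrightarrow> f x = g x"
  shows "continuous_map (top_of_set S) X (\<lambda>x. if \<theta> x \<le> c then f x else g x)"
proof -
  have "S \<inter> {x \<in> S. P x} = {x \<in> S. P x}" for P by blast
  then show ?thesis
    using assms
    by (intro continuous_map_cases_le) (simp_all add: subtopology_subtopology)
qed

abbreviation unit_square :: "(real \<times> real) set" where
  "unit_square \<equiv> {0..1} \<times> {0..1}"

definition path_homotopic :: "'a topology \<Rightarrow> 'a \<Rightarrow> 'a \<Rightarrow> (real \<Rightarrow> 'a) \<Rightarrow> (real \<Rightarrow> 'a) \<Rightarrow> bool" where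
  "path_homotopic X a b = homotopic_with (\<lambda>h. h 0 = a \<and> h 1 = b) (top_of_set {0..1}) X"

lemma loop_homotopic_eq: "loop_homotopic X x = path_homotopic X x x"
  by (simp add: loop_homotopic_def path_homotopic_def)

definition path_between :: "'a topology \<Rightarrow> 'a \<Rightarrow> 'a \<Rightarrow> (real \<Rightarrow> 'a) \<Rightarrow> bool" where
  "path_between X a b p \<longleftrightarrow> continuous_map (top_of_set {0..1}) X p \<and> p 0 = a \<and> p 1 = b"

lemma loop_at_eq: "loop_at X x = path_between X x x"
  by (auto simp: loop_at_def path_between_def pathin_def)

lemma path_homotopic_iff:
  "path_homotopic X a b p q \<longleftrightarrow> (\<exists>h. continuous_map (top_of_set unit_square) X h \<and>
     (\<forall>t\<in>{0..1}. h (0, t) = p t) \<and> (\<forall>t\<in>{0..1}. h (1, t) = q t) \<and>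
     (\<forall>s\<in>{0..1}. h (s, 0) = a \<and> h (s, 1) = b))"
proof -
  have "prod_topology (top_of_set {0..1}) (top_of_set {0..1}) = top_of_set unit_square"
    by (simp add: subtopology_Times[symmetric])
  moreover have "path_homotopic X a b p q \<longleftrightarrow>
    (\<exists>h. continuous_map (prod_topology (top_of_set {0..1 :: real}) (top_of_set {0..1 :: real})) X h \<and>
     (\<forall>t\<in>topspace (top_of_set {0..1}). h (0, t) = p t) \<and> (\<forall>t\<in>topspace (top_of_set {0..1}). h (1, t) = q t) \<and>
     (\<forall>s\<in>{0..1}. h (s, 0) = a \<and> h (s, 1) = b))"
    unfolding path_homotopic_def by (subst homotopic_with) simp_all
  ultimately show ?thesis by simp
qed

lemma path_homotopic_refl [simp]: "path_homotopic X a b p p \<longleftrightarrow> path_between X a b p"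
  by (auto simp: path_homotopic_def path_between_def)

lemma path_homotopic_sym: "path_homotopic X a b p q \<Longrightarrow> path_homotopic X a b q p"
  by (simp add: path_homotopic_def homotopic_with_sym)

lemma path_homotopic_trans [trans]:
  "path_homotopic X a b p q \<Longrightarrow> path_homotopic X a b q r \<Longrightarrow> path_homotopic X a b p r"
  unfolding path_homotopic_def by (rule homotopic_with_trans)

lemma path_homotopic_imp_path:
  assumes "path_homotopic X a b p q"
  shows "path_between X a b p" "path_between X a b q"
  using homotopic_with_imp_continuous_maps[OF assms[unfolded path_homotopic_def]]
    homotopic_with_imp_property[OF assms[unfolded path_homotopic_def]]
  by (auto simp: path_between_def)

lemma path_homotopic_eq_on:
  assumes "path_homotopic X a b p q" "\<And>t. t \<in> {0..1} \<Longrightarrow> p' t = p t" "\<And>t. t \<in> {0..1} \<Longrightarrow> q' t = q t"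
  shows "path_homotopic X a b p' q'"
proof -
  obtain h where h: "continuous_map (top_of_set unit_square) X h" "\<forall>t\<in>{0..1}. h (0, t) = p t"
    "\<forall>t\<in>{0..1}. h (1, t) = q t" "\<forall>s\<in>{0..1}. h (s, 0) = a \<and> h (s, 1) = b"
    using assms(1) unfolding path_homotopic_iff by blast
  have "h (0, t) = p' t" "h (1, t) = q' t" if "t \<in> {0..1}" for t
    using h(2,3) assms(2,3)[OF that] that by (metis bspec)+
  with h show ?thesis unfolding path_homotopic_iff by (intro exI[of _ h]) blast
qed

text \<open>All coherence laws for paths are instances: both sides are images of paths in a convex set.\<close>

lemma path_homotopic_convex:
  fixes S :: "'v :: real_normed_vector set"
  assumes F: "continuous_map (top_of_set S) X F" and S: "convex S"
    and p: "continuous_on {0..1} p" "p ` {0..1} \<subseteq> S" and q: "continuous_on {0..1} q" "q ` {0..1} \<subseteq> S"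
    and "p 0 = q 0" "p 1 = q 1"
  shows "path_homotopic X (F (p 0)) (F (p 1)) (\<lambda>t. F (p t)) (\<lambda>t. F (q t))"
proof -
  define \<phi> where "\<phi> = (\<lambda>y. (1 - fst y) *\<^sub>R p (snd y) + fst y *\<^sub>R q (snd y))"
  have "continuous_on unit_square (\<lambda>y. p (snd y))" "continuous_on unit_square (\<lambda>y. q (snd y))"
    by (intro continuous_on_compose2[OF p(1)] continuous_on_compose2[OF q(1)] continuous_intros; force)+
  then have "continuous_on unit_square \<phi>"
    unfolding \<phi>_def by (intro continuous_intros)
  moreover have "\<phi> ` unit_square \<subseteq> S"
  proof clarify
    fix s t :: real assume "s \<in> {0..1}" "t \<in> {0..1}"
    then show "\<phi> (s, t) \<in> S"
      using p(2) q(2) convexD_alt[OF S, of "p t" "q t" s] by (auto simp: \<phi>_def image_subset_iff)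
  qed
  ultimately have "continuous_map (top_of_set unit_square) X (\<lambda>y. F (\<phi> y))"
    by (rule continuous_map_compose_euclidean[OF F])
  moreover have "(1 - s) *\<^sub>R v + s *\<^sub>R v = v" for s :: real and v :: 'v
    by (simp add: scaleR_left_diff_distrib)
  ultimately show ?thesis
    unfolding path_homotopic_iff using assms(7,8) by (intro exI[of _ "\<lambda>y. F (\<phi> y)"]) (auto simp: \<phi>_def)
qed

lemma continuous_map_join:
  assumes p: "continuous_map (top_of_set unit_square) X h" and q: "continuous_map (top_of_set unit_square) X k"
    and e: "\<And>s. s \<in> {0..1} \<Longrightarrow> h (s, 1) = k (s, 0)"
  shows "continuous_map (top_of_set unit_square) X
    (\<lambda>y. if snd y \<le> 1/2 then h (fst y, 2 * snd y) else k (fst y, 2 * snd y - 1))"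
proof (rule continuous_map_glue)
  show "continuous_map (top_of_set {x \<in> unit_square. snd x \<le> 1/2}) X (\<lambda>y. h (fst y, 2 * snd y))"
    by (rule continuous_map_compose_euclidean[OF p]) (auto intro!: continuous_intros)
  show "continuous_map (top_of_set {x \<in> unit_square. 1/2 \<le> snd x}) X (\<lambda>y. k (fst y, 2 * snd y - 1))"
    by (rule continuous_map_compose_euclidean[OF q]) (auto intro!: continuous_intros)
  show "h (fst y, 2 * snd y) = k (fst y, 2 * snd y - 1)" if "y \<in> unit_square" "snd y = 1/2" for y
  proof -
    have "2 * snd y = 1" using that(2) by simp
    then show ?thesis using e[of "fst y"] that(1) by (simp add: mem_Times_iff)
  qed
qed (intro continuous_intros)

lemma path_homotopic_join:
  assumes "path_homotopic X a b p p'" "path_homotopic X b c q q'"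
  shows "path_homotopic X a c (loop_join p q) (loop_join p' q')"
proof -
  obtain h where h: "continuous_map (top_of_set unit_square) X h" "\<forall>t\<in>{0..1}. h (0, t) = p t"
    "\<forall>t\<in>{0..1}. h (1, t) = p' t" "\<forall>s\<in>{0..1}. h (s, 0) = a \<and> h (s, 1) = b"
    using assms(1) unfolding path_homotopic_iff by blast
  obtain k where k: "continuous_map (top_of_set unit_square) X k" "\<forall>t\<in>{0..1}. k (0, t) = q t"
    "\<forall>t\<in>{0..1}. k (1, t) = q' t" "\<forall>s\<in>{0..1}. k (s, 0) = b \<and> k (s, 1) = c"
    using assms(2) unfolding path_homotopic_iff by blast
  let ?H = "\<lambda>y. if snd y \<le> 1/2 then h (fst y, 2 * snd y) else k (fst y, 2 * snd y - 1)"
  have "continuous_map (top_of_set unit_square) X ?H"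
    using h k by (intro continuous_map_join) auto
  moreover have "\<forall>t\<in>{0..1}. ?H (0, t) = loop_join p q t" "\<forall>t\<in>{0..1}. ?H (1, t) = loop_join p' q' t"
    "\<forall>s\<in>{0..1}. ?H (s, 0) = a \<and> ?H (s, 1) = c"
    using h k by (auto simp: loop_join_def)
  ultimately show ?thesis unfolding path_homotopic_iff by (intro exI[of _ ?H] conjI)
qed

lemma path_between_join:
  "path_between X a b p \<Longrightarrow> path_between X b c q \<Longrightarrow> path_between X a c (loop_join p q)"
  using path_homotopic_join[of X a b p p c q q] by (simp only: path_homotopic_refl)

lemma path_between_compose:
  assumes "continuous_map (top_of_set S) X F" "continuous_on {0..1} p" "p ` {0..1} \<subseteq> S"
  shows "path_between X (F (p 0)) (F (p 1)) (\<lambda>t. F (p t))"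
  using continuous_map_compose_euclidean[OF assms] by (simp add: path_between_def)

lemma path_between_const: "a \<in> topspace X \<Longrightarrow> path_between X a a (\<lambda>t. a)"
  by (simp add: path_between_def)

lemma path_homotopic_reparam:
  assumes p: "path_between X a b p"
    and \<phi>: "continuous_on {0..1} \<phi>" "\<phi> ` {0..1} \<subseteq> {0..1}" and \<psi>: "continuous_on {0..1} \<psi>" "\<psi> ` {0..1} \<subseteq> {0..1}"
    and "\<phi> 0 = \<psi> 0" "\<phi> 1 = \<psi> 1"
    and "\<And>t. t \<in> {0..1} \<Longrightarrow> q t = p (\<phi> t)" "\<And>t. t \<in> {0..1} \<Longrightarrow> r t = p (\<psi> t)"
  shows "path_homotopic X (p (\<phi> 0)) (p (\<phi> 1)) q r"
proof -
  have "path_homotopic X (p (\<phi> 0)) (p (\<phi> 1)) (\<lambda>t. p (\<phi> t)) (\<lambda>t. p (\<psi> t))"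
    by (rule path_homotopic_convex[OF _ _ \<phi> \<psi> assms(6,7)]) (use p in \<open>simp_all add: path_between_def\<close>)
  then show ?thesis
    by (rule path_homotopic_eq_on) (simp_all add: assms(8,9))
qed

lemma path_homotopic_assoc:
  assumes p: "path_between X a b p" and q: "path_between X b c q" and r: "path_between X c d r"
  shows "path_homotopic X a d (loop_join (loop_join p q) r) (loop_join p (loop_join q r))"
proof -
  let ?P = "loop_join (loop_join p q) r"
  have P: "path_between X a d ?P" by (rule path_between_join[OF path_between_join[OF p q] r])
  \<comment> \<open>The reparametrization has slopes \<open>1/2\<close>, \<open>1\<close>,
    \<open>2\<close>. It is convex, hence the maximum of its affine pieces, which makes continuity
    immediate.\<close>
  let ?\<phi> = "\<lambda>t :: real. max (t / 2) (max (t - 1/4) (2 * t - 1))"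
  have "p 1 = q 0" "q 1 = r 0" using assms by (auto simp: path_between_def)
  then have e: "loop_join p (loop_join q r) t = ?P (?\<phi> t)" if "t \<in> {0..1}" for t
  proof -
    consider "t \<le> 1/2" | "1/2 < t" "t \<le> 3/4" | "3/4 < t" by linarith
    then show ?thesis
    proof cases
      case 1
      then have "?\<phi> t = t / 2" using that by auto
      then show ?thesis using 1 that by (simp add: loop_join_def)
    next
      case 2
      then have "?\<phi> t = t - 1/4" using that by auto
      then show ?thesis using 2 that by (simp add: loop_join_def algebra_simps)
    next
      case 3
      then have "?\<phi> t = 2 * t - 1" using that by auto
      then show ?thesis using 3 that by (simp add: loop_join_def algebra_simps)
    qed
  qed
  have "path_homotopic X (?P 0) (?P 1) ?P (loop_join p (loop_join q r))"
  proof -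
    have c: "continuous_on {0..1} ?\<phi>" by (intro continuous_intros) simp_all
    have i: "?\<phi> ` {0..1} \<subseteq> {0..1}" by (auto simp: le_max_iff_disj)
    show ?thesis
      by (rule path_homotopic_reparam[OF P, of "\<lambda>t. t" ?\<phi>, OF _ _ c i _ _ refl e]) simp_all
  qed
  then show ?thesis using P by (simp add: path_between_def)
qed

lemma path_homotopic_const_left:
  assumes p: "path_between X a b p"
  shows "path_homotopic X a b (loop_join (\<lambda>t. a) p) p"
proof -
  have "path_homotopic X (p 0) (p 1) (loop_join (\<lambda>t. a) p) p"
  proof -
    let ?\<phi> = "\<lambda>t :: real. max 0 (2 * t - 1)"
    have "continuous_on {0..1} ?\<phi>" by (intro continuous_intros)
    moreover have "?\<phi> ` {0..1} \<subseteq> {0..1}" by (auto simp: le_max_iff_disj)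
    moreover have "loop_join (\<lambda>t. a) p t = p (?\<phi> t)" for t
    proof -
      have "?\<phi> t = (if t \<le> 1/2 then 0 else 2 * t - 1)" by auto
      then show ?thesis using p by (simp only: loop_join_def path_between_def split: if_split) simp
    qed
    ultimately show ?thesis using p
      path_homotopic_reparam[OF p, of ?\<phi> "\<lambda>t. t" "loop_join (\<lambda>t. a) p" p] by simp
  qed
  then show ?thesis using p by (simp add: path_between_def)
qed

lemma path_homotopic_const_right:
  assumes p: "path_between X a b p"
  shows "path_homotopic X a b (loop_join p (\<lambda>t. b)) p"
proof -
  have "path_homotopic X (p 0) (p 1) (loop_join p (\<lambda>t. b)) p"
  proof -
    let ?\<phi> = "\<lambda>t :: real. min 1 (2 * t)"
    have "continuous_on {0..1} ?\<phi>" by (intro continuous_intros)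
    moreover have "?\<phi> ` {0..1} \<subseteq> {0..1}" by auto
    moreover have "loop_join p (\<lambda>t. b) t = p (?\<phi> t)" for t
    proof -
      have "?\<phi> t = (if t \<le> 1/2 then 2 * t else 1)" by auto
      then show ?thesis using p by (simp only: loop_join_def path_between_def split: if_split) simp
    qed
    ultimately show ?thesis using p
      path_homotopic_reparam[OF p, of ?\<phi> "\<lambda>t. t" "loop_join p (\<lambda>t. b)" p] by simp
  qed
  then show ?thesis using p by (simp add: path_between_def)
qed

definition path_reverse :: "(real \<Rightarrow> 'a) \<Rightarrow> real \<Rightarrow> 'a" where
  "path_reverse p t = p (1 - t)"

lemma path_between_reverse: "path_between X a b p \<Longrightarrow> path_between X b a (path_reverse p)"
proof -
  assume p: "path_between X a b p"
  have "continuous_map (top_of_set {0..1}) X (\<lambda>t. p (1 - t))"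
    by (rule continuous_map_compose_euclidean[of "{0..1}"])
      (use p in \<open>auto simp: path_between_def intro: continuous_on_diff continuous_on_const continuous_on_id\<close>)
  then show ?thesis using p by (simp add: path_between_def path_reverse_def[abs_def])
qed

lemma path_homotopic_cancel_left:
  assumes p: "path_between X a b p"
  shows "path_homotopic X b b (loop_join (path_reverse p) p) (\<lambda>t. b)"
proof -
  have "path_homotopic X (p 1) (p 1) (loop_join (path_reverse p) p) (\<lambda>t. b)"
  proof -
    let ?\<phi> = "\<lambda>t :: real. max (1 - 2 * t) (2 * t - 1)"
    have "continuous_on {0..1} ?\<phi>" by (intro continuous_intros)
    moreover have "?\<phi> ` {0..1} \<subseteq> {0..1}" by (auto simp: le_max_iff_disj)
    moreover have "loop_join (path_reverse p) p t = p (?\<phi> t)" for t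
    proof -
      have "?\<phi> t = (if t \<le> 1/2 then 1 - 2 * t else 2 * t - 1)" by auto
      then show ?thesis by (simp only: loop_join_def path_reverse_def split: if_split) simp
    qed
    moreover have "continuous_on {0..1} (\<lambda>t :: real. 1 :: real)" "(\<lambda>t :: real. 1 :: real) ` {0..1} \<subseteq> {0..1}"
      by auto
    moreover have "p 1 = b" using p by (simp add: path_between_def)
    ultimately show ?thesis
      using path_homotopic_reparam[OF p, of ?\<phi> "\<lambda>t. 1" "loop_join (path_reverse p) p" "\<lambda>t. b"] by simp
  qed
  then show ?thesis using p by (simp add: path_between_def)
qed

section \<open>The group structure on homotopy classes of loops\<close>

lemma loop_class_eq_iff:
  assumes "path_between X x x p"
  shows "loop_class X x p = loop_class X x q \<longleftrightarrow> path_homotopic X x x p q"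
proof
  assume "loop_class X x p = loop_class X x q"
  moreover have "p \<in> loop_class X x p"
    using assms by (simp add: loop_class_def loop_at_eq loop_homotopic_eq)
  ultimately show "path_homotopic X x x p q"
    by (auto simp: loop_class_def loop_homotopic_eq intro: path_homotopic_sym)
next
  assume "path_homotopic X x x p q"
  then show "loop_class X x p = loop_class X x q"
    unfolding loop_class_def loop_homotopic_eq
    by (auto intro: path_homotopic_trans path_homotopic_sym)
qed

lemma fundamental_group_simps:
  "carrier (fundamental_group X x) = loop_class X x ` {p. path_between X x x p}"
  "\<one>\<^bsub>fundamental_group X x\<^esub> = loop_class X x (\<lambda>t. x)"
  by (auto simp: fundamental_group_def loop_at_eq)

text \<open>The product is a union over all pairs of representatives; homotopy invariance of
  \<open>loop_join\<close> makes all members of the union equal.\<close>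

lemma loop_class_mult:
  assumes "path_between X x x p" "path_between X x x q"
  shows "loop_class X x p \<otimes>\<^bsub>fundamental_group X x\<^esub> loop_class X x q = loop_class X x (loop_join p q)"
proof -
  have e: "loop_class X x (loop_join p' q') = loop_class X x (loop_join p q)"
    if "p' \<in> loop_class X x p" "q' \<in> loop_class X x q" for p' q'
  proof -
    have "path_homotopic X x x p p'" "path_homotopic X x x q q'"
      using that by (auto simp: loop_class_def loop_homotopic_eq)
    then have h: "path_homotopic X x x (loop_join p q) (loop_join p' q')"
      by (rule path_homotopic_join)
    show ?thesis
      by (rule sym, rule iffD2[OF loop_class_eq_iff[OF path_homotopic_imp_path(1)[OF h]] h])
  qed
  have "loop_class X x p \<otimes>\<^bsub>fundamental_group X x\<^esub> loop_class X x q =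
      (\<Union>p'\<in>loop_class X x p. \<Union>q'\<in>loop_class X x q. loop_class X x (loop_join p' q'))"
    by (simp add: fundamental_group_def)
  also have "\<dots> = (\<Union>p'\<in>loop_class X x p. \<Union>q'\<in>loop_class X x q. loop_class X x (loop_join p q))"
    by (intro SUP_cong refl e)
  also have "\<dots> = loop_class X x (loop_join p q)"
  proof -
    have "p \<in> loop_class X x p" "q \<in> loop_class X x q"
      using assms by (simp_all add: loop_class_def loop_at_eq loop_homotopic_eq)
    then have "loop_class X x p \<noteq> {}" "loop_class X x q \<noteq> {}" by blast+
    then show ?thesis by (simp only: SUP_const not_False_eq_True)
  qed
  finally show ?thesis .
qed

lemma group_fundamental_group:
  assumes x: "x \<in> topspace X"
  shows "group (fundamental_group X x)"
proof (rule groupI; (unfold fundamental_group_simps)?)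
  let ?c = "loop_class X x"
  have eqI: "?c p = ?c q" if "path_homotopic X x x p q" for p q
    by (rule iffD2[OF loop_class_eq_iff[OF path_homotopic_imp_path(1)[OF that]] that])
  note const = path_between_const[OF x]
  show "?c (\<lambda>t. x) \<in> ?c ` {p. path_between X x x p}" using const by blast
  fix a assume "a \<in> ?c ` {p. path_between X x x p}"
  then obtain p where p: "path_between X x x p" "a = ?c p" by blast
  show "?c (\<lambda>t. x) \<otimes>\<^bsub>fundamental_group X x\<^esub> a = a"
    unfolding p(2) loop_class_mult[OF const p(1)] by (rule eqI[OF path_homotopic_const_left[OF p(1)]])
  show "\<exists>b\<in>?c ` {p. path_between X x x p}. b \<otimes>\<^bsub>fundamental_group X x\<^esub> a = ?c (\<lambda>t. x)"
    using path_between_reverse[OF p(1)] loop_class_mult[OF path_between_reverse[OF p(1)] p(1)]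
      eqI[OF path_homotopic_cancel_left[OF p(1)]] p(2) by blast
  fix b assume "b \<in> ?c ` {p. path_between X x x p}"
  then obtain q where q: "path_between X x x q" "b = ?c q" by blast
  show "a \<otimes>\<^bsub>fundamental_group X x\<^esub> b \<in> ?c ` {p. path_between X x x p}"
    unfolding p(2) q(2) loop_class_mult[OF p(1) q(1)] using path_between_join[OF p(1) q(1)] by blast
  fix d assume "d \<in> ?c ` {p. path_between X x x p}"
  then obtain r where r: "path_between X x x r" "d = ?c r" by blast
  show "a \<otimes>\<^bsub>fundamental_group X x\<^esub> b \<otimes>\<^bsub>fundamental_group X x\<^esub> d =
      a \<otimes>\<^bsub>fundamental_group X x\<^esub> (b \<otimes>\<^bsub>fundamental_group X x\<^esub> d)"
    unfolding p(2) q(2) r(2)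
    by (simp add: loop_class_mult p q r path_between_join[OF p(1) q(1)] path_between_join[OF q(1) r(1)]
        eqI[OF path_homotopic_assoc[OF p(1) q(1) r(1)]])
qed

subsection \<open>Loops in an image of a convex set\<close>

locale convex_image =
  fixes D :: "'v :: real_normed_vector set" and X :: "'a topology" and f :: "'v \<Rightarrow> 'a" and z0 :: 'v
  assumes convex: "convex D" and z0: "z0 \<in> D" and continuous: "continuous_map (top_of_set D) X f"
begin

abbreviation \<pi> where "\<pi> \<equiv> fundamental_group X (f z0)"

lemma f_topspace: "z \<in> D \<Longrightarrow> f z \<in> topspace X"
  using continuous_map_image_subset_topspace[OF continuous] by auto

sublocale group \<pi>
  by (rule group_fundamental_group[OF f_topspace[OF z0]])

definition tail :: "'v \<Rightarrow> real \<Rightarrow> 'a" where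
  "tail z t = f ((1 - t) *\<^sub>R z0 + t *\<^sub>R z)"

text \<open>Closes a path of \<open>X\<close> to a loop along the images of segments to
  \<open>z0\<close>. The loop depends on the chosen preimages \<open>z\<close> and \<open>z'\<close>
  of the ends; as \<open>D\<close> is contractible, this dependence carries all the
  topology.\<close>

definition based :: "'v \<Rightarrow> (real \<Rightarrow> 'a) \<Rightarrow> 'v \<Rightarrow> (real \<Rightarrow> 'a) set" where
  "based z p z' = loop_class X (f z0) (loop_join (loop_join (tail z) p) (path_reverse (tail z')))"

lemma segment_path:
  assumes "z \<in> D"
  shows "continuous_on {0..1} (\<lambda>t. (1 - t) *\<^sub>R z0 + t *\<^sub>R z)"
    "(\<lambda>t. (1 - t) *\<^sub>R z0 + t *\<^sub>R z) ` {0..1} \<subseteq> D"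
proof -
  show "continuous_on {0..1} (\<lambda>t. (1 - t) *\<^sub>R z0 + t *\<^sub>R z)" by (intro continuous_intros)
  show "(\<lambda>t. (1 - t) *\<^sub>R z0 + t *\<^sub>R z) ` {0..1} \<subseteq> D"
    using convexD_alt[OF convex z0 assms] by auto
qed

lemma path_tail: "z \<in> D \<Longrightarrow> path_between X (f z0) (f z) (tail z)"
  using path_between_compose[OF continuous segment_path[of z]] by (simp add: tail_def[abs_def])

lemma path_based:
  assumes "z \<in> D" "z' \<in> D" "path_between X (f z) (f z') p"
  shows "path_between X (f z0) (f z0) (loop_join (loop_join (tail z) p) (path_reverse (tail z')))"
  by (intro path_between_join[OF path_between_join[OF path_tail assms(3)]] path_between_reverse path_tail assms)

lemma based_closed:
  "z \<in> D \<Longrightarrow> z' \<in> D \<Longrightarrow> path_between X (f z) (f z') p \<Longrightarrow> based z p z' \<in> carrier \<pi>"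
  unfolding based_def fundamental_group_simps by (intro imageI CollectI path_based)

lemma loop_class_eqI: "path_homotopic X x x p q \<Longrightarrow> loop_class X x p = loop_class X x q"
  by (rule iffD2[OF loop_class_eq_iff[OF path_homotopic_imp_path(1)]])

lemma based_homotopic:
  assumes "z \<in> D" "z' \<in> D" "path_homotopic X (f z) (f z') p q"
  shows "based z p z' = based z q z'"
  unfolding based_def
proof (rule loop_class_eqI, rule path_homotopic_join[OF path_homotopic_join])
  show "path_homotopic X (f z0) (f z) (tail z) (tail z)"
    by (simp add: path_tail assms)
  show "path_homotopic X (f z') (f z0) (path_reverse (tail z')) (path_reverse (tail z'))"
    by (simp add: path_between_reverse path_tail assms)
qed (rule assms(3))

text \<open>The two passages along the segment to \<open>z'\<close> cancel; the rest is
  associativity.\<close>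

lemma based_mult:
  assumes "z \<in> D" "z' \<in> D" "z'' \<in> D" and p: "path_between X (f z) (f z') p" and q: "path_between X (f z') (f z'') q"
  shows "based z p z' \<otimes>\<^bsub>\<pi>\<^esub> based z' q z'' = based z (loop_join p q) z''"
proof -
  let ?x = "f z0"
  define d d1 d2 where "d = tail z" and "d1 = tail z'" and "d2 = path_reverse (tail z'')"
  have d: "path_between X ?x (f z) d" "path_between X ?x (f z') d1" "path_between X (f z'') ?x d2"
    unfolding d_def d1_def d2_def by (intro path_tail path_between_reverse assms)+
  let ?r = "path_reverse d1"
  have r: "path_between X (f z') ?x ?r" by (rule path_between_reverse[OF d(2)])
  have dp: "path_between X ?x (f z') (loop_join d p)" by (rule path_between_join[OF d(1) p])
  have dq: "path_between X ?x (f z'') (loop_join d1 q)" by (rule path_between_join[OF d(2) q])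
  have dqd: "path_between X ?x ?x (loop_join (loop_join d1 q) d2)" by (rule path_between_join[OF dq d(3)])
  have "path_homotopic X (f z') (f z'') (loop_join ?r (loop_join d1 q)) (loop_join (loop_join ?r d1) q)"
    by (rule path_homotopic_sym[OF path_homotopic_assoc[OF r d(2) q]])
  also have "path_homotopic X (f z') (f z'') (loop_join (loop_join ?r d1) q) (loop_join (\<lambda>t. f z') q)"
    by (rule path_homotopic_join[OF path_homotopic_cancel_left[OF d(2)]]) (simp add: q)
  also have "path_homotopic X (f z') (f z'') (loop_join (\<lambda>t. f z') q) q"
    by (rule path_homotopic_const_left[OF q])
  finally have 1: "path_homotopic X (f z') (f z'') (loop_join ?r (loop_join d1 q)) q" .
  have "path_homotopic X (f z') ?x (loop_join ?r (loop_join (loop_join d1 q) d2)) (loop_join (loop_join ?r (loop_join d1 q)) d2)"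
    by (rule path_homotopic_sym[OF path_homotopic_assoc[OF r dq d(3)]])
  also have "path_homotopic X (f z') ?x (loop_join (loop_join ?r (loop_join d1 q)) d2) (loop_join q d2)"
    by (rule path_homotopic_join[OF 1]) (simp add: d)
  finally have 2: "path_homotopic X (f z') ?x (loop_join ?r (loop_join (loop_join d1 q) d2)) (loop_join q d2)" .
  have "path_homotopic X ?x ?x (loop_join (loop_join (loop_join d p) ?r) (loop_join (loop_join d1 q) d2))
      (loop_join (loop_join d p) (loop_join ?r (loop_join (loop_join d1 q) d2)))"
    by (rule path_homotopic_assoc[OF dp r dqd])
  also have "path_homotopic X ?x ?x (loop_join (loop_join d p) (loop_join ?r (loop_join (loop_join d1 q) d2)))
      (loop_join (loop_join d p) (loop_join q d2))"
    by (rule path_homotopic_join[OF _ 2]) (simp add: dp)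
  also have "path_homotopic X ?x ?x (loop_join (loop_join d p) (loop_join q d2)) (loop_join (loop_join (loop_join d p) q) d2)"
    by (rule path_homotopic_sym[OF path_homotopic_assoc[OF dp q d(3)]])
  also have "path_homotopic X ?x ?x (loop_join (loop_join (loop_join d p) q) d2) (loop_join (loop_join d (loop_join p q)) d2)"
    by (rule path_homotopic_join[OF path_homotopic_assoc[OF d(1) p q]]) (simp add: d)
  finally have 3: "path_homotopic X ?x ?x (loop_join (loop_join (loop_join d p) ?r) (loop_join (loop_join d1 q) d2))
      (loop_join (loop_join d (loop_join p q)) d2)" .
  show ?thesis
    unfolding based_def loop_class_mult[OF path_based[OF assms(1,2) p] path_based[OF assms(2,3) q]]
    using loop_class_eqI[OF 3] by (simp add: d_def d1_def d2_def)
qed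

text \<open>The closed-up loop is the image of a loop in the convex set \<open>D\<close>, where it
  contracts.\<close>

lemma based_lift:
  assumes \<zeta>: "continuous_on {0..1} \<zeta>" "\<zeta> ` {0..1} \<subseteq> D"
    and p: "\<And>t. t \<in> {0..1} \<Longrightarrow> p t = f (\<zeta> t)"
  shows "based (\<zeta> 0) p (\<zeta> 1) = \<one>\<^bsub>\<pi>\<^esub>"
proof -
  have e: "\<zeta> 0 \<in> D" "\<zeta> 1 \<in> D" using \<zeta>(2) by (simp_all add: image_subset_iff)
  let ?s = "\<lambda>z t. (1 - t) *\<^sub>R z0 + t *\<^sub>R z"
  let ?T = "top_of_set D"
  let ?\<psi> = "loop_join (loop_join (?s (\<zeta> 0)) \<zeta>) (path_reverse (?s (\<zeta> 1)))"
  have s: "path_between ?T z0 z (?s z)" if "z \<in> D" for z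
    using segment_path[OF that] by (simp add: path_between_def image_subset_iff_funcset)
  have "path_between ?T (\<zeta> 0) (\<zeta> 1) \<zeta>"
    using \<zeta> by (simp add: path_between_def image_subset_iff_funcset)
  then have "path_between ?T z0 z0 ?\<psi>"
    by (rule path_between_join[OF path_between_join[OF s[OF e(1)]] path_between_reverse[OF s[OF e(2)]]])
  then have \<psi>: "continuous_on {0..1} ?\<psi>" "?\<psi> ` {0..1} \<subseteq> D" "?\<psi> 0 = z0" "?\<psi> 1 = z0"
    by (simp_all add: path_between_def image_subset_iff_funcset)
  have const: "continuous_on {0..1} (\<lambda>t :: real. z0)" "(\<lambda>t :: real. z0) ` {0..1} \<subseteq> D" using z0 by auto
  have "path_homotopic X (f (?\<psi> 0)) (f (?\<psi> 1)) (\<lambda>t. f (?\<psi> t)) (\<lambda>t. f z0)"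
    by (rule path_homotopic_convex[OF continuous convex \<psi>(1,2) const \<psi>(3,4)])
  then have "path_homotopic X (f z0) (f z0) (\<lambda>t. f (?\<psi> t)) (\<lambda>t. f z0)"
    unfolding \<psi>(3,4) .
  then have "path_homotopic X (f z0) (f z0)
      (loop_join (loop_join (tail (\<zeta> 0)) p) (path_reverse (tail (\<zeta> 1)))) (\<lambda>t. f z0)"
    by (rule path_homotopic_eq_on) (auto simp: loop_join_def tail_def path_reverse_def p)
  then show ?thesis unfolding based_def fundamental_group_simps by (rule loop_class_eqI)
qed

lemma loop_class_eq_based:
  assumes p: "path_between X (f z0) (f z0) p"
  shows "loop_class X (f z0) p = based z0 p z0"
proof -
  have t: "tail z0 = (\<lambda>t. f z0)" "path_reverse (\<lambda>t. f z0) = (\<lambda>t. f z0)"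
    by (simp_all add: tail_def[abs_def] path_reverse_def[abs_def] scaleR_left_diff_distrib)
  have "path_homotopic X (f z0) (f z0) (loop_join (loop_join (\<lambda>t. f z0) p) (\<lambda>t. f z0)) (loop_join (\<lambda>t. f z0) p)"
    by (rule path_homotopic_const_right[OF path_between_join[OF path_between_const p]]) (rule f_topspace[OF z0])
  also have "path_homotopic X (f z0) (f z0) (loop_join (\<lambda>t. f z0) p) p"
    by (rule path_homotopic_const_left[OF p])
  finally show ?thesis unfolding based_def t by (rule loop_class_eqI[symmetric])
qed

text \<open>A constant path whose ends are given different preimages: the loop runs in
  \<open>D\<close> to \<open>z\<close>, passes through the gluing to \<open>z'\<close> and returns
  in \<open>D\<close>.\<close>

definition jump :: "'v \<Rightarrow> 'v \<Rightarrow> (real \<Rightarrow> 'a) set" where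
  "jump z z' = based z (\<lambda>t. f z) z'"

lemma path_jump: "z \<in> D \<Longrightarrow> f z = f z' \<Longrightarrow> path_between X (f z) (f z') (\<lambda>t. f z)"
  using f_topspace[of z] by (simp add: path_between_def)

lemma jump_closed: "z \<in> D \<Longrightarrow> z' \<in> D \<Longrightarrow> f z = f z' \<Longrightarrow> jump z z' \<in> carrier \<pi>"
  unfolding jump_def by (intro based_closed path_jump)

lemma jump_mult:
  assumes "z \<in> D" "z' \<in> D" "z'' \<in> D" "f z = f z'" "f z' = f z''"
  shows "jump z z' \<otimes>\<^bsub>\<pi>\<^esub> jump z' z'' = jump z z''"
proof -
  have "loop_join (\<lambda>t. f z) (\<lambda>t. f z') = (\<lambda>t. f z)" using assms(4) by (simp add: loop_join_def[abs_def])
  then show ?thesis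
    unfolding jump_def using based_mult[OF assms(1-3) path_jump[OF assms(1,4)] path_jump[OF assms(2,5)]] by simp
qed

lemma jump_refl: "z \<in> D \<Longrightarrow> jump z z = \<one>\<^bsub>\<pi>\<^esub>"
  using based_lift[of "\<lambda>t. z" "\<lambda>t. f z"] by (auto simp: jump_def)

lemma jump_inv:
  assumes "z \<in> D" "z' \<in> D" "f z = f z'"
  shows "jump z' z = inv\<^bsub>\<pi>\<^esub> jump z z'"
  using jump_mult[OF assms(2,1,2)] jump_refl[OF assms(2)] jump_closed[OF assms] jump_closed[OF assms(2,1)] assms(3)
  by (metis inv_equality)

text \<open>When a pair of identified points moves continuously, the common image path lifts to
  \<open>D\<close> from either partner, so it has trivial class with both choices and can be
  inserted before or after the jump.\<close>

lemma jump_invariant: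
  fixes \<zeta> \<xi> :: "real \<Rightarrow> 'v"
  assumes \<zeta>: "continuous_on {0..1} \<zeta>" "\<zeta> ` {0..1} \<subseteq> D" and \<xi>: "continuous_on {0..1} \<xi>" "\<xi> ` {0..1} \<subseteq> D"
    and e: "\<And>t. t \<in> {0..1} \<Longrightarrow> f (\<zeta> t) = f (\<xi> t)"
  shows "jump (\<zeta> 0) (\<xi> 0) = jump (\<zeta> 1) (\<xi> 1)"
proof -
  have D: "\<zeta> 0 \<in> D" "\<zeta> 1 \<in> D" "\<xi> 0 \<in> D" "\<xi> 1 \<in> D"
    using subsetD[OF \<zeta>(2) imageI, of 0] subsetD[OF \<zeta>(2) imageI, of 1]
      subsetD[OF \<xi>(2) imageI, of 0] subsetD[OF \<xi>(2) imageI, of 1] by simp_all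
  have e0: "f (\<zeta> 0) = f (\<xi> 0)" and e1: "f (\<zeta> 1) = f (\<xi> 1)" using e by simp_all
  let ?r = "\<lambda>t. f (\<zeta> t)"
  have r: "path_between X (f (\<zeta> 0)) (f (\<zeta> 1)) ?r" by (rule path_between_compose[OF continuous \<zeta>])
  have r': "path_between X (f (\<xi> 0)) (f (\<xi> 1)) ?r" using r e0 e1 by simp
  have r'': "path_between X (f (\<zeta> 0)) (f (\<xi> 1)) ?r" using r e1 by simp
  have 1: "based (\<zeta> 0) ?r (\<zeta> 1) = \<one>\<^bsub>\<pi>\<^esub>" "based (\<xi> 0) ?r (\<xi> 1) = \<one>\<^bsub>\<pi>\<^esub>"
    by (rule based_lift[OF \<zeta> refl], rule based_lift[OF \<xi> e])
  have "jump (\<zeta> 0) (\<xi> 0) = jump (\<zeta> 0) (\<xi> 0) \<otimes>\<^bsub>\<pi>\<^esub> based (\<xi> 0) ?r (\<xi> 1)"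
    unfolding 1(2) using jump_closed[OF D(1,3) e0] by simp
  also have "\<dots> = based (\<zeta> 0) (loop_join (\<lambda>t. f (\<zeta> 0)) ?r) (\<xi> 1)"
    unfolding jump_def by (rule based_mult[OF D(1,3,4) path_jump[OF D(1) e0] r'])
  also have "\<dots> = based (\<zeta> 0) ?r (\<xi> 1)"
    by (rule based_homotopic[OF D(1,4) path_homotopic_const_left[OF r'']])
  also have "\<dots> = based (\<zeta> 0) (loop_join ?r (\<lambda>t. f (\<zeta> 1))) (\<xi> 1)"
    using path_homotopic_const_right[OF r''] e1 by (intro based_homotopic[symmetric] D) simp
  also have "\<dots> = based (\<zeta> 0) ?r (\<zeta> 1) \<otimes>\<^bsub>\<pi>\<^esub> jump (\<zeta> 1) (\<xi> 1)"
    unfolding jump_def by (rule based_mult[symmetric, OF D(1,2,4) r path_jump[OF D(2) e1]])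
  also have "\<dots> = jump (\<zeta> 1) (\<xi> 1)"
    unfolding 1(1) using jump_closed[OF D(2,4) e1] by simp
  finally show ?thesis .
qed

section \<open>Charts of a quotient of a convex set\<close>

definition saturated_open :: "'v set \<Rightarrow> bool" where
  "saturated_open W \<longleftrightarrow> openin (top_of_set D) W \<and> (\<forall>z\<in>W. \<forall>w\<in>D. f z = f w \<longrightarrow> w \<in> W)"

lemma saturatedD: "saturated_open W \<Longrightarrow> w \<in> W \<Longrightarrow> z \<in> D \<Longrightarrow> f z = f w \<Longrightarrow> z \<in> W"
  unfolding saturated_open_def by metis

lemma saturated_open_subset: "saturated_open W \<Longrightarrow> W \<subseteq> D"
  unfolding saturated_open_def using openin_imp_subset by blast

lemma saturated_preimage:
  assumes "saturated_open W"
  shows "{z \<in> D. f z \<in> f ` W} = W"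
proof
  show "{z \<in> D. f z \<in> f ` W} \<subseteq> W" using saturatedD[OF assms] by auto
  show "W \<subseteq> {z \<in> D. f z \<in> f ` W}" using saturated_open_subset[OF assms] by auto
qed

text \<open>The deformation respects the fibres of \<open>f\<close>, hence descends to
  \<open>X\<close>, and it ends in a locally constant map. So it pushes a path in the image of
  \<open>W\<close> to a single point of \<open>X\<close> while the ends move along paths that lift
  to \<open>D\<close>.\<close>

definition contraction_chart :: "'v set \<Rightarrow> (real \<times> 'v \<Rightarrow> 'v) \<Rightarrow> bool" where
  "contraction_chart W h \<longleftrightarrow> saturated_open W \<and> continuous_on ({0..1} \<times> W) h \<and>
     h ` ({0..1} \<times> W) \<subseteq> D \<and> (\<forall>z\<in>W. h (0, z) = z) \<and>
     (\<forall>s\<in>{0..1}. \<forall>z\<in>W. \<forall>w\<in>W. f z = f w \<longrightarrow> f (h (s, z)) = f (h (s, w))) \<and>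
     (\<forall>z\<in>W. \<exists>U. open U \<and> z \<in> U \<and> (\<forall>w\<in>U \<inter> W. h (1, w) = h (1, z)))"

end

locale convex_quotient = convex_image D X f z0
  for D :: "'v :: real_normed_vector set" and X :: "'a topology" and f :: "'v \<Rightarrow> 'a" and z0 :: 'v +
  assumes quotient: "quotient_map (top_of_set D) X f"
begin

lemma f_onto: "x \<in> topspace X \<Longrightarrow> \<exists>z\<in>D. f z = x"
proof -
  assume "x \<in> topspace X"
  then have "x \<in> f ` D" using quotient_imp_surjective_map[OF quotient] by simp
  then show ?thesis by blast
qed

lemma openin_image:
  assumes "saturated_open W"
  shows "openin X (f ` W)"
proof -
  have W: "W \<subseteq> D" by (rule saturated_open_subset[OF assms])
  then have "f ` W \<subseteq> topspace X" using f_topspace by auto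
  then have "openin (top_of_set D) {z \<in> topspace (top_of_set D). f z \<in> f ` W} = openin X (f ` W)"
    using quotient unfolding quotient_map_def by blast
  then show ?thesis
    using saturated_preimage[OF assms] assms unfolding saturated_open_def by simp
qed

lemma local_saturated:
  assumes h: "continuous_map (top_of_set Q) X h" and W: "saturated_open W" and q: "q \<in> Q" "h q \<in> f ` W"
  obtains N where "open N" "q \<in> N" "\<And>r z. r \<in> N \<Longrightarrow> r \<in> Q \<Longrightarrow> z \<in> D \<Longrightarrow> f z = h r \<Longrightarrow> z \<in> W"
    "\<And>r. r \<in> N \<Longrightarrow> r \<in> Q \<Longrightarrow> h r \<in> f ` W"
proof -
  have "openin (top_of_set Q) {r \<in> Q. h r \<in> f ` W}"
    using openin_continuous_map_preimage[OF h openin_image[OF W]] by simp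
  then obtain N where N: "open N" "{r \<in> Q. h r \<in> f ` W} = N \<inter> Q"
    by (metis openin_open Int_commute)
  have r: "h r \<in> f ` W" if "r \<in> N" "r \<in> Q" for r using N(2) that by blast
  moreover have "z \<in> W" if "r \<in> N" "r \<in> Q" "z \<in> D" "f z = h r" for r z
    using r[OF that(1,2)] saturatedD[OF W _ that(3)] that(4) by auto
  moreover have "q \<in> N" using N(2) q by blast
  ultimately show ?thesis using that[OF N(1)] by blast
qed

text \<open>The quotient map restricts to \<open>W\<close> because the image of \<open>W\<close> is
  open, and its product with the identity of the locally compact space \<open>{0..1}\<close> is
  again a quotient map.\<close>

lemma continuous_map_descend:
  assumes "contraction_chart W h"
  obtains k where "continuous_map (prod_topology (top_of_set {0..1}) (subtopology X (f ` W))) X k"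
    "\<And>s z. s \<in> {0..1} \<Longrightarrow> z \<in> W \<Longrightarrow> k (s, f z) = f (h (s, z))"
proof -
  have W: "saturated_open W" "W \<subseteq> D" and h: "continuous_on ({0..1} \<times> W) h" "h ` ({0..1} \<times> W) \<subseteq> D"
    and inv: "\<And>s z w. s \<in> {0..1} \<Longrightarrow> z \<in> W \<Longrightarrow> w \<in> W \<Longrightarrow> f z = f w \<Longrightarrow> f (h (s, z)) = f (h (s, w))"
    using assms saturated_open_subset unfolding contraction_chart_def by blast+
  define k where "k = (\<lambda>(s, y). f (h (s, SOME z. z \<in> W \<and> f z = y)))"
  have k: "k (s, f z) = f (h (s, z))" if "s \<in> {0..1}" "z \<in> W" for s z
  proof -
    have "(SOME w. w \<in> W \<and> f w = f z) \<in> W \<and> f (SOME w. w \<in> W \<and> f w = f z) = f z"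
      by (rule someI[of _ z]) (simp add: that)
    then show ?thesis using inv[OF that(1) _ that(2)] by (simp add: k_def)
  qed
  have "{z \<in> topspace (top_of_set D). f z \<in> f ` W} = W"
    using saturated_preimage[OF W(1)] by simp
  then have "quotient_map (subtopology (top_of_set D) W) (subtopology X (f ` W)) f"
    using quotient_map_restriction[OF quotient] openin_image[OF W(1)] by blast
  moreover have "subtopology (top_of_set D) W = top_of_set W"
    using W(2) by (simp add: subtopology_subtopology Int_absorb1)
  ultimately have "quotient_map (top_of_set W) (subtopology X (f ` W)) f" by simp
  then have q: "quotient_map (prod_topology (top_of_set {0..1 :: real}) (top_of_set W))
      (prod_topology (top_of_set {0..1 :: real}) (subtopology X (f ` W))) (\<lambda>(s, z). (s, f z))"
    by (intro quotient_map_prod_right compact_imp_locally_compact_space disjI1)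
      (simp_all add: compact_space_subtopology Hausdorff_space_subtopology)
  have "continuous_map (top_of_set ({0..1} \<times> W)) X (\<lambda>x. f (h x))"
    by (rule continuous_map_compose_euclidean[OF continuous h])
  then have "continuous_map (top_of_set ({0..1} \<times> W)) X (k \<circ> (\<lambda>(s, z). (s, f z)))"
    by (rule continuous_map_cong_on) (auto simp: k)
  then have "continuous_map (prod_topology (top_of_set {0..1}) (top_of_set W)) X (k \<circ> (\<lambda>(s, z). (s, f z)))"
    by (simp add: subtopology_Times[symmetric])
  then have "continuous_map (prod_topology (top_of_set {0..1}) (subtopology X (f ` W))) X k"
    by (rule continuous_compose_quotient_map[OF q])
  then show ?thesis using that k by blast
qed


lemma contraction_chartD:
  assumes "contraction_chart W h"
  shows "saturated_open W" "W \<subseteq> D" "continuous_on ({0..1} \<times> W) h"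
    "\<And>s z. s \<in> {0..1} \<Longrightarrow> z \<in> W \<Longrightarrow> h (s, z) \<in> D" "\<And>z. z \<in> W \<Longrightarrow> h (0, z) = z"
    "\<And>z w. z \<in> W \<Longrightarrow> w \<in> W \<Longrightarrow> f z = f w \<Longrightarrow> f (h (1, z)) = f (h (1, w))"
    "\<And>z. z \<in> W \<Longrightarrow> \<exists>U. open U \<and> z \<in> U \<and> (\<forall>w\<in>U \<inter> W. h (1, w) = h (1, z))"
proof -
  show "saturated_open W" "continuous_on ({0..1} \<times> W) h"
    "\<And>z. z \<in> W \<Longrightarrow> h (0, z) = z"
    "\<And>z. z \<in> W \<Longrightarrow> \<exists>U. open U \<and> z \<in> U \<and> (\<forall>w\<in>U \<inter> W. h (1, w) = h (1, z))"
    using assms unfolding contraction_chart_def by blast+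
  then show "W \<subseteq> D" by (intro saturated_open_subset)
  show "h (s, z) \<in> D" if "s \<in> {0..1}" "z \<in> W" for s z
  proof -
    have "h ` ({0..1} \<times> W) \<subseteq> D" using assms unfolding contraction_chart_def by blast
    then show ?thesis by (rule subsetD) (use that in simp)
  qed
  show "f (h (1, z)) = f (h (1, w))" if "z \<in> W" "w \<in> W" "f z = f w" for z w
  proof -
    have "\<forall>s\<in>{0..1}. \<forall>z\<in>W. \<forall>w\<in>W. f z = f w \<longrightarrow> f (h (s, z)) = f (h (s, w))"
      using assms unfolding contraction_chart_def by blast
    then have "\<forall>z\<in>W. \<forall>w\<in>W. f z = f w \<longrightarrow> f (h (1, z)) = f (h (1, w))" by (rule bspec) simp
    then show ?thesis using that by blast
  qed
qed

text \<open>The point of \<open>X\<close> in which the contraction ends depends only on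
  \<open>p t\<close>, and locally constantly; the interval is connected. The selection
  \<open>r\<close> of preimages may be discontinuous, as the sets \<open>V\<close> are
  saturated.\<close>

lemma chart_core_constant:
  assumes h: "contraction_chart W h" and p: "continuous_map (top_of_set {0..1 :: real}) X p" "p ` {0..1} \<subseteq> f ` W"
    and z: "z \<in> W" "f z = p s" "s \<in> {0..1}" and z': "z' \<in> W" "f z' = p t" "t \<in> {0..1}"
  shows "f (h (1, z)) = f (h (1, z'))"
proof -
  note H = contraction_chartD[OF h]
  define r where "r = (\<lambda>t. SOME z. z \<in> W \<and> f z = p t)"
  have r: "r t \<in> W \<and> f (r t) = p t" if "t \<in> {0..1}" for t
  proof -
    have "p t \<in> f ` W" using p(2) that by auto
    then have "\<exists>z. z \<in> W \<and> f z = p t" by auto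
    from someI_ex[OF this] show ?thesis by (simp only: r_def)
  qed
  have "f (h (1, r s)) = f (h (1, r t))"
  proof (rule connected_local_const[of "{0..1}"])
    show "\<forall>a\<in>{0..1}. \<forall>\<^sub>F b in at a within {0..1}. f (h (1, r a)) = f (h (1, r b))"
    proof
      fix a :: real assume a: "a \<in> {0..1}"
      define V where "V = {w \<in> W. f (h (1, w)) = f (h (1, r a))}"
      have "saturated_open V"
        unfolding saturated_open_def
      proof
        show "openin (top_of_set D) V"
        proof (subst openin_subopen, intro ballI)
          fix w assume w: "w \<in> V"
          then obtain U where U: "open U" "w \<in> U" "\<forall>v\<in>U \<inter> W. h (1, v) = h (1, w)"
            using H(7)[of w] by (auto simp: V_def)
          have "openin (top_of_set D) (W \<inter> U)"
            using H(1) U(1) unfolding saturated_open_def by (intro openin_Int_open) auto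
          moreover have "w \<in> W \<inter> U" using w U(2) by (simp add: V_def)
          moreover have "v \<in> V" if "v \<in> W \<inter> U" for v
          proof -
            have "h (1, v) = h (1, w)" using U(3) that by blast
            then show ?thesis using that w by (simp add: V_def)
          qed
          ultimately show "\<exists>T. openin (top_of_set D) T \<and> w \<in> T \<and> T \<subseteq> V" by blast
        qed
        show "\<forall>z\<in>V. \<forall>w\<in>D. f z = f w \<longrightarrow> w \<in> V"
        proof (intro ballI impI)
          fix v w assume v: "v \<in> V" and w: "w \<in> D" "f v = f w"
          then have "w \<in> W" using saturatedD[OF H(1), of v w] by (simp add: V_def)
          then show "w \<in> V" using v w H(6)[of v w] by (simp add: V_def)
        qed
      qed
      moreover have "p a \<in> f ` V" using r[OF a] by (intro image_eqI[of _ _ "r a"]) (simp_all add: V_def)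
      ultimately obtain N where N: "open N" "a \<in> N"
        "\<And>b z. b \<in> N \<Longrightarrow> b \<in> {0..1} \<Longrightarrow> z \<in> D \<Longrightarrow> f z = p b \<Longrightarrow> z \<in> V"
        using local_saturated[OF p(1), of V a] a by metis
      have "f (h (1, r a)) = f (h (1, r b))" if "b \<in> N" "b \<in> {0..1}" for b
        using N(3)[OF that, of "r b"] r[OF that(2)] H(2) by (auto simp: V_def)
      then show "\<forall>\<^sub>F b in at a within {0..1}. f (h (1, r a)) = f (h (1, r b))"
        unfolding eventually_at_topological using N(1,2) by blast
    qed
  qed (use z z' in auto)
  then show ?thesis
    using H(6)[of z "r s"] H(6)[of z' "r t"] r[OF z(3)] r[OF z'(3)] z z' by simp
qed

text \<open>Contracting the whole path gives a square whose edge \<open>p\<close> is homotopic to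
  the other three. The traces \<open>l\<close> and \<open>r\<close> of the ends lift to
  \<open>D\<close> and have trivial class; the remaining edge \<open>c\<close> is constant, hence a
  jump.\<close>

lemma chart_path:
  assumes h: "contraction_chart W h" and p: "path_between X (f z) (f z') p" "p ` {0..1} \<subseteq> f ` W"
    and z: "z \<in> W" "z' \<in> W"
  shows "f (h (1, z)) = f (h (1, z'))" "based z p z' = jump (h (1, z)) (h (1, z'))"
proof -
  note H = contraction_chartD[OF h]
  have pc: "continuous_map (top_of_set {0..1}) X p" "p 0 = f z" "p 1 = f z'" using p by (simp_all add: path_between_def)
  show core: "f (h (1, z)) = f (h (1, z'))"
    using chart_core_constant[OF h pc(1) p(2) z(1) _ _ z(2), of 0 1] pc by simp
  obtain k where k: "continuous_map (prod_topology (top_of_set {0..1}) (subtopology X (f ` W))) X k"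
    "\<And>s z. s \<in> {0..1} \<Longrightarrow> z \<in> W \<Longrightarrow> k (s, f z) = f (h (s, z))"
    using continuous_map_descend[OF h] by metis
  define F where "F = (\<lambda>y. k (fst y, p (snd y)))"
  have "continuous_map (top_of_set unit_square) X F"
  proof -
    have "continuous_map (top_of_set unit_square) X (\<lambda>y. p (snd y))"
      by (rule continuous_map_compose_euclidean[OF pc(1)]) (auto intro!: continuous_intros)
    then have "continuous_map (top_of_set unit_square) (subtopology X (f ` W)) (\<lambda>y. p (snd y))"
      using p(2) by (auto simp: continuous_map_in_subtopology)
    moreover have "continuous_map (top_of_set unit_square) (top_of_set {0..1}) fst"
      by (auto intro!: continuous_intros)
    ultimately have "continuous_map (top_of_set unit_square)
        (prod_topology (top_of_set {0..1}) (subtopology X (f ` W))) (\<lambda>y. (fst y, p (snd y)))"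
      by (simp add: continuous_map_pairwise comp_def)
    from continuous_map_compose[OF this k(1)] show ?thesis by (simp add: F_def[abs_def] comp_def)
  qed
  note Fc = this
  let ?S = "top_of_set unit_square"
  let ?\<psi> = "loop_join (loop_join (\<lambda>t. (t, 0)) (\<lambda>t. (1, t))) (\<lambda>t. (1 - t, 1 :: real))"
  have "path_between ?S (0, 0) (1, 0) (\<lambda>t. (t, 0))" "path_between ?S (1, 0) (1, 1) (\<lambda>t. (1, t))"
    "path_between ?S (1, 1) (0, 1) (\<lambda>t. (1 - t, 1))" "path_between ?S (0, 0) (0, 1) (\<lambda>t. (0, t))"
    by (auto simp: path_between_def intro!: continuous_intros)
  note sides = this
  have "path_between ?S (0, 0) (0, 1) ?\<psi>"
    by (rule path_between_join[OF path_between_join[OF sides(1,2)] sides(3)])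
  then have \<psi>: "continuous_on {0..1} ?\<psi>" "?\<psi> ` {0..1} \<subseteq> unit_square" "?\<psi> 0 = (0, 0)" "?\<psi> 1 = (0, 1)"
    by (simp_all only: path_between_def continuous_map_subtopology_eu image_subset_iff_funcset)
  have edge: "continuous_on {0..1} (\<lambda>t :: real. (0 :: real, t))" "(\<lambda>t :: real. (0 :: real, t)) ` {0..1} \<subseteq> unit_square"
    using sides(4) by (simp_all only: path_between_def continuous_map_subtopology_eu image_subset_iff_funcset)
  have cv: "convex unit_square" by (intro convex_Times convex_closed_interval convex_real_interval)
  have "path_homotopic X (F (0, 0)) (F (0, 1)) (\<lambda>t. F (0, t)) (\<lambda>t. F (?\<psi> t))"
    by (rule path_homotopic_convex[OF Fc cv edge \<psi>(1,2)]) (simp_all only: \<psi>(3,4))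
  define l c r where "l = (\<lambda>t. F (t, 0))" and "c = (\<lambda>t. F (1, t))" and "r = (\<lambda>t. F (1 - t, 1))"
  have F0: "F (0, t) = p t" if "t \<in> {0..1}" for t
  proof -
    have "p t \<in> f ` W" using p(2) that by auto
    then obtain w where w: "w \<in> W" "p t = f w" by auto
    then show ?thesis using k(2)[of 0 w] H(5) by (simp add: F_def)
  qed
  have Fl: "l t = f (h (t, z))" "r t = f (h (1 - t, z'))" if "t \<in> {0..1}" for t
    using that k(2)[of t z] k(2)[of "1 - t" z'] z pc by (simp_all add: l_def r_def F_def)
  have Fc1: "c t = f (h (1, z))" if "t \<in> {0..1}" for t
  proof -
    have "p t \<in> f ` W" using p(2) that by auto
    then obtain w where w: "w \<in> W" "f w = p t" by auto
    have "f (h (1, z)) = f (h (1, w))"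
      using chart_core_constant[OF h pc(1) p(2) z(1) _ _ w that, of 0] pc by simp
    then show ?thesis using k(2)[of 1 w] w by (simp add: c_def F_def)
  qed
  have hom: "path_homotopic X (f z) (f z') p (loop_join (loop_join l c) r)"
  proof -
    have "F (0, 0) = f z" "F (0, 1) = f z'" using F0 pc by simp_all
    with \<open>path_homotopic X (F (0, 0)) (F (0, 1)) (\<lambda>t. F (0, t)) (\<lambda>t. F (?\<psi> t))\<close>
    have "path_homotopic X (f z) (f z') (\<lambda>t. F (0, t)) (\<lambda>t. F (?\<psi> t))" by simp
    then show ?thesis
      by (rule path_homotopic_eq_on) (simp_all add: F0 loop_join_def l_def c_def r_def)
  qed
  have hz: "(\<lambda>t. h (t, z)) ` {0..1} \<subseteq> D" "(\<lambda>t. h (1 - t, z')) ` {0..1} \<subseteq> D"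
    using H(4) z by (auto simp: image_subset_iff)
  have hc: "continuous_on {0..1} (\<lambda>t. h (t, z))" "continuous_on {0..1} (\<lambda>t. h (1 - t, z'))"
    by (rule continuous_on_compose2[OF H(3)]; use z in \<open>auto intro!: continuous_intros\<close>)+
  have D: "z \<in> D" "z' \<in> D" "h (1, z) \<in> D" "h (1, z') \<in> D" using H(2,4) z by auto
  have l: "path_between X (f z) (f (h (1, z))) l"
    using path_between_compose[OF Fc, of "\<lambda>t. (t, 0)"] sides(1) Fl(1)[of 0] Fl(1)[of 1] H(5)[OF z(1)]
    by (simp add: path_between_def l_def image_subset_iff_funcset)
  have c: "path_between X (f (h (1, z))) (f (h (1, z'))) c"
    using path_between_compose[OF Fc, of "\<lambda>t. (1, t)"] sides(2) Fc1[of 0] Fc1[of 1] core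
    by (simp add: path_between_def c_def image_subset_iff_funcset)
  have r: "path_between X (f (h (1, z'))) (f z') r"
    using path_between_compose[OF Fc, of "\<lambda>t. (1 - t, 1)"] sides(3) Fl(2)[of 0] Fl(2)[of 1] H(5)[OF z(2)]
    by (simp add: path_between_def r_def image_subset_iff_funcset)
  have lc: "path_between X (f z) (f (h (1, z'))) (loop_join l c)" by (rule path_between_join[OF l c])
  have 1: "based z l (h (1, z)) = \<one>\<^bsub>\<pi>\<^esub>" "based (h (1, z')) r z' = \<one>\<^bsub>\<pi>\<^esub>"
    using based_lift[OF hc(1) hz(1), of l] based_lift[OF hc(2) hz(2), of r] Fl H(5) z by simp_all
  have j: "based (h (1, z)) c (h (1, z')) = jump (h (1, z)) (h (1, z'))"
  proof -
    have "path_homotopic X (f (h (1, z))) (f (h (1, z'))) c c" using c by simp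
    then have "path_homotopic X (f (h (1, z))) (f (h (1, z'))) c (\<lambda>t. f (h (1, z)))"
      by (rule path_homotopic_eq_on) (simp_all add: Fc1)
    then show ?thesis unfolding jump_def by (rule based_homotopic[OF D(3,4)])
  qed
  have "based z p z' = based z (loop_join (loop_join l c) r) z'"
    by (rule based_homotopic[OF D(1,2) hom])
  also have "\<dots> = based z l (h (1, z)) \<otimes>\<^bsub>\<pi>\<^esub> based (h (1, z)) c (h (1, z')) \<otimes>\<^bsub>\<pi>\<^esub> based (h (1, z')) r z'"
    by (simp only: based_mult[OF D(1,3,4) l c] based_mult[OF D(1,4,2) lc r])
  also have "\<dots> = jump (h (1, z)) (h (1, z'))"
    unfolding 1 j using jump_closed[OF D(3,4) core] by simp
  finally show "based z p z' = jump (h (1, z)) (h (1, z'))" .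
qed

section \<open>Subdivision of paths\<close>

definition subpath :: "(real \<Rightarrow> 'a) \<Rightarrow> real \<Rightarrow> real \<Rightarrow> real \<Rightarrow> 'a" where
  "subpath p a b t = p (a + t * (b - a))"

lemma subpath_range:
  fixes a b t :: real
  assumes "0 \<le> a" "a \<le> b" "b \<le> 1" "t \<in> {0..1}"
  shows "a + t * (b - a) \<in> {a..b}"
proof -
  have "t * (b - a) \<le> 1 * (b - a)" by (rule mult_right_mono) (use assms in auto)
  then show ?thesis using assms by simp
qed

lemma path_subpath:
  assumes "continuous_map (top_of_set {0..1 :: real}) X p" "0 \<le> a" "a \<le> b" "b \<le> 1"
  shows "path_between X (p a) (p b) (subpath p a b)"
proof -
  have "(\<lambda>t. a + t * (b - a)) ` {0..1} \<subseteq> {0..1}"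
    using subpath_range[OF assms(2-4)] assms(2-4) by (fastforce simp: image_subset_iff)
  then have "path_between X (p (a + 0 * (b - a))) (p (a + 1 * (b - a))) (\<lambda>t. p (a + t * (b - a)))"
    by (intro path_between_compose[OF assms(1)] continuous_intros)
  then show ?thesis by (simp add: subpath_def[abs_def])
qed

lemma subpath_join:
  assumes p: "continuous_map (top_of_set {0..1 :: real}) X p" and ab: "0 \<le> a" "a \<le> b" "b \<le> c" "c \<le> 1"
  shows "path_homotopic X (p a) (p c) (loop_join (subpath p a b) (subpath p b c)) (subpath p a c)"
proof -
  let ?T = "top_of_set {0..1 :: real}"
  let ?l = "\<lambda>a b t. a + t * (b - a) :: real"
  have l: "path_between ?T a b (?l a b)" if "0 \<le> a" "a \<le> b" "b \<le> 1" for a b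
  proof -
    have "?l a b t \<in> {0..1}" if "t \<in> {0..1}" for t
      using subpath_range[OF \<open>0 \<le> a\<close> \<open>a \<le> b\<close> \<open>b \<le> 1\<close> that] \<open>0 \<le> a\<close> \<open>b \<le> 1\<close> by simp
    then show ?thesis
      unfolding path_between_def continuous_map_subtopology_eu
      by (intro conjI continuous_intros) auto
  qed
  have j: "path_between ?T a c (loop_join (?l a b) (?l b c))"
    by (rule path_between_join[OF l l]) (use ab in auto)
  have ac: "path_between ?T a c (?l a c)" by (rule l) (use ab in auto)
  let ?\<phi> = "loop_join (?l a b) (?l b c)"
  have \<phi>: "continuous_on {0..1} ?\<phi>" "?\<phi> ` {0..1} \<subseteq> {0..1}" "?\<phi> 0 = a" "?\<phi> 1 = c"
    using j by (simp_all only: path_between_def continuous_map_subtopology_eu image_subset_iff_funcset)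
  have \<psi>: "continuous_on {0..1} (?l a c)" "?l a c ` {0..1} \<subseteq> {0..1}" "?l a c 0 = a" "?l a c 1 = c"
    using ac by (simp_all only: path_between_def continuous_map_subtopology_eu image_subset_iff_funcset)
  have "path_homotopic X (p (?\<phi> 0)) (p (?\<phi> 1)) (\<lambda>t. p (?\<phi> t)) (\<lambda>t. p (?l a c t))"
    by (rule path_homotopic_convex[OF p _ \<phi>(1,2) \<psi>(1,2)]) (simp_all only: \<phi> \<psi> convex_closed_interval convex_real_interval)
  then have "path_homotopic X (p a) (p c) (\<lambda>t. p (?\<phi> t)) (\<lambda>t. p (?l a c t))" unfolding \<phi>(3,4) .
  then show ?thesis
    by (rule path_homotopic_eq_on) (simp_all add: loop_join_def subpath_def)
qed

text \<open>Short pieces of the path lie in one chart and give jumps by \<open>chart_path\<close>;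
  \<open>Bolzano\<close> supplies the subdivision. The property \<open>P\<close> ranges over all
  preimages of both ends, so pieces can be joined at any preimage of their common point.\<close>

lemma based_in_subgroup:
  assumes M: "subgroup M \<pi>" and jump: "\<And>z z'. z \<in> D \<Longrightarrow> z' \<in> D \<Longrightarrow> f z = f z' \<Longrightarrow> jump z z' \<in> M"
    and cover: "\<And>z. z \<in> D \<Longrightarrow> \<exists>W h. contraction_chart W h \<and> z \<in> W"
    and p: "continuous_map (top_of_set {0..1 :: real}) X p" and z: "z \<in> D" "z' \<in> D" "f z = p 0" "f z' = p 1"
  shows "based z p z' \<in> M"
proof -
  define P where "P = (\<lambda>a b. 0 \<le> a \<longrightarrow> a \<le> b \<longrightarrow> b \<le> 1 \<longrightarrow> (\<forall>z\<in>D. \<forall>z'\<in>D. f z = p a \<longrightarrow> f z' = p b \<longrightarrow>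
      based z (subpath p a b) z' \<in> M))"
  have top: "p t \<in> topspace X" if "t \<in> {0..1}" for t
    using continuous_map_image_subset_topspace[OF p] that by auto
  have "(0 :: real) \<le> 1" by simp
  then have "P 0 1"
  proof (induction rule: Bolzano)
    case (trans a b c)
    show ?case
      unfolding P_def
    proof (intro impI ballI)
      fix z z' assume a: "0 \<le> a" "a \<le> c" "c \<le> 1" and z: "z \<in> D" "z' \<in> D" "f z = p a" "f z' = p c"
      obtain w where w: "w \<in> D" "f w = p b" using f_onto[OF top[of b]] a trans by auto
      have 1: "path_between X (f z) (f w) (subpath p a b)" "path_between X (f w) (f z') (subpath p b c)"
        using path_subpath[OF p, of a b] path_subpath[OF p, of b c] a trans z w by simp_all
      have "based z (subpath p a c) z' = based z (loop_join (subpath p a b) (subpath p b c)) z'"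
        using subpath_join[OF p a(1) trans(3,4) a(3)] z by (intro based_homotopic[symmetric]) simp_all
      also have "\<dots> = based z (subpath p a b) w \<otimes>\<^bsub>\<pi>\<^esub> based w (subpath p b c) z'"
        by (rule based_mult[symmetric, OF z(1) w(1) z(2) 1])
      also have "\<dots> \<in> M"
        using trans a z w unfolding P_def by (intro subgroup.m_closed[OF M]) auto
      finally show "based z (subpath p a c) z' \<in> M" .
    qed
  next
    case (local x)
    then have x: "x \<in> {0..1}" by simp
    then obtain w where w: "w \<in> D" "f w = p x" using f_onto[OF top] by blast
    obtain W h where h: "contraction_chart W h" "w \<in> W" using cover[OF w(1)] by blast
    note H = contraction_chartD[OF h(1)]
    obtain N where N: "open N" "x \<in> N" 
      "\<And>r z. r \<in> N \<Longrightarrow> r \<in> {0..1} \<Longrightarrow> z \<in> D \<Longrightarrow> f z = p r \<Longrightarrow> z \<in> W"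
      "\<And>r. r \<in> N \<Longrightarrow> r \<in> {0..1} \<Longrightarrow> p r \<in> f ` W"
      using local_saturated[OF p H(1) x] h(2) w by (metis imageI)
    then obtain d where d: "d > 0" "\<And>y. \<bar>y - x\<bar> < d \<Longrightarrow> y \<in> N"
      unfolding open_dist by (metis dist_real_def)
    show ?case
    proof (intro exI[of _ d] conjI d(1) allI impI)
      fix a b assume ab: "a \<le> x \<and> x \<le> b \<and> b - a < d"
      have N': "y \<in> N" if "y \<in> {a..b}" for y using d(2)[of y] ab that by auto
      show "P a b"
        unfolding P_def
      proof (intro impI ballI)
        fix z z' assume a: "0 \<le> a" "a \<le> b" "b \<le> 1" and z: "z \<in> D" "z' \<in> D" "f z = p a" "f z' = p b"
        have zW: "z \<in> W" "z' \<in> W" using N(3)[of a z] N(3)[of b z'] N' a z by auto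
        have "path_between X (f z) (f z') (subpath p a b)"
          using path_subpath[OF p a] z by simp
        moreover have "subpath p a b ` {0..1} \<subseteq> f ` W"
        proof
          fix y assume "y \<in> subpath p a b ` {0..1}"
          then obtain t where t: "t \<in> {0..1}" "y = p (a + t * (b - a))" by (auto simp: subpath_def)
          have "a + t * (b - a) \<in> {a..b}" by (rule subpath_range[OF a t(1)])
          then show "y \<in> f ` W" using N(4)[OF N', of "a + t * (b - a)"] a t(2) by simp
        qed
        ultimately show "based z (subpath p a b) z' \<in> M"
          using chart_path[OF h(1) _ _ zW] jump H(4)[of 1] zW by simp
      qed
    qed
  qed
  then have "based z (subpath p 0 1) z' \<in> M" unfolding P_def using z by simp
  then show ?thesis by (simp add: subpath_def[abs_def])
qed

theorem generated_by_jumps: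
  assumes "subgroup M \<pi>" "\<And>z z'. z \<in> D \<Longrightarrow> z' \<in> D \<Longrightarrow> f z = f z' \<Longrightarrow> jump z z' \<in> M"
    and "\<And>z. z \<in> D \<Longrightarrow> \<exists>W h. contraction_chart W h \<and> z \<in> W"
  shows "M = carrier \<pi>"
proof
  show "M \<subseteq> carrier \<pi>" by (rule subgroup.subset[OF assms(1)])
  show "carrier \<pi> \<subseteq> M"
    unfolding fundamental_group_simps
  proof clarify
    fix p assume p: "path_between X (f z0) (f z0) p"
    then show "loop_class X (f z0) p \<in> M"
      unfolding loop_class_eq_based[OF p]
      by (intro based_in_subgroup[OF assms] z0) (simp_all add: path_between_def)
  qed
qed

end

subsection \<open>Holonomy\<close>

text \<open>The functions \<open>\<phi> j\<close> are local trivializations of a covering of \<open>X\<close> with fibre \<open>K\<close> that is glued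
  from \<open>K \<times> D\<close>.\<close>

locale holonomy = convex_quotient D X f z0 + K: group K
  for D :: "'v :: real_normed_vector set" and X :: "'a topology" and f :: "'v \<Rightarrow> 'a" and z0 :: 'v
    and K :: "('k, 'm) monoid_scheme" +
  fixes J :: "'j set" and W :: "'j \<Rightarrow> 'v set" and \<phi> :: "'j \<Rightarrow> 'v \<Rightarrow> 'k"
  assumes saturated: "j \<in> J \<Longrightarrow> saturated_open (W j)"
    and cover: "z \<in> D \<Longrightarrow> \<exists>j\<in>J. z \<in> W j"
    and \<phi>_closed: "j \<in> J \<Longrightarrow> z \<in> W j \<Longrightarrow> \<phi> j z \<in> carrier K"
    and \<phi>_locally_constant: "j \<in> J \<Longrightarrow> z \<in> W j \<Longrightarrow> \<exists>U. open U \<and> z \<in> U \<and> (\<forall>w\<in>U \<inter> W j. \<phi> j w = \<phi> j z)"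
    and \<phi>_compatible: "j \<in> J \<Longrightarrow> j' \<in> J \<Longrightarrow> z \<in> W j \<Longrightarrow> z \<in> W j' \<Longrightarrow> w \<in> D \<Longrightarrow> f z = f w \<Longrightarrow>
      \<phi> j z \<otimes>\<^bsub>K\<^esub> inv\<^bsub>K\<^esub> \<phi> j' z = \<phi> j w \<otimes>\<^bsub>K\<^esub> inv\<^bsub>K\<^esub> \<phi> j' w"
begin

text \<open>The quotient of two trivializations is constant on fibres and locally constant on
  \<open>D\<close>, hence locally constant on \<open>X\<close>.\<close>

lemma change_of_chart:
  assumes h: "continuous_map (top_of_set Q) X h" and q: "q \<in> Q" and j: "j \<in> J" "j' \<in> J"
    and z: "z \<in> W j" "z \<in> W j'" "f z = h q"
  obtains N d where "open N" "q \<in> N" "d \<in> carrier K"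
    "\<And>r w. r \<in> N \<Longrightarrow> r \<in> Q \<Longrightarrow> w \<in> D \<Longrightarrow> f w = h r \<Longrightarrow> w \<in> W j \<and> w \<in> W j' \<and> \<phi> j w = d \<otimes>\<^bsub>K\<^esub> \<phi> j' w"
proof -
  define d where "d = \<phi> j z \<otimes>\<^bsub>K\<^esub> inv\<^bsub>K\<^esub> \<phi> j' z"
  define V where "V = {w \<in> W j \<inter> W j'. \<phi> j w \<otimes>\<^bsub>K\<^esub> inv\<^bsub>K\<^esub> \<phi> j' w = d}"
  have d: "d \<in> carrier K" using \<phi>_closed j z by (simp add: d_def)
  have "saturated_open V"
    unfolding saturated_open_def
  proof
    show "openin (top_of_set D) V"
    proof (subst openin_subopen, intro ballI)
      fix w assume w: "w \<in> V"
      then have wj: "w \<in> W j" "w \<in> W j'" by (simp_all add: V_def)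
      obtain U where U: "open U" "w \<in> U" "\<And>v. v \<in> U \<inter> W j \<Longrightarrow> \<phi> j v = \<phi> j w"
        using \<phi>_locally_constant[OF j(1) wj(1)] by blast
      obtain U' where U': "open U'" "w \<in> U'" "\<And>v. v \<in> U' \<inter> W j' \<Longrightarrow> \<phi> j' v = \<phi> j' w"
        using \<phi>_locally_constant[OF j(2) wj(2)] by blast
      have o: "openin (top_of_set D) (W j)" "openin (top_of_set D) (W j')"
        using saturated j by (simp_all add: saturated_open_def)
      have "openin (top_of_set D) ((W j \<inter> W j') \<inter> (U \<inter> U'))"
        by (intro openin_Int_open openin_Int o open_Int U(1) U'(1))
      moreover have "w \<in> (W j \<inter> W j') \<inter> (U \<inter> U')" using wj U(2) U'(2) by simp
      moreover have "v \<in> V" if "v \<in> (W j \<inter> W j') \<inter> (U \<inter> U')" for v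
        using that w U(3)[of v] U'(3)[of v] by (simp add: V_def)
      ultimately show "\<exists>T. openin (top_of_set D) T \<and> w \<in> T \<and> T \<subseteq> V" by blast
    qed
    show "\<forall>z\<in>V. \<forall>w\<in>D. f z = f w \<longrightarrow> w \<in> V"
    proof (intro ballI impI)
      fix v w assume v: "v \<in> V" and w: "w \<in> D" "f v = f w"
      then have "w \<in> W j" "w \<in> W j'"
        using saturatedD[OF saturated[OF j(1)], of v w] saturatedD[OF saturated[OF j(2)], of v w]
        by (simp_all add: V_def)
      then show "w \<in> V" using v w \<phi>_compatible[OF j, of v w] by (simp add: V_def)
    qed
  qed
  moreover have "h q \<in> f ` V"
    using z by (intro image_eqI[of _ _ z]) (simp_all add: V_def d_def)
  ultimately obtain N where N: "open N" "q \<in> N"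
    "\<And>r w. r \<in> N \<Longrightarrow> r \<in> Q \<Longrightarrow> w \<in> D \<Longrightarrow> f w = h r \<Longrightarrow> w \<in> V"
    using local_saturated[OF h, of V q] q by metis
  have "w \<in> W j \<and> w \<in> W j' \<and> \<phi> j w = d \<otimes>\<^bsub>K\<^esub> \<phi> j' w" if "r \<in> N" "r \<in> Q" "w \<in> D" "f w = h r" for r w
  proof -
    have w: "w \<in> W j" "w \<in> W j'" "\<phi> j w \<otimes>\<^bsub>K\<^esub> inv\<^bsub>K\<^esub> \<phi> j' w = d"
      using N(3)[OF that] by (simp_all add: V_def)
    then show ?thesis
      using \<phi>_closed[OF j(1) w(1)] \<phi>_closed[OF j(2) w(2)] d by (metis K.inv_solve_right K.inv_closed K.inv_solve_right')
  qed
  then show ?thesis using that[OF N(1,2) d] by blast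
qed

text \<open>A lift of \<open>h\<close> to the covering: \<open>\<kappa> q z\<close> is its
  coordinate in \<open>K\<close> over the preimage \<open>z\<close> of \<open>h q\<close>. Each
  preimage has its own value because the coordinate changes across the gluing. Left multiplication
  by elements of \<open>K\<close> permutes the lifts.\<close>

definition flat_section ::
    "'q :: topological_space set \<Rightarrow> ('q \<Rightarrow> 'a) \<Rightarrow> ('q \<Rightarrow> 'v \<Rightarrow> 'k) \<Rightarrow> bool" where
  "flat_section Q h \<kappa> \<longleftrightarrow> (\<forall>q\<in>Q. \<exists>j\<in>J. \<exists>c\<in>carrier K. \<exists>N. open N \<and> q \<in> N \<and>
     (\<forall>r\<in>N \<inter> Q. \<forall>z\<in>D. f z = h r \<longrightarrow> z \<in> W j \<and> \<kappa> r z = c \<otimes>\<^bsub>K\<^esub> \<phi> j z))"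

section \<open>Lifts to the covering: restriction, uniqueness and gluing\<close>

lemma flat_sectionE:
  assumes "flat_section Q h \<kappa>" "q \<in> Q"
  obtains j c N where "j \<in> J" "c \<in> carrier K" "open N" "q \<in> N"
    "\<And>r z. r \<in> N \<Longrightarrow> r \<in> Q \<Longrightarrow> z \<in> D \<Longrightarrow> f z = h r \<Longrightarrow> z \<in> W j \<and> \<kappa> r z = c \<otimes>\<^bsub>K\<^esub> \<phi> j z"
  using assms unfolding flat_section_def by (metis IntI)

lemma flat_sectionI:
  assumes "\<And>q. q \<in> Q \<Longrightarrow> \<exists>j c N. j \<in> J \<and> c \<in> carrier K \<and> open N \<and> q \<in> N \<and>
    (\<forall>r z. r \<in> N \<longrightarrow> r \<in> Q \<longrightarrow> z \<in> D \<longrightarrow> f z = h r \<longrightarrow> z \<in> W j \<and> \<kappa> r z = c \<otimes>\<^bsub>K\<^esub> \<phi> j z)"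
  shows "flat_section Q h \<kappa>"
  unfolding flat_section_def
proof
  fix q assume "q \<in> Q"
  from assms[OF this] obtain j c N where *: "j \<in> J" "c \<in> carrier K" "open N" "q \<in> N"
    "\<forall>r z. r \<in> N \<longrightarrow> r \<in> Q \<longrightarrow> z \<in> D \<longrightarrow> f z = h r \<longrightarrow> z \<in> W j \<and> \<kappa> r z = c \<otimes>\<^bsub>K\<^esub> \<phi> j z" by blast
  show "\<exists>j\<in>J. \<exists>c\<in>carrier K. \<exists>N. open N \<and> q \<in> N \<and>
     (\<forall>r\<in>N \<inter> Q. \<forall>z\<in>D. f z = h r \<longrightarrow> z \<in> W j \<and> \<kappa> r z = c \<otimes>\<^bsub>K\<^esub> \<phi> j z)"
    by (rule bexI[OF _ *(1)], rule bexI[OF _ *(2)], rule exI[of _ N]) (use *(3-5) in blast)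
qed

lemma flat_section_closed:
  assumes "flat_section Q h \<kappa>" "q \<in> Q" "z \<in> D" "f z = h q"
  shows "\<kappa> q z \<in> carrier K"
proof -
  obtain j c N where "j \<in> J" "c \<in> carrier K" "q \<in> N"
    "\<And>r z. r \<in> N \<Longrightarrow> r \<in> Q \<Longrightarrow> z \<in> D \<Longrightarrow> f z = h r \<Longrightarrow> z \<in> W j \<and> \<kappa> r z = c \<otimes>\<^bsub>K\<^esub> \<phi> j z"
    using flat_sectionE[OF assms(1,2)] by metis
  then show ?thesis using assms \<phi>_closed by simp
qed

lemma flat_section_mult:
  assumes "flat_section Q h \<kappa>" "a \<in> carrier K"
  shows "flat_section Q h (\<lambda>q z. a \<otimes>\<^bsub>K\<^esub> \<kappa> q z)"
proof (rule flat_sectionI)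
  fix q assume q: "q \<in> Q"
  obtain j c N where *: "j \<in> J" "c \<in> carrier K" "open N" "q \<in> N"
    "\<And>r z. r \<in> N \<Longrightarrow> r \<in> Q \<Longrightarrow> z \<in> D \<Longrightarrow> f z = h r \<Longrightarrow> z \<in> W j \<and> \<kappa> r z = c \<otimes>\<^bsub>K\<^esub> \<phi> j z"
    using flat_sectionE[OF assms(1) q] by metis
  show "\<exists>j c N. j \<in> J \<and> c \<in> carrier K \<and> open N \<and> q \<in> N \<and>
    (\<forall>r z. r \<in> N \<longrightarrow> r \<in> Q \<longrightarrow> z \<in> D \<longrightarrow> f z = h r \<longrightarrow> z \<in> W j \<and> a \<otimes>\<^bsub>K\<^esub> \<kappa> r z = c \<otimes>\<^bsub>K\<^esub> \<phi> j z)"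
    using * assms(2) \<phi>_closed[OF *(1)]
    by (intro exI[of _ j] exI[of _ "a \<otimes>\<^bsub>K\<^esub> c"] exI[of _ N]) (simp add: K.m_assoc)
qed

lemma flat_section_pullback:
  assumes "flat_section Q h \<kappa>" "continuous_on Q' \<theta>" "\<theta> ` Q' \<subseteq> Q" "\<And>r. r \<in> Q' \<Longrightarrow> h' r = h (\<theta> r)"
  shows "flat_section Q' h' (\<lambda>r. \<kappa> (\<theta> r))"
proof (rule flat_sectionI)
  fix q assume q: "q \<in> Q'"
  then have "\<theta> q \<in> Q" using assms(3) by auto
  then obtain j c N where *: "j \<in> J" "c \<in> carrier K" "open N" "\<theta> q \<in> N"
    "\<And>r z. r \<in> N \<Longrightarrow> r \<in> Q \<Longrightarrow> z \<in> D \<Longrightarrow> f z = h r \<Longrightarrow> z \<in> W j \<and> \<kappa> r z = c \<otimes>\<^bsub>K\<^esub> \<phi> j z"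
    using flat_sectionE[OF assms(1)] by metis
  obtain M where M: "open M" "M \<inter> Q' = \<theta> -` N \<inter> Q'"
    using assms(2) *(3) unfolding continuous_on_open_invariant by metis
  have "z \<in> W j \<and> \<kappa> (\<theta> r) z = c \<otimes>\<^bsub>K\<^esub> \<phi> j z" if "r \<in> M" "r \<in> Q'" "z \<in> D" "f z = h' r" for r z
  proof (rule *(5))
    show "\<theta> r \<in> N" using M(2) that by blast
    show "\<theta> r \<in> Q" using assms(3) that by auto
  qed (use that assms(4) in auto)
  moreover have "q \<in> M" using M(2) q *(4) by blast
  ultimately show "\<exists>j c N. j \<in> J \<and> c \<in> carrier K \<and> open N \<and> q \<in> N \<and>
    (\<forall>r z. r \<in> N \<longrightarrow> r \<in> Q' \<longrightarrow> z \<in> D \<longrightarrow> f z = h' r \<longrightarrow> z \<in> W j \<and> \<kappa> (\<theta> r) z = c \<otimes>\<^bsub>K\<^esub> \<phi> j z)"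
    using *(1,2) M(1) by (intro exI[of _ j] exI[of _ c] exI[of _ M]) simp
qed

lemma flat_section_subset: "flat_section Q h \<kappa> \<Longrightarrow> Q' \<subseteq> Q \<Longrightarrow> flat_section Q' h \<kappa>"
  using flat_section_pullback[of Q h \<kappa> Q' "\<lambda>x. x" h] by (simp add: continuous_on_id)

lemma flat_section_ratio:
  assumes h: "continuous_map (top_of_set Q) X h" and s: "flat_section Q h \<kappa>" "flat_section Q h \<kappa>'" and q: "q \<in> Q"
  obtains N e where "open N" "q \<in> N" "e \<in> carrier K"
    "\<And>r w. r \<in> N \<Longrightarrow> r \<in> Q \<Longrightarrow> w \<in> D \<Longrightarrow> f w = h r \<Longrightarrow> \<kappa>' r w = e \<otimes>\<^bsub>K\<^esub> \<kappa> r w"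
proof -
  obtain j c N where 1: "j \<in> J" "c \<in> carrier K" "open N" "q \<in> N"
    "\<And>r z. r \<in> N \<Longrightarrow> r \<in> Q \<Longrightarrow> z \<in> D \<Longrightarrow> f z = h r \<Longrightarrow> z \<in> W j \<and> \<kappa> r z = c \<otimes>\<^bsub>K\<^esub> \<phi> j z"
    using flat_sectionE[OF s(1) q] by metis
  obtain j' c' N' where 2: "j' \<in> J" "c' \<in> carrier K" "open N'" "q \<in> N'"
    "\<And>r z. r \<in> N' \<Longrightarrow> r \<in> Q \<Longrightarrow> z \<in> D \<Longrightarrow> f z = h r \<Longrightarrow> z \<in> W j' \<and> \<kappa>' r z = c' \<otimes>\<^bsub>K\<^esub> \<phi> j' z"
    using flat_sectionE[OF s(2) q] by metis
  have "h q \<in> topspace X" using continuous_map_image_subset_topspace[OF h] q by auto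
  then obtain z where z: "z \<in> D" "f z = h q" using f_onto by blast
  have zj: "z \<in> W j'" "z \<in> W j" using 1(5)[OF 1(4) q z] 2(5)[OF 2(4) q z] by auto
  obtain M d where M: "open M" "q \<in> M" "d \<in> carrier K"
    "\<And>r w. r \<in> M \<Longrightarrow> r \<in> Q \<Longrightarrow> w \<in> D \<Longrightarrow> f w = h r \<Longrightarrow> w \<in> W j' \<and> w \<in> W j \<and> \<phi> j' w = d \<otimes>\<^bsub>K\<^esub> \<phi> j w"
    using change_of_chart[OF h q 2(1) 1(1) zj z(2)] by metis
  show ?thesis
  proof (rule that[of "M \<inter> (N \<inter> N')" "c' \<otimes>\<^bsub>K\<^esub> d \<otimes>\<^bsub>K\<^esub> inv\<^bsub>K\<^esub> c"])
    fix r w assume r: "r \<in> M \<inter> (N \<inter> N')" "r \<in> Q" and w: "w \<in> D" "f w = h r"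
    have 3: "w \<in> W j" "\<kappa> r w = c \<otimes>\<^bsub>K\<^esub> \<phi> j w" "\<kappa>' r w = c' \<otimes>\<^bsub>K\<^esub> \<phi> j' w" "\<phi> j' w = d \<otimes>\<^bsub>K\<^esub> \<phi> j w"
      using 1(5)[OF _ r(2) w] 2(5)[OF _ r(2) w] M(4)[OF _ r(2) w] r(1) by auto
    have p: "\<phi> j w \<in> carrier K" by (rule \<phi>_closed[OF 1(1) 3(1)])
    have "inv\<^bsub>K\<^esub> c \<otimes>\<^bsub>K\<^esub> (c \<otimes>\<^bsub>K\<^esub> \<phi> j w) = \<phi> j w" using p 1(2) by (simp flip: K.m_assoc)
    then show "\<kappa>' r w = c' \<otimes>\<^bsub>K\<^esub> d \<otimes>\<^bsub>K\<^esub> inv\<^bsub>K\<^esub> c \<otimes>\<^bsub>K\<^esub> \<kappa> r w"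
      unfolding 3 using p 1(2) 2(2) M(3) by (simp add: K.m_assoc)
  qed (use 1 2 M in auto)
qed

text \<open>The ratio of two lifts is locally constant and does not depend on the preimage, so on a
  connected set one of its values determines all.\<close>

lemma flat_section_unique:
  assumes h: "continuous_map (top_of_set Q) X h" and s: "flat_section Q h \<kappa>" "flat_section Q h \<kappa>'" and Q: "connected Q"
    and q0: "q0 \<in> Q" "z \<in> D" "f z = h q0" "\<kappa> q0 z = \<kappa>' q0 z"
    and q: "q \<in> Q" "w \<in> D" "f w = h q"
  shows "\<kappa> q w = \<kappa>' q w"
proof -
  define \<rho> where "\<rho> = (\<lambda>r. SOME w. w \<in> D \<and> f w = h r)"
  have \<rho>: "\<rho> r \<in> D \<and> f (\<rho> r) = h r" if "r \<in> Q" for r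
  proof -
    have "h r \<in> topspace X" using continuous_map_image_subset_topspace[OF h] that by auto
    then have "\<exists>w. w \<in> D \<and> f w = h r" using f_onto by blast
    from someI_ex[OF this] show ?thesis by (simp only: \<rho>_def)
  qed
  define e where "e = (\<lambda>r. \<kappa>' r (\<rho> r) \<otimes>\<^bsub>K\<^esub> inv\<^bsub>K\<^esub> \<kappa> r (\<rho> r))"
  have loc: "\<exists>N. open N \<and> r \<in> N \<and> (\<forall>t\<in>N \<inter> Q. e t = e r) \<and> e r \<in> carrier K \<and>
      (\<forall>w. w \<in> D \<longrightarrow> f w = h r \<longrightarrow> \<kappa>' r w = e r \<otimes>\<^bsub>K\<^esub> \<kappa> r w)" if r: "r \<in> Q" for r
  proof -
    obtain N d where N: "open N" "r \<in> N" "d \<in> carrier K"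
      "\<And>t w. t \<in> N \<Longrightarrow> t \<in> Q \<Longrightarrow> w \<in> D \<Longrightarrow> f w = h t \<Longrightarrow> \<kappa>' t w = d \<otimes>\<^bsub>K\<^esub> \<kappa> t w"
      using flat_section_ratio[OF h s r] by metis
    have "e t = d" if "t \<in> N" "t \<in> Q" for t
    proof -
      have "\<kappa> t (\<rho> t) \<in> carrier K" using flat_section_closed[OF s(1) that(2)] \<rho>[OF that(2)] by simp
      then show ?thesis using N(4)[OF that, of "\<rho> t"] \<rho>[OF that(2)] N(3) by (simp add: e_def K.m_assoc)
    qed
    then show ?thesis using N r by (intro exI[of _ N]) auto
  qed
  have "e q = e q0"
  proof (rule connected_local_const[OF Q q(1) q0(1)], rule ballI)
    fix r assume "r \<in> Q"
    then obtain N where "open N" "r \<in> N" "\<forall>t\<in>N \<inter> Q. e t = e r" using loc by blast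
    then show "\<forall>\<^sub>F t in at r within Q. e r = e t"
      unfolding eventually_at_topological by (metis IntI)
  qed
  moreover have "e q0 = \<one>\<^bsub>K\<^esub>"
  proof -
    have "e q0 \<in> carrier K" "\<kappa>' q0 z = e q0 \<otimes>\<^bsub>K\<^esub> \<kappa> q0 z" using loc[OF q0(1)] q0 by blast+
    then show ?thesis using flat_section_closed[OF s(1) q0(1-3)] q0(4) by (metis K.r_cancel_one')
  qed
  moreover have "\<kappa>' q w = e q \<otimes>\<^bsub>K\<^esub> \<kappa> q w" using loc[OF q(1)] q by blast
  ultimately show ?thesis using flat_section_closed[OF s(1) q] by simp
qed

text \<open>If \<open>h\<close> itself comes from a map to \<open>D\<close>, its lift stays on one
  sheet, a copy of \<open>D\<close>, since trivializations are locally constant.\<close>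

lemma flat_section_along_lift:
  assumes s: "flat_section Q h \<kappa>" and Q: "connected Q"
    and \<zeta>: "continuous_on Q \<zeta>" "\<zeta> ` Q \<subseteq> D" "\<And>q. q \<in> Q \<Longrightarrow> f (\<zeta> q) = h q" and q: "q \<in> Q" "r \<in> Q"
  shows "\<kappa> q (\<zeta> q) = \<kappa> r (\<zeta> r)"
proof (rule connected_local_const[OF Q q], rule ballI)
  fix t assume t: "t \<in> Q"
  obtain j c N where *: "j \<in> J" "c \<in> carrier K" "open N" "t \<in> N"
    "\<And>r z. r \<in> N \<Longrightarrow> r \<in> Q \<Longrightarrow> z \<in> D \<Longrightarrow> f z = h r \<Longrightarrow> z \<in> W j \<and> \<kappa> r z = c \<otimes>\<^bsub>K\<^esub> \<phi> j z"
    using flat_sectionE[OF s t] by metis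
  have \<zeta>D: "\<zeta> r \<in> D" if "r \<in> Q" for r using \<zeta>(2) that by auto
  have tW: "\<zeta> t \<in> W j" using *(5)[OF *(4) t \<zeta>D[OF t]] \<zeta>(3)[OF t] by simp
  obtain U where U: "open U" "\<zeta> t \<in> U" "\<And>w. w \<in> U \<inter> W j \<Longrightarrow> \<phi> j w = \<phi> j (\<zeta> t)"
    using \<phi>_locally_constant[OF *(1) tW] by blast
  obtain M where M: "open M" "M \<inter> Q = \<zeta> -` U \<inter> Q"
    using \<zeta>(1) U(1) unfolding continuous_on_open_invariant by metis
  have "\<kappa> t (\<zeta> t) = \<kappa> r (\<zeta> r)" if r: "r \<in> N \<inter> M" "r \<in> Q" for r
  proof -
    have "\<zeta> r \<in> U" using M(2) r by blast
    moreover have "\<zeta> r \<in> W j" "\<kappa> r (\<zeta> r) = c \<otimes>\<^bsub>K\<^esub> \<phi> j (\<zeta> r)"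
      using *(5)[of r "\<zeta> r"] \<zeta>D[OF r(2)] \<zeta>(3)[OF r(2)] r by auto
    moreover have "\<kappa> t (\<zeta> t) = c \<otimes>\<^bsub>K\<^esub> \<phi> j (\<zeta> t)" using *(5)[OF *(4) t \<zeta>D[OF t]] \<zeta>(3)[OF t] by simp
    ultimately show ?thesis using U(3)[of "\<zeta> r"] by simp
  qed
  moreover have "open (N \<inter> M)" "t \<in> N \<inter> M" using *(3,4) M t U(2) by auto
  ultimately show "\<forall>\<^sub>F r in at t within Q. \<kappa> t (\<zeta> t) = \<kappa> r (\<zeta> r)"
    unfolding eventually_at_topological by (intro exI[of _ "N \<inter> M"]) simp
qed

text \<open>After left multiplication of \<open>\<kappa>\<close> by a constant the two lifts agree
  at one point of the intersection, hence on all of it. Near such a point they may be given in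
  different charts; their equality yields \<open>c = c' \<otimes> d\<close> with the factor
  \<open>d\<close> of the change of charts.\<close>

lemma flat_section_glue:
  assumes h: "continuous_map (top_of_set (A \<union> B)) X h" and s: "flat_section A h \<kappa>" "flat_section B h \<mu>"
    and cl: "closed A" "closed B" and AB: "connected (A \<inter> B)" "A \<inter> B \<noteq> {}"
  shows "\<exists>\<nu>. flat_section (A \<union> B) h \<nu>"
proof -
  have hAB: "continuous_map (top_of_set (A \<inter> B)) X h"
    using continuous_map_compose_euclidean[OF h continuous_on_id, of "A \<inter> B"] by auto
  obtain q0 where q0: "q0 \<in> A" "q0 \<in> B" using AB(2) by blast
  have "h q0 \<in> topspace X" using continuous_map_image_subset_topspace[OF h] q0 by auto
  then obtain z where z: "z \<in> D" "f z = h q0" using f_onto by blast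
  define e where "e = \<mu> q0 z \<otimes>\<^bsub>K\<^esub> inv\<^bsub>K\<^esub> \<kappa> q0 z"
  have kz: "\<kappa> q0 z \<in> carrier K" "\<mu> q0 z \<in> carrier K"
    using flat_section_closed[OF s(1) q0(1) z] flat_section_closed[OF s(2) q0(2) z] by auto
  then have e: "e \<in> carrier K" by (simp add: e_def)
  define \<kappa>' where "\<kappa>' = (\<lambda>q z. e \<otimes>\<^bsub>K\<^esub> \<kappa> q z)"
  have s': "flat_section A h \<kappa>'" unfolding \<kappa>'_def by (rule flat_section_mult[OF s(1) e])
  have "\<kappa>' q0 z = \<mu> q0 z" using kz by (simp add: \<kappa>'_def e_def K.m_assoc)
  then have agree: "\<kappa>' q w = \<mu> q w" if "q \<in> A" "q \<in> B" "w \<in> D" "f w = h q" for q w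
    using flat_section_unique[OF hAB flat_section_subset[OF s'] flat_section_subset[OF s(2)] AB(1) _ z] that q0
    by simp
  define \<nu> where "\<nu> = (\<lambda>q z. if q \<in> A then \<kappa>' q z else \<mu> q z)"
  have \<nu>: "\<nu> q w = \<kappa>' q w" if "q \<in> A" for q w using that by (simp add: \<nu>_def)
  have \<nu>': "\<nu> q w = \<mu> q w" if "q \<in> B" "w \<in> D" "f w = h q" for q w using agree that by (simp add: \<nu>_def)
  have "flat_section (A \<union> B) h \<nu>"
  proof (rule flat_sectionI)
    fix q assume q: "q \<in> A \<union> B"
    consider "q \<in> A" "q \<notin> B" | "q \<notin> A" "q \<in> B" | "q \<in> A" "q \<in> B" using q by blast
    then show "\<exists>j c N. j \<in> J \<and> c \<in> carrier K \<and> open N \<and> q \<in> N \<and>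
      (\<forall>r z. r \<in> N \<longrightarrow> r \<in> A \<union> B \<longrightarrow> z \<in> D \<longrightarrow> f z = h r \<longrightarrow> z \<in> W j \<and> \<nu> r z = c \<otimes>\<^bsub>K\<^esub> \<phi> j z)"
    proof cases
      case 1
      obtain j c N where *: "j \<in> J" "c \<in> carrier K" "open N" "q \<in> N"
        "\<And>r z. r \<in> N \<Longrightarrow> r \<in> A \<Longrightarrow> z \<in> D \<Longrightarrow> f z = h r \<Longrightarrow> z \<in> W j \<and> \<kappa>' r z = c \<otimes>\<^bsub>K\<^esub> \<phi> j z"
        using flat_sectionE[OF s' 1(1)] by metis
      have "open (N \<inter> - B)" using *(3) cl by (intro open_Int open_Compl)
      then show ?thesis using * 1 \<nu> by (intro exI[of _ j] exI[of _ c] exI[of _ "N \<inter> - B"]) auto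
    next
      case 2
      obtain j c N where *: "j \<in> J" "c \<in> carrier K" "open N" "q \<in> N"
        "\<And>r z. r \<in> N \<Longrightarrow> r \<in> B \<Longrightarrow> z \<in> D \<Longrightarrow> f z = h r \<Longrightarrow> z \<in> W j \<and> \<mu> r z = c \<otimes>\<^bsub>K\<^esub> \<phi> j z"
        using flat_sectionE[OF s(2) 2(2)] by metis
      have "open (N \<inter> - A)" using *(3) cl by (intro open_Int open_Compl)
      then show ?thesis using * 2 \<nu>' by (intro exI[of _ j] exI[of _ c] exI[of _ "N \<inter> - A"]) auto
    next
      case 3
      obtain j c N where 1: "j \<in> J" "c \<in> carrier K" "open N" "q \<in> N"
        "\<And>r z. r \<in> N \<Longrightarrow> r \<in> A \<Longrightarrow> z \<in> D \<Longrightarrow> f z = h r \<Longrightarrow> z \<in> W j \<and> \<kappa>' r z = c \<otimes>\<^bsub>K\<^esub> \<phi> j z"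
        using flat_sectionE[OF s' 3(1)] by metis
      obtain j' c' N' where 2: "j' \<in> J" "c' \<in> carrier K" "open N'" "q \<in> N'"
        "\<And>r z. r \<in> N' \<Longrightarrow> r \<in> B \<Longrightarrow> z \<in> D \<Longrightarrow> f z = h r \<Longrightarrow> z \<in> W j' \<and> \<mu> r z = c' \<otimes>\<^bsub>K\<^esub> \<phi> j' z"
        using flat_sectionE[OF s(2) 3(2)] by metis
      have "h q \<in> topspace X" using continuous_map_image_subset_topspace[OF h] q by auto
      then obtain w where w: "w \<in> D" "f w = h q" using f_onto by blast
      have wj: "w \<in> W j" "\<kappa>' q w = c \<otimes>\<^bsub>K\<^esub> \<phi> j w" "w \<in> W j'" "\<mu> q w = c' \<otimes>\<^bsub>K\<^esub> \<phi> j' w"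
        using 1(5)[OF 1(4) 3(1) w] 2(5)[OF 2(4) 3(2) w] by auto
      obtain M d where M: "open M" "q \<in> M" "d \<in> carrier K"
        "\<And>r w. r \<in> M \<Longrightarrow> r \<in> A \<union> B \<Longrightarrow> w \<in> D \<Longrightarrow> f w = h r \<Longrightarrow> w \<in> W j' \<and> w \<in> W j \<and> \<phi> j' w = d \<otimes>\<^bsub>K\<^esub> \<phi> j w"
        using change_of_chart[OF h q 2(1) 1(1) wj(3,1) w(2)] by metis
      have p: "\<phi> j w \<in> carrier K" by (rule \<phi>_closed[OF 1(1) wj(1)])
      have "c \<otimes>\<^bsub>K\<^esub> \<phi> j w = (c' \<otimes>\<^bsub>K\<^esub> d) \<otimes>\<^bsub>K\<^esub> \<phi> j w"
        using agree[OF 3 w] wj M(4)[OF M(2) q w] p M(3) 2(2) by (simp add: K.m_assoc)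
      then have cd: "c = c' \<otimes>\<^bsub>K\<^esub> d" using p M(3) 2(2) 1(2) K.right_cancel by simp
      have "r \<in> N \<inter> N' \<inter> M \<Longrightarrow> r \<in> A \<union> B \<Longrightarrow> v \<in> D \<Longrightarrow> f v = h r \<Longrightarrow> v \<in> W j \<and> \<nu> r v = c \<otimes>\<^bsub>K\<^esub> \<phi> j v" for r v
      proof -
        assume r: "r \<in> N \<inter> N' \<inter> M" "r \<in> A \<union> B" and v: "v \<in> D" "f v = h r"
        have m: "v \<in> W j" "\<phi> j' v = d \<otimes>\<^bsub>K\<^esub> \<phi> j v" using M(4)[OF _ r(2) v] r(1) by auto
        show ?thesis
        proof (cases "r \<in> A")
          case True
          then show ?thesis using 1(5)[OF _ True v] r(1) \<nu> by simp
        next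
          case False
          then have "r \<in> B" using r by blast
          then show ?thesis using 2(5)[OF _ _ v] r(1) \<nu>'[OF _ v] m \<phi>_closed[OF 1(1) m(1)] M(3) 2(2)
            by (simp add: cd K.m_assoc)
        qed
      qed
      moreover have "open (N \<inter> N' \<inter> M)" "q \<in> N \<inter> N' \<inter> M" using 1 2 M by auto
      ultimately show ?thesis
        using 1(1,2) by (intro exI[of _ j] exI[of _ c] exI[of _ "N \<inter> N' \<inter> M"]) simp
    qed
  qed
  then show ?thesis by blast
qed


section \<open>Existence of lifts on squares and paths\<close>

lemma flat_section_local:
  assumes h: "continuous_map (top_of_set Q) X h" and q: "q \<in> Q"
  obtains N where "open N" "q \<in> N" "\<And>Q'. Q' \<subseteq> N \<inter> Q \<Longrightarrow> \<exists>\<kappa>. flat_section Q' h \<kappa>"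
proof -
  have "h q \<in> topspace X" using continuous_map_image_subset_topspace[OF h] q by auto
  then obtain z where z: "z \<in> D" "f z = h q" using f_onto by blast
  obtain j where j: "j \<in> J" "z \<in> W j" using cover[OF z(1)] by blast
  have "h q \<in> f ` W j" using z(2) j(2) by (intro image_eqI[of _ _ z]) simp_all
  then obtain N where N: "open N" "q \<in> N"
    "\<And>r w. r \<in> N \<Longrightarrow> r \<in> Q \<Longrightarrow> w \<in> D \<Longrightarrow> f w = h r \<Longrightarrow> w \<in> W j"
    using local_saturated[OF h saturated[OF j(1)] q] by metis
  have "flat_section Q' h (\<lambda>r z. \<phi> j z)" if Q': "Q' \<subseteq> N \<inter> Q" for Q'
  proof (rule flat_sectionI)
    fix r assume "r \<in> Q'"
    then have "r \<in> N" using Q' by blast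
    moreover have "z \<in> W j \<and> \<phi> j z = \<one>\<^bsub>K\<^esub> \<otimes>\<^bsub>K\<^esub> \<phi> j z" if "t \<in> Q'" "z \<in> D" "f z = h t" for t z
    proof -
      have "t \<in> N" "t \<in> Q" using Q' that(1) by auto
      then show ?thesis using N(3)[OF _ _ that(2,3)] \<phi>_closed[OF j(1)] by simp
    qed
    ultimately show "\<exists>k c N. k \<in> J \<and> c \<in> carrier K \<and> open N \<and> r \<in> N \<and>
      (\<forall>r z. r \<in> N \<longrightarrow> r \<in> Q' \<longrightarrow> z \<in> D \<longrightarrow> f z = h r \<longrightarrow> z \<in> W k \<and> \<phi> j z = c \<otimes>\<^bsub>K\<^esub> \<phi> k z)"
      using j(1) N(1) by (intro exI[of _ j] exI[of _ "\<one>\<^bsub>K\<^esub>"] exI[of _ N]) simp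
  qed
  then show ?thesis using that[OF N(1,2)] by blast
qed

lemma continuous_map_subset:
  "continuous_map (top_of_set Q) X h \<Longrightarrow> Q' \<subseteq> Q \<Longrightarrow> continuous_map (top_of_set Q') X h"
  using continuous_map_compose_euclidean[of Q X h Q' "\<lambda>x. x"] by (auto simp: continuous_on_id)

text \<open>Subdivision in two stages: thin strips are assembled from small rectangles, the square
  from strips. Adjacent pieces meet in a connected set, as \<open>flat_section_glue\<close>
  requires.\<close>

lemma flat_section_square:
  assumes h: "continuous_map (top_of_set unit_square) X h"
  shows "\<exists>\<kappa>. flat_section unit_square h \<kappa>"
proof -
  \<comment> \<open>Clipping at \<open>0\<close> and \<open>1\<close> allows the width of a piece to
    be chosen regardless of the edges of the square.\<close>
  define R where "R = (\<lambda>a b c d. {max 0 a..min 1 b} \<times> {max 0 c..min 1 (d :: real)} :: (real \<times> real) set)"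
  have hR: "continuous_map (top_of_set (R a b c d)) X h" for a b c d
    by (rule continuous_map_subset[OF h]) (auto simp: R_def)
  have clR: "closed (R a b c d)" for a b c d unfolding R_def by (intro closed_Times closed_real_atLeastAtMost)
  have cnR: "connected (R a b c d)" for a b c d
    unfolding R_def by (intro connected_Times) simp_all
  have strip: "\<exists>e>0. \<exists>\<kappa>. flat_section (R (x - e) (x + e) 0 1) h \<kappa>" if x: "0 \<le> x" "x \<le> 1" for x
  proof -
    have "(0 :: real) \<le> 1" by simp
    then have "0 \<le> (0 :: real) \<longrightarrow> (1 :: real) \<le> 1 \<longrightarrow> (0 :: real) \<le> 1 \<longrightarrow> (\<exists>e>0. \<exists>\<kappa>. flat_section (R (x - e) (x + e) 0 1) h \<kappa>)"
    proof (induction rule: Bolzano[where P = "\<lambda>c d. 0 \<le> c \<longrightarrow> d \<le> 1 \<longrightarrow> c \<le> d \<longrightarrow> (\<exists>e>0. \<exists>\<kappa>. flat_section (R (x - e) (x + e) c d) h \<kappa>)"])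
      case (trans a b c)
      show ?case
      proof (intro impI)
        assume a: "0 \<le> a" "c \<le> 1" "a \<le> c"
        obtain e \<kappa> where e: "e > 0" "flat_section (R (x - e) (x + e) a b) h \<kappa>" using trans a by auto
        obtain e' \<mu> where e': "e' > 0" "flat_section (R (x - e') (x + e') b c) h \<mu>" using trans a by auto
        define d where "d = min e e'"
        have d: "d > 0" "d \<le> e" "d \<le> e'" using e(1) e'(1) by (simp_all add: d_def)
        let ?A = "R (x - d) (x + d) a b" and ?B = "R (x - d) (x + d) b c"
        have un: "?A \<union> ?B = R (x - d) (x + d) a c" using trans a by (auto simp: R_def)
        have int: "?A \<inter> ?B = R (x - d) (x + d) b b" using trans a by (auto simp: R_def)
        have s: "flat_section ?A h \<kappa>" "flat_section ?B h \<mu>"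
          by (rule flat_section_subset[OF e(2)] flat_section_subset[OF e'(2)], use d in \<open>auto simp: R_def\<close>)+
        have "(x, b) \<in> ?A \<inter> ?B" unfolding int using x d(1) a trans by (simp add: R_def)
        then have "?A \<inter> ?B \<noteq> {}" by blast
        moreover have "connected (?A \<inter> ?B)" unfolding int by (rule cnR)
        moreover have "continuous_map (top_of_set (?A \<union> ?B)) X h" unfolding un by (rule hR)
        ultimately have "\<exists>\<nu>. flat_section (?A \<union> ?B) h \<nu>"
          using flat_section_glue[OF _ s clR clR] by blast
        then show "\<exists>e>0. \<exists>\<kappa>. flat_section (R (x - e) (x + e) a c) h \<kappa>" unfolding un using d(1) by blast
      qed
    next
      case (local y)
      have xy: "(x, y) \<in> unit_square" using x local by simp
      obtain N where N: "open N" "(x, y) \<in> N" "\<And>Q'. Q' \<subseteq> N \<inter> unit_square \<Longrightarrow> \<exists>\<kappa>. flat_section Q' h \<kappa>"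
        using flat_section_local[OF h xy] by metis
      obtain A B where AB: "open A" "open B" "x \<in> A" "y \<in> B" "A \<times> B \<subseteq> N"
        using open_prod_elim[OF N(1,2)] by (metis mem_Sigma_iff)
      obtain e where e: "e > 0" "\<And>t. \<bar>t - x\<bar> < e \<Longrightarrow> t \<in> A"
        using AB(1,3) unfolding open_dist by (metis dist_real_def)
      obtain d where d: "d > 0" "\<And>t. \<bar>t - y\<bar> < d \<Longrightarrow> t \<in> B"
        using AB(2,4) unfolding open_dist by (metis dist_real_def)
      show ?case
      proof (rule exI[of _ d], intro conjI d(1) allI impI)
        fix a b assume ab: "a \<le> y \<and> y \<le> b \<and> b - a < d" "0 \<le> a" "b \<le> 1" "a \<le> b"
        have "R (x - e / 2) (x + e / 2) a b \<subseteq> A \<times> B"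
        proof
          fix q assume "q \<in> R (x - e / 2) (x + e / 2) a b"
          then have q: "x - e / 2 \<le> fst q" "fst q \<le> x + e / 2" "a \<le> snd q" "snd q \<le> b"
            by (auto simp: R_def)
          then have "\<bar>fst q - x\<bar> < e" "\<bar>snd q - y\<bar> < d" using e(1) ab unfolding abs_less_iff by linarith+
          then have "fst q \<in> A" "snd q \<in> B" by (auto intro: e(2) d(2))
          then show "q \<in> A \<times> B" by (simp add: mem_Times_iff)
        qed
        then have "R (x - e / 2) (x + e / 2) a b \<subseteq> N \<inter> unit_square" using AB(5) by (auto simp: R_def)
        then have "\<exists>\<kappa>. flat_section (R (x - e / 2) (x + e / 2) a b) h \<kappa>" by (rule N(3))
        then show "\<exists>e>0. \<exists>\<kappa>. flat_section (R (x - e) (x + e) a b) h \<kappa>" using e(1) half_gt_zero by blast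
      qed
    qed
    then show ?thesis by simp
  qed
  have "(0 :: real) \<le> 1" by simp
  then have "0 \<le> (0 :: real) \<longrightarrow> (1 :: real) \<le> 1 \<longrightarrow> (0 :: real) \<le> 1 \<longrightarrow> (\<exists>\<kappa>. flat_section (R 0 1 0 1) h \<kappa>)"
  proof (induction rule: Bolzano[where P = "\<lambda>c d. 0 \<le> c \<longrightarrow> d \<le> 1 \<longrightarrow> c \<le> d \<longrightarrow> (\<exists>\<kappa>. flat_section (R c d 0 1) h \<kappa>)"])
    case (trans a b c)
    show ?case
    proof (intro impI)
      assume a: "0 \<le> a" "c \<le> 1" "a \<le> c"
      obtain \<kappa> where e: "flat_section (R a b 0 1) h \<kappa>" using trans a by auto
      obtain \<mu> where e': "flat_section (R b c 0 1) h \<mu>" using trans a by auto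
      let ?A = "R a b 0 1" and ?B = "R b c 0 1"
      have un: "?A \<union> ?B = R a c 0 1" using trans a by (auto simp: R_def)
      have int: "?A \<inter> ?B = R b b 0 1" using trans a by (auto simp: R_def)
      have "(b, 0) \<in> ?A \<inter> ?B" unfolding int using a trans by (simp add: R_def)
      then have "?A \<inter> ?B \<noteq> {}" by blast
      moreover have "connected (?A \<inter> ?B)" unfolding int by (rule cnR)
      moreover have "continuous_map (top_of_set (?A \<union> ?B)) X h" unfolding un by (rule hR)
      ultimately have "\<exists>\<nu>. flat_section (?A \<union> ?B) h \<nu>"
        using flat_section_glue[OF _ e e' clR clR] by blast
      then show "\<exists>\<kappa>. flat_section (R a c 0 1) h \<kappa>" unfolding un .
    qed
  next
    case (local x)
    then obtain e \<kappa> where e: "e > 0" "flat_section (R (x - e) (x + e) 0 1) h \<kappa>" using strip[of x] by auto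
    show ?case
    proof (rule exI[of _ e], intro conjI e(1) allI impI)
      fix a b assume ab: "a \<le> x \<and> x \<le> b \<and> b - a < e" "0 \<le> a" "b \<le> 1" "a \<le> b"
      then have "R a b 0 1 \<subseteq> R (x - e) (x + e) 0 1" by (auto simp: R_def)
      then show "\<exists>\<kappa>. flat_section (R a b 0 1) h \<kappa>" using flat_section_subset[OF e(2)] by blast
    qed
  qed
  moreover have "R 0 1 0 1 = unit_square" by (simp add: R_def)
  ultimately show ?thesis by simp
qed

text \<open>The path is lifted as a homotopy that is constant in the first coordinate; a left factor
  then normalizes the initial value.\<close>

lemma flat_section_path:
  assumes p: "continuous_map (top_of_set {0..1 :: real}) X p" and z: "z \<in> D" "f z = p 0"
  obtains \<kappa> where "flat_section {0..1} p \<kappa>" "\<kappa> 0 z = \<one>\<^bsub>K\<^esub>"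
proof -
  have "continuous_map (top_of_set unit_square) X (\<lambda>y. p (snd y))"
    by (rule continuous_map_compose_euclidean[OF p]) (auto intro!: continuous_intros)
  then obtain \<mu> where "flat_section unit_square (\<lambda>y. p (snd y)) \<mu>" using flat_section_square by blast
  then have s: "flat_section {0..1} p (\<lambda>t. \<mu> (0, t))"
    by (rule flat_section_pullback) (auto intro!: continuous_intros)
  have c: "\<mu> (0, 0) z \<in> carrier K" using flat_section_closed[OF s _ z] by simp
  show ?thesis
    by (rule that[OF flat_section_mult[OF s K.inv_closed[OF c]]]) (simp add: c)
qed

section \<open>The holonomy homomorphism\<close>

definition hol :: "(real \<Rightarrow> 'a) \<Rightarrow> 'k" where
  "hol p = (SOME k. \<exists>\<kappa>. flat_section {0..1} p \<kappa> \<and> \<kappa> 0 z0 = \<one>\<^bsub>K\<^esub> \<and> k = \<kappa> 1 z0)"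

lemma hol_eq:
  assumes p: "path_between X (f z0) (f z0) p" and s: "flat_section {0..1} p \<kappa>"
  shows "\<kappa> 1 z0 = \<kappa> 0 z0 \<otimes>\<^bsub>K\<^esub> hol p" "hol p \<in> carrier K"
proof -
  have pc: "continuous_map (top_of_set {0..1}) X p" "f z0 = p 0" "f z0 = p 1" using p by (simp_all add: path_between_def)
  obtain \<mu> where "flat_section {0..1} p \<mu>" "\<mu> 0 z0 = \<one>\<^bsub>K\<^esub>" using flat_section_path[OF pc(1) z0 pc(2)] by metis
  then have "\<exists>k \<kappa>. flat_section {0..1} p \<kappa> \<and> \<kappa> 0 z0 = \<one>\<^bsub>K\<^esub> \<and> k = \<kappa> 1 z0" by blast
  from someI_ex[OF this] obtain \<nu> where \<nu>: "flat_section {0..1} p \<nu>" "\<nu> 0 z0 = \<one>\<^bsub>K\<^esub>" "hol p = \<nu> 1 z0"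
    unfolding hol_def by blast
  show "hol p \<in> carrier K" using flat_section_closed[OF \<nu>(1) _ z0 pc(3)] \<nu>(3) by simp
  have k: "\<kappa> 0 z0 \<in> carrier K" using flat_section_closed[OF s _ z0 pc(2)] by simp
  have c01: "connected {0..1 :: real}" by simp
  show "\<kappa> 1 z0 = \<kappa> 0 z0 \<otimes>\<^bsub>K\<^esub> hol p"
    unfolding \<nu>(3)
    by (rule flat_section_unique[OF pc(1) s flat_section_mult[OF \<nu>(1) k] c01 _ z0 pc(2) _ _ z0 pc(3)])
      (simp_all add: \<nu>(2) k)
qed

lemma flat_section_const:
  assumes s: "flat_section Q h \<kappa>" and Q: "connected Q" and h: "\<And>q. q \<in> Q \<Longrightarrow> h q = f z" and z: "z \<in> D"
    and q: "q \<in> Q" "r \<in> Q"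
  shows "\<kappa> q z = \<kappa> r z"
  using flat_section_along_lift[OF s Q, of "\<lambda>q. z", OF _ _ _ q] h z by auto

text \<open>On the two edges of the square on which the homotopy rests at the base point, the
  coordinate over \<open>z0\<close> is constant, so both paths have the same initial and final
  values.\<close>

lemma hol_homotopic:
  assumes "path_homotopic X (f z0) (f z0) p q"
  shows "hol p = hol q"
proof -
  obtain h where h: "continuous_map (top_of_set unit_square) X h" "\<forall>t\<in>{0..1}. h (0, t) = p t"
    "\<forall>t\<in>{0..1}. h (1, t) = q t" "\<forall>s\<in>{0..1}. h (s, 0) = f z0 \<and> h (s, 1) = f z0"
    using assms unfolding path_homotopic_iff by blast
  obtain \<kappa> where \<kappa>: "flat_section unit_square h \<kappa>" using flat_section_square[OF h(1)] by blast
  have s: "flat_section {0..1} p (\<lambda>t. \<kappa> (0, t))" "flat_section {0..1} q (\<lambda>t. \<kappa> (1, t))"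
    by (rule flat_section_pullback[OF \<kappa>]; use h in \<open>auto intro!: continuous_intros\<close>)+
  have e: "flat_section {0..1} (\<lambda>t. f z0) (\<lambda>t. \<kappa> (t, 0))" "flat_section {0..1} (\<lambda>t. f z0) (\<lambda>t. \<kappa> (t, 1))"
    by (rule flat_section_pullback[OF \<kappa>]; use h in \<open>auto intro!: continuous_intros\<close>)+
  have c01: "connected {0..1 :: real}" by simp
  have e': "\<kappa> (0, 0) z0 = \<kappa> (1, 0) z0" "\<kappa> (0, 1) z0 = \<kappa> (1, 1) z0"
    using flat_section_const[OF e(1) c01 _ z0, of 0 1] flat_section_const[OF e(2) c01 _ z0, of 0 1] by auto
  note P = path_homotopic_imp_path[OF assms]
  have "\<kappa> (0, 0) z0 \<in> carrier K"
    using flat_section_closed[OF \<kappa>, of "(0, 0)" z0] h(4) z0 by simp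
  then show ?thesis
    using hol_eq[OF P(1) s(1)] hol_eq[OF P(2) s(2)] e' by simp
qed

lemma hol_join:
  assumes p: "path_between X (f z0) (f z0) p" and q: "path_between X (f z0) (f z0) q"
  shows "hol (loop_join p q) = hol p \<otimes>\<^bsub>K\<^esub> hol q"
proof -
  have j: "path_between X (f z0) (f z0) (loop_join p q)" by (rule path_between_join[OF p q])
  then have jc: "continuous_map (top_of_set {0..1}) X (loop_join p q)" "f z0 = loop_join p q 0"
    by (simp_all add: path_between_def)
  obtain \<kappa> where \<kappa>: "flat_section {0..1} (loop_join p q) \<kappa>" "\<kappa> 0 z0 = \<one>\<^bsub>K\<^esub>"
    using flat_section_path[OF jc(1) z0 jc(2)] by metis
  have pq: "p 1 = f z0" "q 0 = f z0" using p q by (simp_all add: path_between_def)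
  have s1: "flat_section {0..1} p (\<lambda>t. \<kappa> (t / 2))"
    by (rule flat_section_pullback[OF \<kappa>(1)]) (auto intro!: continuous_intros simp: loop_join_def)
  have s2: "flat_section {0..1} q (\<lambda>t. \<kappa> ((1 + t) / 2))"
  proof (rule flat_section_pullback[OF \<kappa>(1)])
    show "q r = loop_join p q ((1 + r) / 2)" if "r \<in> {0..1}" for r
    proof (cases "r = 0")
      case True
      then show ?thesis using pq by (simp add: loop_join_def)
    next
      case False
      then have "\<not> (1 + r) / 2 \<le> 1 / 2" "2 * ((1 + r) / 2) - 1 = r"
        using that by (simp_all add: field_simps)
      then show ?thesis unfolding loop_join_def by presburger
    qed
  qed (auto intro!: continuous_intros)
  show ?thesis
    using hol_eq[OF p s1] hol_eq[OF q s2] hol_eq[OF j \<kappa>(1)] \<kappa>(2) by simp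
qed

definition Hol :: "(real \<Rightarrow> 'a) set \<Rightarrow> 'k" where
  "Hol a = hol (SOME p. path_between X (f z0) (f z0) p \<and> a = loop_class X (f z0) p)"

lemma Hol_loop_class:
  assumes p: "path_between X (f z0) (f z0) p"
  shows "Hol (loop_class X (f z0) p) = hol p"
proof -
  have "\<exists>q. path_between X (f z0) (f z0) q \<and> loop_class X (f z0) p = loop_class X (f z0) q" using p by blast
  from someI_ex[OF this] obtain q where q: "path_between X (f z0) (f z0) q"
    "loop_class X (f z0) p = loop_class X (f z0) q" "Hol (loop_class X (f z0) p) = hol q"
    unfolding Hol_def by blast
  then show ?thesis using loop_class_eq_iff[OF p] hol_homotopic by metis
qed

lemma Hol_hom: "Hol \<in> hom \<pi> K"
proof (rule homI; unfold fundamental_group_simps)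
  have closed: "hol p \<in> carrier K" if p: "path_between X (f z0) (f z0) p" for p
  proof -
    have "continuous_map (top_of_set {0..1}) X p" "f z0 = p 0" using p by (simp_all add: path_between_def)
    then obtain \<mu> where "flat_section {0..1} p \<mu>" using flat_section_path[OF _ z0] by metis
    then show ?thesis by (rule hol_eq(2)[OF p])
  qed
  fix a assume "a \<in> loop_class X (f z0) ` {p. path_between X (f z0) (f z0) p}"
  then obtain p where p: "path_between X (f z0) (f z0) p" "a = loop_class X (f z0) p" by blast
  show "Hol a \<in> carrier K" unfolding p(2) Hol_loop_class[OF p(1)] by (rule closed[OF p(1)])
  fix b assume "b \<in> loop_class X (f z0) ` {p. path_between X (f z0) (f z0) p}"
  then obtain q where q: "path_between X (f z0) (f z0) q" "b = loop_class X (f z0) q" by blast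
  show "Hol (a \<otimes>\<^bsub>\<pi>\<^esub> b) = Hol a \<otimes>\<^bsub>K\<^esub> Hol b"
    unfolding p(2) q(2) loop_class_mult[OF p(1) q(1)] Hol_loop_class[OF p(1)] Hol_loop_class[OF q(1)]
      Hol_loop_class[OF path_between_join[OF p(1) q(1)]] by (rule hol_join[OF p(1) q(1)])
qed

text \<open>Along both segments the loop lifts to \<open>D\<close> and the coordinate does not
  change; only the passage from \<open>z\<close> to \<open>z'\<close> at time \<open>1/2\<close>
  contributes. There the section is read in some chart \<open>i\<close>, which compatibility
  exchanges for \<open>j\<close>.\<close>

lemma Hol_jump:
  assumes j: "j \<in> J" and z: "z \<in> W j" "z' \<in> W j" "f z = f z'"
  shows "Hol (jump z z') = inv\<^bsub>K\<^esub> \<phi> j z \<otimes>\<^bsub>K\<^esub> \<phi> j z'"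
proof -
  have D: "z \<in> D" "z' \<in> D" using saturated_open_subset[OF saturated[OF j]] z by auto
  define P where "P = loop_join (loop_join (tail z) (\<lambda>t. f z)) (path_reverse (tail z'))"
  have P: "path_between X (f z0) (f z0) P"
    unfolding P_def by (rule path_based[OF D path_jump[OF D(1) z(3)]])
  then have Pc: "continuous_map (top_of_set {0..1}) X P" "f z0 = P 0" "f z0 = P 1"
    by (simp_all add: path_between_def)
  obtain \<kappa> where \<kappa>: "flat_section {0..1} P \<kappa>" "\<kappa> 0 z0 = \<one>\<^bsub>K\<^esub>" using flat_section_path[OF Pc(1) z0 Pc(2)] by metis
  let ?s = "\<lambda>z t. (1 - t) *\<^sub>R z0 + t *\<^sub>R z"
  have seg: "?s z t \<in> D" if "z \<in> D" "t \<in> {0..1}" for z t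
    using segment_path(2)[OF that(1)] that(2) by (simp add: image_subset_iff)
  have s1: "flat_section {0..1/2} P \<kappa>" "flat_section {1/2..1} P \<kappa>"
    by (rule flat_section_subset[OF \<kappa>(1)], simp)+
  \<comment> \<open>The first half lifts to the segment until time \<open>1/4\<close> and then rests
    in \<open>z\<close>.\<close>
  have "\<kappa> 0 (?s z (min 1 (4 * 0))) = \<kappa> (1/2) (?s z (min 1 (4 * (1/2))))"
  proof (rule flat_section_along_lift[OF s1(1)])
    show "continuous_on {0..1/2} (\<lambda>t. ?s z (min 1 (4 * t)))" by (intro continuous_intros)
    show "(\<lambda>t. ?s z (min 1 (4 * t))) ` {0..1/2} \<subseteq> D"
      by (intro image_subsetI seg D) auto
    show "f (?s z (min 1 (4 * t))) = P t" if "t \<in> {0..1/2}" for t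
    proof (cases "t \<le> 1/4")
      case True
      then have "min 1 (4 * t) = 4 * t" by simp
      then show ?thesis using True that by (simp add: P_def loop_join_def tail_def)
    next
      case False
      then have "min 1 (4 * t) = 1" by simp
      then show ?thesis using False that by (simp add: P_def loop_join_def)
    qed
  qed simp_all
  then have 1: "\<kappa> (1/2) z = \<one>\<^bsub>K\<^esub>" using \<kappa>(2) by simp
  have "\<kappa> (1/2) (?s z' (2 - 2 * (1/2))) = \<kappa> 1 (?s z' (2 - 2 * 1))"
  proof (rule flat_section_along_lift[OF s1(2)])
    show "continuous_on {1/2..1} (\<lambda>t. ?s z' (2 - 2 * t))" by (intro continuous_intros)
    show "(\<lambda>t. ?s z' (2 - 2 * t)) ` {1/2..1} \<subseteq> D"
      by (intro image_subsetI seg D) auto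
    show "f (?s z' (2 - 2 * t)) = P t" if "t \<in> {1/2..1}" for t
    proof (cases "t = 1/2")
      case True
      show ?thesis using z(3) unfolding True by (simp add: P_def loop_join_def)
    next
      case False
      then have "\<not> t \<le> 1/2" "1 - (2 * t - 1) = 2 - 2 * t" using that by auto
      then show ?thesis unfolding P_def loop_join_def tail_def path_reverse_def by presburger
    qed
  qed simp_all
  then have 2: "\<kappa> 1 z0 = \<kappa> (1/2) z'" by simp
  have half: "1/2 \<in> {0..1 :: real}" "P (1/2) = f z" by (simp_all add: P_def loop_join_def)
  obtain i c N where *: "i \<in> J" "c \<in> carrier K" "1/2 \<in> N"
    "\<And>r z. r \<in> N \<Longrightarrow> r \<in> {0..1} \<Longrightarrow> z \<in> D \<Longrightarrow> f z = P r \<Longrightarrow> z \<in> W i \<and> \<kappa> r z = c \<otimes>\<^bsub>K\<^esub> \<phi> i z"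
    using flat_sectionE[OF \<kappa>(1) half(1)] by metis
  have 3: "z \<in> W i" "\<kappa> (1/2) z = c \<otimes>\<^bsub>K\<^esub> \<phi> i z" "z' \<in> W i" "\<kappa> (1/2) z' = c \<otimes>\<^bsub>K\<^esub> \<phi> i z'"
    using *(4)[OF *(3) half(1), of z] *(4)[OF *(3) half(1), of z'] D half(2) z(3) by simp_all
  have cl: "\<phi> i z \<in> carrier K" "\<phi> i z' \<in> carrier K" "\<phi> j z \<in> carrier K" "\<phi> j z' \<in> carrier K"
    using \<phi>_closed *(1) j z 3 by auto
  have "\<phi> i z' = (\<phi> i z' \<otimes>\<^bsub>K\<^esub> inv\<^bsub>K\<^esub> \<phi> j z') \<otimes>\<^bsub>K\<^esub> \<phi> j z'" using cl by (simp add: K.m_assoc)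
  also have "\<phi> i z' \<otimes>\<^bsub>K\<^esub> inv\<^bsub>K\<^esub> \<phi> j z' = \<phi> i z \<otimes>\<^bsub>K\<^esub> inv\<^bsub>K\<^esub> \<phi> j z"
    using \<phi>_compatible[OF *(1) j 3(1) z(1) D(2) z(3)] by simp
  finally have 4: "\<phi> i z' = \<phi> i z \<otimes>\<^bsub>K\<^esub> inv\<^bsub>K\<^esub> \<phi> j z \<otimes>\<^bsub>K\<^esub> \<phi> j z'" .
  have "\<kappa> (1/2) z' = (c \<otimes>\<^bsub>K\<^esub> \<phi> i z) \<otimes>\<^bsub>K\<^esub> (inv\<^bsub>K\<^esub> \<phi> j z \<otimes>\<^bsub>K\<^esub> \<phi> j z')"
    unfolding 3(4) by (subst 4) (use cl *(2) in \<open>simp add: K.m_assoc\<close>)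
  also have "\<dots> = inv\<^bsub>K\<^esub> \<phi> j z \<otimes>\<^bsub>K\<^esub> \<phi> j z'" using 1 3(2) cl by simp
  finally have "\<kappa> 1 z0 = inv\<^bsub>K\<^esub> \<phi> j z \<otimes>\<^bsub>K\<^esub> \<phi> j z'" using 2 by simp
  moreover have "jump z z' = loop_class X (f z0) P" by (simp add: jump_def based_def P_def)
  ultimately show ?thesis
    using hol_eq[OF P \<kappa>(1)] \<kappa>(2) Hol_loop_class[OF P] by simp
qed

end

subsection \<open>The glued polygon\<close>

text \<open>The letters are in the order in which a small loop around the vertex passes the glued sides, which
  is not the order of the sides in the boundary of the polygon.\<close>

primrec surface_relator :: "('k, 'm) monoid_scheme \<Rightarrow> (nat \<Rightarrow> 'k) \<Rightarrow> (nat \<Rightarrow> 'k) \<Rightarrow> nat \<Rightarrow> 'k" where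
  "surface_relator K \<xi> \<eta> 0 = \<one>\<^bsub>K\<^esub>"
| "surface_relator K \<xi> \<eta> (Suc i) = surface_relator K \<xi> \<eta> i \<otimes>\<^bsub>K\<^esub>
     (\<xi> i \<otimes>\<^bsub>K\<^esub> inv\<^bsub>K\<^esub> \<eta> i \<otimes>\<^bsub>K\<^esub> inv\<^bsub>K\<^esub> \<xi> i \<otimes>\<^bsub>K\<^esub> \<eta> i)"

lemma (in group) surface_relator_closed:
  "(\<And>i. i < n \<Longrightarrow> \<xi> i \<in> carrier G \<and> \<eta> i \<in> carrier G) \<Longrightarrow> surface_relator G \<xi> \<eta> n \<in> carrier G"
  by (induction n) simp_all

locale glued_polygon =
  fixes g :: nat and X :: "'a topology" and f :: "complex \<Rightarrow> 'a" and z0 :: complex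
  assumes g: "g \<ge> 1" and quotient: "quotient_map (top_of_set (cball 0 1)) X f"
    and fibres: "z \<in> cball 0 1 \<Longrightarrow> w \<in> cball 0 1 \<Longrightarrow> f z = f w \<longleftrightarrow> equivclp (glued g) z w"
    and base: "z0 \<in> cball 0 1"
begin

sublocale convex_quotient "cball 0 1" X f z0
  using base quotient quotient_imp_continuous_map[OF quotient] by unfold_locales simp_all

section \<open>Parametrization of the boundary of the polygon and the fibres of the gluing\<close>

definition N :: real where "N = real (4 * g)"

lemma N: "N \<ge> 4" using g by (simp add: N_def)

text \<open>The boundary parameter has period \<open>N\<close>: corners are at the integers, and
  side \<open>k\<close> runs from \<open>k\<close> to \<open>k + 1\<close>.\<close>

definition pt :: "real \<Rightarrow> complex" where "pt u = cis (2 * pi * u / N)"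

lemma polygon_side_eq: "polygon_side g k t = pt (real k + t)"
  by (simp add: polygon_side_def pt_def N_def)

lemma norm_pt [simp]: "cmod (pt u) = 1" and pt_nonzero [simp]: "pt u \<noteq> 0"
  by (simp_all add: pt_def)

lemma pt_add: "pt (u + v) = pt u * pt v"
  by (simp add: pt_def cis_mult ring_distribs add_divide_distrib)

lemma pt_minus: "pt (u - v) = pt u / pt v"
  by (simp add: pt_def cis_divide ring_distribs diff_divide_distrib)

lemma pt_in_cball [simp]: "pt u \<in> cball 0 1"
  by simp

lemma continuous_on_pt: "continuous_on S h \<Longrightarrow> continuous_on S (\<lambda>x. pt (h x))"
  unfolding pt_def using N by (intro continuous_intros) auto

lemma pt_eq_iff: "pt u = pt v \<longleftrightarrow> (\<exists>m :: int. u = v + of_int m * N)"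
proof -
  have "pt u = pt v \<longleftrightarrow> exp (\<i> * complex_of_real (2 * pi * u / N)) = exp (\<i> * complex_of_real (2 * pi * v / N))"
    by (simp add: pt_def cis_conv_exp)
  also have "\<dots> \<longleftrightarrow> (\<exists>n :: int. \<i> * complex_of_real (2 * pi * u / N) =
      \<i> * complex_of_real (2 * pi * v / N) + (of_int (2 * n) * pi) * \<i>)"
    by (rule exp_eq)
  also have "\<dots> \<longleftrightarrow> (\<exists>m :: int. u = v + of_int m * N)"
  proof (rule ex_cong1)
    fix n :: int
    have "\<i> * complex_of_real (2 * pi * v / N) + (of_int (2 * n) * pi) * \<i> =
        \<i> * complex_of_real (2 * pi * v / N + 2 * of_int n * pi)"
      by (simp add: algebra_simps)
    then have "\<i> * complex_of_real (2 * pi * u / N) = \<i> * complex_of_real (2 * pi * v / N) + (of_int (2 * n) * pi) * \<i>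
        \<longleftrightarrow> 2 * pi * u / N = 2 * pi * v / N + 2 * of_int n * pi"
      by (simp only: mult_cancel_left of_real_eq_iff) simp
    also have "\<dots> \<longleftrightarrow> 2 * pi * u = 2 * pi * (v + of_int n * N)"
      using N by (simp add: field_simps)
    also have "\<dots> \<longleftrightarrow> u = v + of_int n * N" by simp
    finally show "\<i> * complex_of_real (2 * pi * u / N) =
      \<i> * complex_of_real (2 * pi * v / N) + (of_int (2 * n) * pi) * \<i> \<longleftrightarrow> u = v + of_int n * N" .
  qed
  finally show ?thesis .
qed

lemma pt_period: "pt (u + N) = pt u"
  unfolding pt_eq_iff by (intro exI[of _ 1]) simp

lemma polar: "\<exists>v. z = complex_of_real (cmod z) * pt v"
proof -
  have "z = complex_of_real (cmod z) * pt (N * Arg z / (2 * pi))"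
    using N rcis_cmod_Arg[of z] by (simp add: pt_def rcis_def)
  then show ?thesis by blast
qed

lemma glued_cases:
  assumes "glued g z w"
  obtains k k' t where "t \<in> {0..1}" "z = pt (real k + t)" "w = pt (real k' + 1 - t)" "k < 4 * g" "k' < 4 * g"
    "(\<exists>i<g. k = 4 * i \<and> k' = 4 * i + 2 \<or> k = 4 * i + 1 \<and> k' = 4 * i + 3)"
  using assms
proof cases
  case (a i t)
  then show ?thesis
    by (intro that[of t "4 * i" "4 * i + 2"]) (auto simp: polygon_side_eq algebra_simps)
next
  case (b i t)
  then show ?thesis
    by (intro that[of t "4 * i + 1" "4 * i + 3"]) (auto simp: polygon_side_eq algebra_simps)
qed

lemma glued_pt:
  assumes "i < g" "t \<in> {0..1}"
  shows "glued g (pt (real (4 * i) + t)) (pt (real (4 * i + 2) + 1 - t))"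
    "glued g (pt (real (4 * i + 1) + t)) (pt (real (4 * i + 3) + 1 - t))"
  using glued.a[of i g t] glued.b[of i g t] assms by (simp_all add: polygon_side_eq add_diff_eq)

lemma glued_imp_eq: "glued g z w \<Longrightarrow> f z = f w"
proof -
  assume gl: "glued g z w"
  then have "z \<in> cball 0 1" "w \<in> cball 0 1" by (auto elim!: glued_cases)
  then show ?thesis using fibres r_into_equivclp[of "glued g", OF gl] by blast
qed

lemma fibre_invariant:
  assumes "z \<in> cball 0 1" "w \<in> cball 0 1" "f z = f w" "\<And>a b. glued g a b \<Longrightarrow> F a = F b"
  shows "F z = F w"
proof -
  have "equivclp (glued g) z w" using fibres assms(1-3) by blast
  then show ?thesis
    by (induction rule: equivclp_induct) (use assms(4) in \<open>auto\<close>)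
qed

lemma fibre_interior:
  assumes "z \<in> cball 0 1" "w \<in> cball 0 1" "f z = f w" "cmod z < 1"
  shows "w = z"
proof -
  \<comment> \<open>This function is invariant under gluing, as only boundary points are glued, and
    it determines interior points.\<close>
  have "(if cmod z < 1 then Some z else None) = (if cmod w < 1 then Some w else None)"
    by (rule fibre_invariant[OF assms(1-3)]) (auto elim!: glued_cases)
  then show ?thesis using assms(4) by (auto split: if_splits)
qed

text \<open>For \<open>\<delta> = 0\<close> the sectors around the corners, for \<open>\<delta> = 1/2\<close> those around the midpoints of the
  sides.\<close>

definition in_sector :: "real \<Rightarrow> complex \<Rightarrow> int \<Rightarrow> real \<Rightarrow> bool" where
  "in_sector \<delta> z n v \<longleftrightarrow> z \<noteq> 0 \<and> z = complex_of_real (cmod z) * pt v \<and> \<bar>v - (of_int n + \<delta>)\<bar> < 1/2"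

definition sectors :: "real \<Rightarrow> complex set" where
  "sectors \<delta> = {z \<in> cball 0 1. \<exists>n v. in_sector \<delta> z n v}"

text \<open>The index \<open>n\<close> of a sector is determined only up to multiples of
  \<open>4 * g\<close>; this is its representative below \<open>4 * g\<close>.\<close>

definition idx :: "real \<Rightarrow> complex \<Rightarrow> nat" where
  "idx \<delta> z = (SOME i. \<exists>n v. in_sector \<delta> z n v \<and> i = nat (n mod int (4 * g)))"

lemma in_sector_unique:
  assumes "in_sector \<delta> z n v" "in_sector \<delta> z n' v'"
  obtains m where "n' = n + m * int (4 * g)" "v' = v + of_int m * N"
proof -
  have "complex_of_real (cmod z) * pt v' = complex_of_real (cmod z) * pt v" "z \<noteq> 0"
    using assms by (auto simp: in_sector_def)
  then have "pt v' = pt v" by simp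
  then obtain m where m: "v' = v + of_int m * N" unfolding pt_eq_iff by blast
  have "\<bar>v - (of_int n + \<delta>)\<bar> < 1/2" "\<bar>v + of_int m * N - (of_int n' + \<delta>)\<bar> < 1/2"
    using assms m by (auto simp: in_sector_def)
  then have "\<bar>of_int n' - of_int n - of_int m * N\<bar> < 1" unfolding abs_less_iff by linarith
  then have "\<bar>real_of_int (n' - n - m * int (4 * g))\<bar> < 1" by (simp add: N_def)
  then have "n' - n - m * int (4 * g) = 0" by linarith
  then show ?thesis using that[of m] m by simp
qed

lemma idx_eq:
  assumes "in_sector \<delta> z n v"
  shows "idx \<delta> z = nat (n mod int (4 * g))"
proof -
  have "\<exists>i n v. in_sector \<delta> z n v \<and> i = nat (n mod int (4 * g))" using assms by blast
  from someI_ex[OF this] obtain n' v' where n': "in_sector \<delta> z n' v'" "idx \<delta> z = nat (n' mod int (4 * g))"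
    unfolding idx_def by blast
  obtain m where "n' = n + m * int (4 * g)" using in_sector_unique[OF assms n'(1)] by metis
  then show ?thesis using n'(2) by simp
qed

lemma idx_less: "in_sector \<delta> z n v \<Longrightarrow> idx \<delta> z < 4 * g"
  using idx_eq g by (simp add: nat_less_iff)

definition centre :: "real \<Rightarrow> complex \<Rightarrow> complex" where
  "centre \<delta> z = pt (real (idx \<delta> z) + \<delta>)"

lemma centre_eq:
  assumes "in_sector \<delta> z n v"
  shows "centre \<delta> z = pt (of_int n + \<delta>)"
proof -
  have "real (idx \<delta> z) = of_int (n mod int (4 * g))"
    using g by (simp add: idx_eq[OF assms])
  moreover have "of_int (n mod int (4 * g)) = (of_int n - of_int (n div int (4 * g)) * N :: real)"
    unfolding N_def by (simp flip: minus_div_mult_eq_mod)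
  ultimately have "of_int n + \<delta> = real (idx \<delta> z) + \<delta> + of_int (n div int (4 * g)) * N" by simp
  then show ?thesis unfolding centre_def using pt_eq_iff by metis
qed

lemma sector_locally_constant:
  assumes "in_sector \<delta> z n v"
  obtains U where "open U" "z \<in> U" "\<And>w. w \<in> U \<Longrightarrow> \<exists>v'. in_sector \<delta> w n v'"
proof -
  have z: "z \<noteq> 0" "z = complex_of_real (cmod z) * pt v" "\<bar>v - (of_int n + \<delta>)\<bar> < 1/2"
    using assms by (auto simp: in_sector_def)
  \<comment> \<open>The distance of \<open>v\<close> from the edge of the sector, converted from the
    boundary parameter to an angle.\<close>
  define e where "e = (1/2 - \<bar>v - (of_int n + \<delta>)\<bar>) * 2 * pi / N"
  have e: "e > 0" using z(3) N by (simp add: e_def)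
  have "isCont (\<lambda>w. Im (Ln (w / z))) z"
    using z(1) by (intro continuous_Im isCont_Ln' isCont_divide continuous_ident continuous_const) auto
  then obtain d where d: "d > 0" "\<And>w. dist w z < d \<Longrightarrow> dist (Im (Ln (w / z))) (Im (Ln (z / z))) < e"
    unfolding continuous_at_eps_delta using e by blast
  define d' where "d' = min d (cmod z)"
  have "\<exists>v'. in_sector \<delta> w n v'" if w: "w \<in> ball z d'" for w
  proof -
    have dist: "dist w z < d" "dist w z < cmod z" using w by (auto simp: d'_def dist_commute)
    then have w0: "w \<noteq> 0" by (auto simp: dist_norm)
    define L where "L = Ln (w / z)"
    have L: "\<bar>Im L\<bar> < e" using d(2)[OF dist(1)] z(1) by (simp add: L_def dist_real_def)
    define v' where "v' = v + N * Im L / (2 * pi)"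
    have "w = z * exp L" using w0 z(1) by (simp add: L_def)
    also have "exp L = complex_of_real (exp (Re L)) * cis (Im L)"
      by (simp add: exp_eq_polar)
    also have "cis (Im L) = pt (N * Im L / (2 * pi))" using N by (simp add: pt_def)
    finally have "w = complex_of_real (cmod z) * pt v * (complex_of_real (exp (Re L)) * pt (N * Im L / (2 * pi)))"
      using z(2) by simp
    then have w': "w = complex_of_real (cmod z * exp (Re L)) * pt v'"
      by (simp add: v'_def pt_add)
    then have "cmod w = cmod z * exp (Re L)" by (simp add: norm_mult)
    with w' have "w = complex_of_real (cmod w) * pt v'" by simp
    moreover have "\<bar>v' - (of_int n + \<delta>)\<bar> < 1/2"
    proof -
      have "\<bar>N * Im L / (2 * pi)\<bar> = N * \<bar>Im L\<bar> / (2 * pi)" using N by (simp add: abs_mult)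
      also have "\<dots> < N * e / (2 * pi)" using L N by (intro divide_strict_right_mono mult_strict_left_mono) auto
      also have "\<dots> = 1/2 - \<bar>v - (of_int n + \<delta>)\<bar>" using N by (simp add: e_def)
      finally have "\<bar>v - (of_int n + \<delta>)\<bar> + \<bar>N * Im L / (2 * pi)\<bar> < 1/2" by simp
      moreover have "v' - (of_int n + \<delta>) = (v - (of_int n + \<delta>)) + N * Im L / (2 * pi)" by (simp add: v'_def)
      ultimately show ?thesis by (metis abs_triangle_ineq order_le_less_trans)
    qed
    ultimately have "in_sector \<delta> w n v'" using w0 by (simp add: in_sector_def)
    then show ?thesis ..
  qed
  moreover have "z \<in> ball z d'" using d(1) z(1) by (simp add: d'_def)
  ultimately show ?thesis using that[OF open_ball] by blast
qed

text \<open>Linear contraction in logarithmic polar coordinates.\<close>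

definition contract :: "real \<Rightarrow> real \<times> complex \<Rightarrow> complex" where
  "contract \<delta> y = centre \<delta> (snd y) * exp (complex_of_real (1 - fst y) * Ln (snd y / centre \<delta> (snd y)))"

lemma contract_eq:
  assumes "in_sector \<delta> z n v"
  shows "contract \<delta> (s, z) = complex_of_real (exp ((1 - s) * ln (cmod z))) * pt ((1 - s) * v + s * (of_int n + \<delta>))"
    and "z / centre \<delta> z \<notin> \<real>\<^sub>\<le>\<^sub>0"
proof -
  have z: "z \<noteq> 0" "z = complex_of_real (cmod z) * pt v" "\<bar>v - (of_int n + \<delta>)\<bar> < 1/2"
    using assms by (auto simp: in_sector_def)
  define c where "c = of_int n + \<delta>"
  have c: "centre \<delta> z = pt c" using centre_eq[OF assms] by (simp add: c_def)
  define \<theta> where "\<theta> = 2 * pi * (v - c) / N"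
  have "\<bar>\<theta>\<bar> = 2 * pi * \<bar>v - c\<bar> / N" using N by (simp add: \<theta>_def abs_mult)
  \<comment> \<open>A crude bound by \<open>2 \<le> N\<close>. Angles below \<open>pi / 2\<close>
    keep \<open>z / pt c\<close> in the right half plane and off the branch cut of
    \<open>Ln\<close>.\<close>
  also have "\<dots> \<le> 2 * pi * \<bar>v - c\<bar> / 2" using N by (intro divide_left_mono) auto
  also have "\<dots> < 2 * pi * (1/2) / 2" using z(3) by (simp add: c_def)
  finally have \<theta>: "\<bar>\<theta>\<bar> < pi / 2" by simp
  define \<zeta> where "\<zeta> = Complex (ln (cmod z)) \<theta>"
  have "z / pt c = complex_of_real (cmod z) * pt (v - c)" using z(2) by (metis pt_minus times_divide_eq_right)
  also have "\<dots> = exp \<zeta>" using z(1) by (simp add: \<zeta>_def exp_eq_polar pt_def \<theta>_def)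
  finally have q: "z / pt c = exp \<zeta>" .
  have "Re (exp \<zeta>) > 0" using \<theta> z(1) by (simp add: \<zeta>_def Re_exp cos_gt_zero_pi abs_less_iff)
  then show "z / centre \<delta> z \<notin> \<real>\<^sub>\<le>\<^sub>0" unfolding c q by (auto simp: complex_nonpos_Reals_iff)
  have "Ln (exp \<zeta>) = \<zeta>" using \<theta> by (intro Ln_exp) (auto simp: \<zeta>_def abs_less_iff)
  then have "contract \<delta> (s, z) = pt c * exp (complex_of_real (1 - s) * \<zeta>)"
    by (simp add: contract_def c q)
  also have "exp (complex_of_real (1 - s) * \<zeta>) = complex_of_real (exp ((1 - s) * ln (cmod z))) * cis ((1 - s) * \<theta>)"
    by (simp add: exp_eq_polar \<zeta>_def)
  also have "cis ((1 - s) * \<theta>) = pt ((1 - s) * (v - c))"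
    by (simp add: pt_def \<theta>_def mult_ac)
  also have "pt c * (complex_of_real (exp ((1 - s) * ln (cmod z))) * pt ((1 - s) * (v - c))) =
      complex_of_real (exp ((1 - s) * ln (cmod z))) * pt (c + (1 - s) * (v - c))"
    by (simp add: pt_add)
  also have "c + (1 - s) * (v - c) = (1 - s) * v + s * c" by (simp add: algebra_simps)
  finally show "contract \<delta> (s, z) = complex_of_real (exp ((1 - s) * ln (cmod z))) * pt ((1 - s) * v + s * (of_int n + \<delta>))"
    by (simp add: c_def)
qed

lemma sectors_openin: "openin (top_of_set (cball 0 1)) (sectors \<delta>)"
proof (subst openin_subopen, intro ballI)
  fix z assume z: "z \<in> sectors \<delta>"
  then obtain n v where n: "in_sector \<delta> z n v" by (auto simp: sectors_def)
  obtain U where U: "open U" "z \<in> U" "\<And>w. w \<in> U \<Longrightarrow> \<exists>v'. in_sector \<delta> w n v'"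
    using sector_locally_constant[OF n] by metis
  have "openin (top_of_set (cball 0 1)) (cball 0 1 \<inter> U)" using U(1) by (rule openin_open_Int)
  moreover have "z \<in> cball 0 1 \<inter> U" using z U(2) by (simp add: sectors_def)
  moreover have "w \<in> sectors \<delta>" if "w \<in> cball 0 1 \<inter> U" for w
    using that U(3)[of w] by (auto simp: sectors_def)
  ultimately show "\<exists>T. openin (top_of_set (cball 0 1)) T \<and> z \<in> T \<and> T \<subseteq> sectors \<delta>" by blast
qed

text \<open>The gluing \<open>t \<mapsto> 1 - t\<close> maps the sectors around corners, and those around midpoints, to such sectors.\<close>

lemma glued_sectors:
  fixes k k' :: nat
  assumes \<delta>: "\<delta> = 0 \<or> \<delta> = 1/2" and t: "t \<in> {0..1}" and z: "pt (real k + t) \<in> sectors \<delta>"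
  obtains c where "c \<in> {0..1}" "\<bar>t - c\<bar> < 1/2" "c = 1/2 \<and> \<delta> = 1/2 \<or> (c = 0 \<or> c = 1) \<and> \<delta> = 0"
    "in_sector \<delta> (pt (real k + t)) (int k + \<lfloor>c\<rfloor>) (real k + t)"
    "in_sector \<delta> (pt (real k' + 1 - t)) (int k' + \<lfloor>1 - c\<rfloor>) (real k' + 1 - t)"
proof -
  obtain n v where n: "in_sector \<delta> (pt (real k + t)) n v" using z by (auto simp: sectors_def)
  then have "pt v = pt (real k + t)" "\<bar>v - (of_int n + \<delta>)\<bar> < 1/2" by (simp_all add: in_sector_def)
  then obtain m where m: "v = real k + t + of_int m * N" unfolding pt_eq_iff by blast
  define j where "j = n - m * int (4 * g) - int k"
  have "\<bar>t - (of_int j + \<delta>)\<bar> < 1/2"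
    using \<open>\<bar>v - (of_int n + \<delta>)\<bar> < 1/2\<close> unfolding m j_def by (simp add: N_def algebra_simps)
  note tj = this
  then have tj1: "t - (of_int j + \<delta>) < 1/2" and tj2: "- (t - (of_int j + \<delta>)) < 1/2"
    unfolding abs_less_iff by blast+
  have tj': "t < 1/2 + (of_int j + \<delta>)" "of_int j + \<delta> < 1/2 + t"
    using add_strict_right_mono[OF tj1, of "of_int j + \<delta>"] add_strict_right_mono[OF tj2, of t] by simp_all
  \<comment> \<open>The centre of the sector in the coordinate of side \<open>k\<close>: an end
    point for corners, \<open>1/2\<close> for midpoints. On the partner side it is
    \<open>1 - c\<close>.\<close>
  define c where "c = of_int j + \<delta>"
  have cc: "c = 1/2 \<and> \<delta> = 1/2 \<or> (c = 0 \<or> c = 1) \<and> \<delta> = 0"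
    using \<delta>
  proof
    assume d: "\<delta> = 0"
    have "t \<le> 1" "0 \<le> t" using t by auto
    then have "real_of_int j < real_of_int 2" "real_of_int (- 1) < real_of_int j" using tj' d by simp_all
    then have "j < 2" "- 1 < j" by (simp_all only: of_int_less_iff)
    then have "j = 0 \<or> j = 1" by arith
    then show ?thesis using d by (auto simp: c_def)
  next
    assume d: "\<delta> = 1/2"
    have "t \<le> 1" "0 \<le> t" using t by auto
    then have "real_of_int j < real_of_int 1" "real_of_int (- 1) < real_of_int j" using tj' d by simp_all
    then have "j < 1" "- 1 < j" by (simp_all only: of_int_less_iff)
    then have "j = 0" by arith
    then show ?thesis using d by (auto simp: c_def)
  qed
  have ct: "\<bar>t - c\<bar> < 1/2" using tj by (simp add: c_def)
  have fl: "of_int \<lfloor>c\<rfloor> + \<delta> = c" "of_int \<lfloor>1 - c\<rfloor> + \<delta> = 1 - c"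
    using cc by (elim disjE conjE; hypsubst; simp)+
  show ?thesis
  proof (rule that[of c])
    show "c \<in> {0..1}" using cc by (elim disjE conjE; hypsubst; simp)
    have 1: "(real_of_int (int k + \<lfloor>c\<rfloor>) + \<delta>) = real k + c" using fl(1) by simp
    show "in_sector \<delta> (pt (real k + t)) (int k + \<lfloor>c\<rfloor>) (real k + t)"
      unfolding in_sector_def 1 using ct by simp
    have 2: "(real_of_int (int k' + \<lfloor>1 - c\<rfloor>) + \<delta>) = real k' + (1 - c)" using fl(2) by simp
    have "\<bar>real k' + 1 - t - (real k' + (1 - c))\<bar> = \<bar>t - c\<bar>" by (simp add: abs_minus_commute)
    then show "in_sector \<delta> (pt (real k' + 1 - t)) (int k' + \<lfloor>1 - c\<rfloor>) (real k' + 1 - t)"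
      unfolding in_sector_def 2 using ct by simp
  qed (use ct cc in auto)
qed

text \<open>On the boundary the contraction is affine in the parameter, and the gluing carries the
  centre \<open>c\<close> to \<open>1 - c\<close>. So the partners move to the parameters
  \<open>t'\<close> and \<open>1 - t'\<close> of their sides, which are glued again.\<close>

lemma glued_sectors_contract:
  assumes \<delta>: "\<delta> = 0 \<or> \<delta> = 1/2" and ab: "glued g a b"
  shows "a \<in> sectors \<delta> \<longleftrightarrow> b \<in> sectors \<delta>" "a \<in> sectors \<delta> \<Longrightarrow> s \<in> {0..1} \<Longrightarrow> f (contract \<delta> (s, a)) = f (contract \<delta> (s, b))"
proof -
  obtain k k' t where t: "t \<in> {0..1}" and a: "a = pt (real k + t)" and b: "b = pt (real k' + 1 - t)"
    and kk: "\<exists>i<g. k = 4 * i \<and> k' = 4 * i + 2 \<or> k = 4 * i + 1 \<and> k' = 4 * i + 3"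
    using glued_cases[OF ab] by metis
  have in_sectors: "pt v \<in> sectors \<delta>" if "in_sector \<delta> (pt v) n v'" for v n v'
    using that unfolding sectors_def by auto
  show "a \<in> sectors \<delta> \<longleftrightarrow> b \<in> sectors \<delta>"
  proof
    assume "a \<in> sectors \<delta>"
    then show "b \<in> sectors \<delta>"
      unfolding a b by (rule glued_sectors[OF \<delta> t, where k' = k']) (rule in_sectors)
  next
    have b': "b = pt (real k' + (1 - t))" and t': "1 - t \<in> {0..1}" and a': "a = pt (real k + 1 - (1 - t))"
      using t a b by (simp_all add: add_diff_eq)
    assume "b \<in> sectors \<delta>"
    then show "a \<in> sectors \<delta>"
      unfolding a' b' by (rule glued_sectors[OF \<delta> t', where k' = k]) (rule in_sectors)
  qed
  assume as: "a \<in> sectors \<delta>" and s: "s \<in> {0..1}"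
  obtain c :: real where c: "c \<in> {0..1}" "c = 1/2 \<and> \<delta> = 1/2 \<or> (c = 0 \<or> c = 1) \<and> \<delta> = 0"
    and ia: "in_sector \<delta> a (int k + \<lfloor>c\<rfloor>) (real k + t)" and ib: "in_sector \<delta> b (int k' + \<lfloor>1 - c\<rfloor>) (real k' + 1 - t)"
    by (rule glued_sectors[OF \<delta> t as[unfolded a], where k' = k']) (simp only: a b)
  define t' where "t' = (1 - s) * t + s * c"
  have t': "t' \<in> {0..1}"
    using convexD_alt[of "{0..1 :: real}" t c s] t c s by (simp add: t'_def)
  have fl: "of_int \<lfloor>c\<rfloor> + \<delta> = c" "of_int \<lfloor>1 - c\<rfloor> + \<delta> = 1 - c"
    using c(2) by (elim disjE conjE; hypsubst; simp)+
  have "contract \<delta> (s, a) = pt ((1 - s) * (real k + t) + s * (real_of_int (int k + \<lfloor>c\<rfloor>) + \<delta>))"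
    using contract_eq(1)[OF ia] a by simp
  also have "(1 - s) * (real k + t) + s * (real_of_int (int k + \<lfloor>c\<rfloor>) + \<delta>) = real k + t'"
  proof -
    have "real_of_int (int k + \<lfloor>c\<rfloor>) + \<delta> = real k + c" using fl(1) by simp
    then show ?thesis by (simp only:) (simp add: t'_def algebra_simps)
  qed
  finally have 1: "contract \<delta> (s, a) = pt (real k + t')" .
  have "contract \<delta> (s, b) = pt ((1 - s) * (real k' + 1 - t) + s * (real_of_int (int k' + \<lfloor>1 - c\<rfloor>) + \<delta>))"
    using contract_eq(1)[OF ib] b by simp
  also have "(1 - s) * (real k' + 1 - t) + s * (real_of_int (int k' + \<lfloor>1 - c\<rfloor>) + \<delta>) = real k' + 1 - t'"
  proof -
    have "real_of_int (int k' + \<lfloor>1 - c\<rfloor>) + \<delta> = real k' + (1 - c)" using fl(2) by simp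
    then show ?thesis by (simp only:) (simp add: t'_def algebra_simps)
  qed
  finally have 2: "contract \<delta> (s, b) = pt (real k' + 1 - t')" .
  have "glued g (pt (real k + t')) (pt (real k' + 1 - t'))"
    using kk glued_pt[OF _ t'] by auto
  then show "f (contract \<delta> (s, a)) = f (contract \<delta> (s, b))"
    unfolding 1 2 by (rule glued_imp_eq)
qed

lemma saturated_sectors:
  assumes "\<delta> = 0 \<or> \<delta> = 1/2"
  shows "saturated_open (sectors \<delta>)"
  unfolding saturated_open_def
proof (intro conjI ballI impI)
  show "openin (top_of_set (cball 0 1)) (sectors \<delta>)" by (rule sectors_openin)
  fix z w assume z: "z \<in> sectors \<delta>" and w: "w \<in> cball 0 1" "f z = f w"
  then have "z \<in> cball 0 1" by (simp add: sectors_def)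
  then have "(z \<in> sectors \<delta>) = (w \<in> sectors \<delta>)"
    by (rule fibre_invariant[OF _ w]) (rule glued_sectors_contract(1)[OF assms])
  then show "w \<in> sectors \<delta>" using z by simp
qed

lemma contract_continuous: "continuous_on ({0..1} \<times> sectors \<delta>) (contract \<delta>)"
proof -
  let ?S = "{0..1} \<times> sectors \<delta>"
  have "continuous (at y within ?S) (contract \<delta>)" if y: "y \<in> ?S" for y
  proof -
    obtain s z where yz: "y = (s, z)" "z \<in> sectors \<delta>" using y by auto
    then obtain n v where n: "in_sector \<delta> z n v" by (auto simp: sectors_def)
    obtain U where U: "open U" "z \<in> U" "\<And>w. w \<in> U \<Longrightarrow> \<exists>v'. in_sector \<delta> w n v'"
      using sector_locally_constant[OF n] by metis
    then obtain d where d: "d > 0" "\<And>w. dist w z < d \<Longrightarrow> w \<in> U" unfolding open_dist by metis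
    define c where "c = pt (of_int n + \<delta>)"
    have cz: "centre \<delta> z = c" using centre_eq[OF n] by (simp add: c_def)
    have "isCont (\<lambda>y. c * exp (complex_of_real (1 - fst y) * Ln (snd y / c))) y"
      using contract_eq(2)[OF n] yz(1) cz
      by (intro isCont_mult isCont_exp' isCont_Ln' isCont_divide continuous_intros) (auto simp: c_def)
    then have "continuous (at y within ?S) (\<lambda>y. c * exp (complex_of_real (1 - fst y) * Ln (snd y / c)))"
      by (rule continuous_at_imp_continuous_at_within)
    then show ?thesis
    proof (rule continuous_transform_within[OF _ d(1) y])
      fix x assume x: "x \<in> ?S" "dist x y < d"
      then have "dist (snd x) z < d" using dist_snd_le[of x y] yz(1) by simp
      then obtain v' where "in_sector \<delta> (snd x) n v'" using d(2) U(3) by blast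
      then have "centre \<delta> (snd x) = c" using centre_eq by (simp add: c_def)
      then show "c * exp (complex_of_real (1 - fst x) * Ln (snd x / c)) = contract \<delta> x"
        by (simp add: contract_def)
    qed
  qed
  then show ?thesis by (simp add: continuous_on_eq_continuous_within)
qed

lemma contraction_chart_sectors:
  assumes \<delta>: "\<delta> = 0 \<or> \<delta> = 1/2"
  shows "contraction_chart (sectors \<delta>) (contract \<delta>)"
  unfolding contraction_chart_def
proof (intro conjI)
  show "saturated_open (sectors \<delta>)" by (rule saturated_sectors[OF \<delta>])
  show "continuous_on ({0..1} \<times> sectors \<delta>) (contract \<delta>)" by (rule contract_continuous)
  show "contract \<delta> ` ({0..1} \<times> sectors \<delta>) \<subseteq> cball 0 1"
  proof clarify
    fix s :: real and z assume s: "s \<in> {0..1}" and z: "z \<in> sectors \<delta>"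
    then obtain n v where n: "in_sector \<delta> z n v" by (auto simp: sectors_def)
    have "cmod z \<le> 1" "cmod z > 0" using z n by (auto simp: sectors_def in_sector_def)
    then have "(1 - s) * ln (cmod z) \<le> 0" using s by (intro mult_nonneg_nonpos) auto
    then show "contract \<delta> (s, z) \<in> cball 0 1" unfolding contract_eq(1)[OF n] by (simp add: norm_mult)
  qed
  show "\<forall>z\<in>sectors \<delta>. contract \<delta> (0, z) = z"
  proof
    fix z assume "z \<in> sectors \<delta>"
    then obtain n v where n: "in_sector \<delta> z n v" by (auto simp: sectors_def)
    have "cmod z > 0" "z = complex_of_real (cmod z) * pt v" using n by (auto simp: in_sector_def)
    then show "contract \<delta> (0, z) = z" using contract_eq(1)[OF n, of 0] by simp
  qed
  show "\<forall>s\<in>{0..1}. \<forall>z\<in>sectors \<delta>. \<forall>w\<in>sectors \<delta>. f z = f w \<longrightarrow> f (contract \<delta> (s, z)) = f (contract \<delta> (s, w))"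
  proof (intro ballI impI)
    fix s :: real and z w assume s: "s \<in> {0..1}" and z: "z \<in> sectors \<delta>" and w: "w \<in> sectors \<delta>" and e: "f z = f w"
    have c: "z \<in> cball 0 1" "w \<in> cball 0 1" using z w by (simp_all add: sectors_def)
    have "(if z \<in> sectors \<delta> then f (contract \<delta> (s, z)) else f 0) = (if w \<in> sectors \<delta> then f (contract \<delta> (s, w)) else f 0)"
    proof (rule fibre_invariant[OF c e])
      fix a b assume "glued g a b"
      then show "(if a \<in> sectors \<delta> then f (contract \<delta> (s, a)) else f 0) = (if b \<in> sectors \<delta> then f (contract \<delta> (s, b)) else f 0)"
        using glued_sectors_contract(1)[OF \<delta>, of a b] glued_sectors_contract(2)[OF \<delta>, of a b s] s by simp
    qed
    then show "f (contract \<delta> (s, z)) = f (contract \<delta> (s, w))" using z w by simp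
  qed
  show "\<forall>z\<in>sectors \<delta>. \<exists>U. open U \<and> z \<in> U \<and> (\<forall>w\<in>U \<inter> sectors \<delta>. contract \<delta> (1, w) = contract \<delta> (1, z))"
  proof
    fix z assume "z \<in> sectors \<delta>"
    then obtain n v where n: "in_sector \<delta> z n v" by (auto simp: sectors_def)
    obtain U where U: "open U" "z \<in> U" "\<And>w. w \<in> U \<Longrightarrow> \<exists>v'. in_sector \<delta> w n v'"
      using sector_locally_constant[OF n] by metis
    have "contract \<delta> (1, w) = contract \<delta> (1, z)" if "w \<in> U" for w
      using U(3)[OF that] contract_eq(1)[of \<delta> w n _ 1] contract_eq(1)[OF n, of 1] by auto
    then show "\<exists>U. open U \<and> z \<in> U \<and> (\<forall>w\<in>U \<inter> sectors \<delta>. contract \<delta> (1, w) = contract \<delta> (1, z))"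
      using U(1,2) by blast
  qed
qed

lemma saturated_ball: "saturated_open (ball 0 1)"
  unfolding saturated_open_def
proof (intro conjI ballI impI)
  show "openin (top_of_set (cball 0 1)) (ball 0 1)"
    by (rule open_subset) auto
  fix z w assume "z \<in> ball 0 1" "w \<in> cball 0 1" "f z = f w"
  then have "w = z" by (intro fibre_interior) auto
  then show "w \<in> ball 0 1" using \<open>z \<in> ball 0 1\<close> by simp
qed

lemma contraction_chart_ball: "contraction_chart (ball 0 1) (\<lambda>y. (1 - fst y) *\<^sub>R snd y)"
  unfolding contraction_chart_def
proof (intro conjI)
  let ?h = "\<lambda>y :: real \<times> complex. (1 - fst y) *\<^sub>R snd y"
  show "saturated_open (ball 0 1)" by (rule saturated_ball)
  show "continuous_on ({0..1} \<times> ball 0 1) ?h" by (intro continuous_intros)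
  show "?h ` ({0..1} \<times> ball 0 1) \<subseteq> cball 0 1"
  proof (rule image_subsetI)
    fix y :: "real \<times> complex" assume "y \<in> {0..1} \<times> ball 0 1"
    then have y: "fst y \<in> {0..1}" "cmod (snd y) < 1" by auto
    then have "(1 - fst y) * cmod (snd y) \<le> 1" by (intro mult_le_one) auto
    then show "?h y \<in> cball 0 1" using y(1) by simp
  qed
  show "\<forall>z\<in>ball 0 1. ?h (0, z) = z" by simp
  show "\<forall>s\<in>{0..1}. \<forall>z\<in>ball 0 1. \<forall>w\<in>ball 0 1. f z = f w \<longrightarrow> f (?h (s, z)) = f (?h (s, w))"
  proof (intro ballI impI)
    fix s :: real and z w :: complex assume "z \<in> ball 0 1" "w \<in> ball 0 1" "f z = f w"
    then have "w = z" by (intro fibre_interior) auto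
    then show "f (?h (s, z)) = f (?h (s, w))" by simp
  qed
  show "\<forall>z\<in>ball 0 1. \<exists>U. open U \<and> z \<in> U \<and> (\<forall>w\<in>U \<inter> ball 0 1. ?h (1, w) = ?h (1, z))"
    by (auto intro: exI[of _ UNIV])
qed

lemma in_sectors_pt:
  assumes "\<bar>v - (of_int n + \<delta>)\<bar> < 1/2"
  shows "in_sector \<delta> (pt v) n v" "pt v \<in> sectors \<delta>"
  using assms by (auto simp: in_sector_def sectors_def)

lemma sectors_cover:
  assumes "z \<in> cball 0 1"
  shows "z \<in> ball 0 1 \<or> z \<in> sectors 0 \<or> z \<in> sectors (1/2)"
proof (cases "cmod z < 1")
  case False
  then have r: "cmod z = 1" using assms by simp
  then obtain v where v: "z = pt v" using polar[of z] by auto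
  show ?thesis
  proof (cases "v = of_int \<lfloor>v\<rfloor>")
    case True
    then have "\<bar>v - (of_int \<lfloor>v\<rfloor> + 0)\<bar> < 1/2" by simp
    then show ?thesis using in_sectors_pt(2) v by blast
  next
    case False
    then have "of_int \<lfloor>v\<rfloor> < v" using of_int_floor_le[of v] by linarith
    then have "\<bar>v - (of_int \<lfloor>v\<rfloor> + 1/2)\<bar> < 1/2" using floor_correct[of v] unfolding abs_less_iff by linarith
    then show ?thesis using in_sectors_pt(2) v by blast
  qed
qed simp

lemma charts_cover:
  assumes "z \<in> cball 0 1"
  shows "\<exists>W h. contraction_chart W h \<and> z \<in> W"
  using sectors_cover[OF assms] contraction_chart_ball contraction_chart_sectors[of 0] contraction_chart_sectors[of "1/2"]
  by blast

end

section \<open>Generators and relation of the surface group\<close>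

context glued_polygon
begin

text \<open>The midpoints merely represent a pair of sides: by \<open>jump_along_side\<close> all
  glued pairs on these sides have the same jump. The form \<open>1 - 1/2\<close> matches
  \<open>glued_pt\<close>.\<close>

definition gen_x :: "nat \<Rightarrow> (real \<Rightarrow> 'a) set" where
  "gen_x i = jump (pt (real (4 * i) + 1/2)) (pt (real (4 * i + 2) + 1 - 1/2))"

definition gen_y :: "nat \<Rightarrow> (real \<Rightarrow> 'a) set" where
  "gen_y i = jump (pt (real (4 * i + 1) + 1/2)) (pt (real (4 * i + 3) + 1 - 1/2))"

lemma jump_along_side:
  assumes "\<And>t. t \<in> {0..1} \<Longrightarrow> glued g (pt (real k + t)) (pt (real k' + 1 - t))" and t: "t \<in> {0..1}"
  shows "jump (pt (real k + t)) (pt (real k' + 1 - t)) = jump (pt (real k + 1/2)) (pt (real k' + 1 - 1/2))"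
proof -
  let ?c = "\<lambda>s :: real. (1 - s) * t + s * (1/2)"
  have c: "?c s \<in> {0..1}" if "s \<in> {0..1}" for s
    using convexD_alt[of "{0..1 :: real}" t "1/2" s] t that by simp
  have "jump (pt (real k + ?c 0)) (pt (real k' + 1 - ?c 0)) = jump (pt (real k + ?c 1)) (pt (real k' + 1 - ?c 1))"
  proof (rule jump_invariant)
    show "continuous_on {0..1} (\<lambda>s. pt (real k + ?c s))" "continuous_on {0..1} (\<lambda>s. pt (real k' + 1 - ?c s))"
      by (intro continuous_on_pt continuous_intros)+
    show "f (pt (real k + ?c s)) = f (pt (real k' + 1 - ?c s))" if "s \<in> {0..1}" for s
      by (rule glued_imp_eq[OF assms(1)[OF c[OF that]]])
  qed auto
  then show ?thesis by simp
qed

lemma jump_x: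
  assumes "i < g" "t \<in> {0..1}"
  shows "jump (pt (real (4 * i) + t)) (pt (real (4 * i + 2) + 1 - t)) = gen_x i"
  unfolding gen_x_def by (rule jump_along_side[OF _ assms(2)]) (rule glued_pt(1)[OF assms(1)])

lemma jump_y:
  assumes "i < g" "t \<in> {0..1}"
  shows "jump (pt (real (4 * i + 1) + t)) (pt (real (4 * i + 3) + 1 - t)) = gen_y i"
  unfolding gen_y_def by (rule jump_along_side[OF _ assms(2)]) (rule glued_pt(2)[OF assms(1)])

lemma gen_closed:
  assumes "i < g"
  shows "gen_x i \<in> carrier \<pi>" "gen_y i \<in> carrier \<pi>"
  using glued_imp_eq[OF glued_pt(1)[OF assms, of "1/2"]] glued_imp_eq[OF glued_pt(2)[OF assms, of "1/2"]]
  unfolding gen_x_def gen_y_def by (auto intro!: jump_closed)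

text \<open>Two points of a fibre are joined by a chain of gluings. Jumps multiply along the chain,
  and each link contributes a generator or its inverse.\<close>

lemma generated: "generate \<pi> (gen_x ` {..<g} \<union> gen_y ` {..<g}) = carrier \<pi>" (is "?M = _")
proof (rule generated_by_jumps)
  have sub: "gen_x ` {..<g} \<union> gen_y ` {..<g} \<subseteq> carrier \<pi>" using gen_closed by auto
  then show M: "subgroup ?M \<pi>" by (rule generate_is_subgroup)
  show "\<exists>W h. contraction_chart W h \<and> z \<in> W" if "z \<in> cball 0 1" for z by (rule charts_cover[OF that])
  have step: "a \<in> cball 0 1 \<and> b \<in> cball 0 1 \<and> f a = f b \<and> jump a b \<in> ?M" if ab: "glued g a b" for a b
  proof -
    have "jump a b \<in> ?M"
      using ab
    proof cases
      case (a i t)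
      then have "jump a b = gen_x i"
        using jump_x[of i t] by (simp add: polygon_side_eq add_diff_eq)
      then show ?thesis using a by (auto intro: generate.incl)
    next
      case (b i t)
      then have "jump a b = gen_y i"
        using jump_y[of i t] by (simp add: polygon_side_eq add_diff_eq)
      then show ?thesis using b by (auto intro: generate.incl)
    qed
    moreover have "a \<in> cball 0 1" "b \<in> cball 0 1" using ab by (auto elim!: glued_cases)
    ultimately show ?thesis using glued_imp_eq[OF ab] by simp
  qed
  fix z z' assume z: "z \<in> cball 0 1" "z' \<in> cball 0 1" "f z = f z'"
  then have "equivclp (glued g) z z'" using fibres by blast
  then have "z' \<in> cball 0 1 \<and> f z = f z' \<and> jump z z' \<in> ?M"
  proof (induction rule: equivclp_induct)
    case base
    then show ?case using z(1) jump_refl[OF z(1)] subgroup.one_closed[OF M] by simp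
  next
    case (step y w)
    have yw: "w \<in> cball 0 1 \<and> y \<in> cball 0 1 \<and> f y = f w \<and> jump y w \<in> ?M"
    proof (cases "glued g y w")
      case True
      then show ?thesis using \<open>\<And>a b. glued g a b \<Longrightarrow> _\<close> by blast
    next
      case False
      then have "glued g w y" using step.hyps(2) by blast
      then have *: "w \<in> cball 0 1" "y \<in> cball 0 1" "f w = f y" "jump w y \<in> ?M"
        using \<open>\<And>a b. glued g a b \<Longrightarrow> _\<close> by blast+
      then show ?thesis using jump_inv[OF *(1,2,3)] subgroup.m_inv_closed[OF M *(4)] by simp
    qed
    have "jump z y \<otimes>\<^bsub>\<pi>\<^esub> jump y w = jump z w"
      using step.IH yw z(1) by (intro jump_mult) auto
    moreover have "jump z y \<otimes>\<^bsub>\<pi>\<^esub> jump y w \<in> ?M"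
      using step.IH yw by (intro subgroup.m_closed[OF M]) auto
    ultimately show ?case using step.IH yw by simp
  qed
  then show "jump z z' \<in> ?M" by blast
qed

text \<open>The end points of the glued sides identify the corners \<open>4 * i\<close>,
  \<open>4 * i + 3\<close>, \<open>4 * i + 2\<close>, \<open>4 * i + 1\<close>,
  \<open>4 * i + 4\<close> successively. The jumps telescope along this circuit around the vertex,
  which closes up because corner \<open>4 * g\<close> is corner \<open>0\<close>.\<close>

lemma relator_eq_one: "surface_relator \<pi> gen_x gen_y g = \<one>\<^bsub>\<pi>\<^esub>"
proof -
  define p where "p = (\<lambda>n. pt (real n))"
  have "surface_relator \<pi> gen_x gen_y i = jump (p 0) (p (4 * i)) \<and> f (p 0) = f (p (4 * i))" if "i \<le> g" for i
    using that
  proof (induction i)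
    case 0
    then show ?case by (simp add: jump_refl p_def)
  next
    case (Suc i)
    then have i: "i < g" by simp
    have 01: "(0 :: real) \<in> {0..1}" "(1 :: real) \<in> {0..1}" by auto
    have c: "p n \<in> cball 0 1" for n by (simp add: p_def)
    have a: "jump (p (4 * i)) (p (4 * i + 3)) = gen_x i" "f (p (4 * i)) = f (p (4 * i + 3))"
      using jump_x[OF i 01(1)] glued_imp_eq[OF glued_pt(1)[OF i 01(1)]] by (simp_all add: p_def add_ac)
    have b: "jump (p (4 * i + 1)) (p (4 * i + 2)) = gen_x i" "f (p (4 * i + 1)) = f (p (4 * i + 2))"
      using jump_x[OF i 01(2)] glued_imp_eq[OF glued_pt(1)[OF i 01(2)]] by (simp_all add: p_def add_ac)
    have d: "jump (p (4 * i + 1)) (p (4 * i + 4)) = gen_y i" "f (p (4 * i + 1)) = f (p (4 * i + 4))"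
      using jump_y[OF i 01(1)] glued_imp_eq[OF glued_pt(2)[OF i 01(1)]] by (simp_all add: p_def add_ac)
    have e: "jump (p (4 * i + 2)) (p (4 * i + 3)) = gen_y i" "f (p (4 * i + 2)) = f (p (4 * i + 3))"
      using jump_y[OF i 01(2)] glued_imp_eq[OF glued_pt(2)[OF i 01(2)]] by (simp_all add: p_def add_ac)
    have "inv\<^bsub>\<pi>\<^esub> gen_y i = jump (p (4 * i + 3)) (p (4 * i + 2))" "inv\<^bsub>\<pi>\<^esub> gen_x i = jump (p (4 * i + 2)) (p (4 * i + 1))"
      using jump_inv[OF c c e(2)] jump_inv[OF c c b(2)] e(1) b(1) by simp_all
    then have "gen_x i \<otimes>\<^bsub>\<pi>\<^esub> inv\<^bsub>\<pi>\<^esub> gen_y i \<otimes>\<^bsub>\<pi>\<^esub> inv\<^bsub>\<pi>\<^esub> gen_x i \<otimes>\<^bsub>\<pi>\<^esub> gen_y i =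
        jump (p (4 * i)) (p (4 * i + 3)) \<otimes>\<^bsub>\<pi>\<^esub> jump (p (4 * i + 3)) (p (4 * i + 2)) \<otimes>\<^bsub>\<pi>\<^esub>
        jump (p (4 * i + 2)) (p (4 * i + 1)) \<otimes>\<^bsub>\<pi>\<^esub> jump (p (4 * i + 1)) (p (4 * i + 4))"
      by (simp only: a(1) d(1))
    also have "jump (p (4 * i)) (p (4 * i + 3)) \<otimes>\<^bsub>\<pi>\<^esub> jump (p (4 * i + 3)) (p (4 * i + 2)) = jump (p (4 * i)) (p (4 * i + 2))"
      by (rule jump_mult[OF c c c a(2) e(2)[symmetric]])
    also have "jump (p (4 * i)) (p (4 * i + 2)) \<otimes>\<^bsub>\<pi>\<^esub> jump (p (4 * i + 2)) (p (4 * i + 1)) = jump (p (4 * i)) (p (4 * i + 1))"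
      by (rule jump_mult[OF c c c _ b(2)[symmetric]]) (simp only: a(2) e(2))
    also have "jump (p (4 * i)) (p (4 * i + 1)) \<otimes>\<^bsub>\<pi>\<^esub> jump (p (4 * i + 1)) (p (4 * i + 4)) = jump (p (4 * i)) (p (4 * i + 4))"
      by (rule jump_mult[OF c c c _ d(2)]) (simp only: a(2) b(2) e(2))
    finally have blk: "gen_x i \<otimes>\<^bsub>\<pi>\<^esub> inv\<^bsub>\<pi>\<^esub> gen_y i \<otimes>\<^bsub>\<pi>\<^esub> inv\<^bsub>\<pi>\<^esub> gen_x i \<otimes>\<^bsub>\<pi>\<^esub> gen_y i =
        jump (p (4 * i)) (p (4 * i + 4))" .
    have f4: "f (p (4 * i)) = f (p (4 * i + 4))" using a(2) b(2) e(2) d(2) by simp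
    have IH: "surface_relator \<pi> gen_x gen_y i = jump (p 0) (p (4 * i))" "f (p 0) = f (p (4 * i))"
      using Suc i by auto
    have "surface_relator \<pi> gen_x gen_y (Suc i) = jump (p 0) (p (4 * i + 4))"
      unfolding surface_relator.simps blk IH(1) by (rule jump_mult[OF c c c IH(2) f4])
    then show ?case using IH(2) f4 by (simp add: add_ac)
  qed
  from this[of g] have "surface_relator \<pi> gen_x gen_y g = jump (p 0) (p (4 * g))" by simp
  moreover have "p (4 * g) = p 0" using pt_period[of 0] by (simp add: p_def N_def)
  ultimately show ?thesis using jump_refl[of "p 0"] by (simp add: p_def)
qed

end

text \<open>The trivialization in the sector at corner \<open>n\<close>: the part of the relator
  accumulated on the circuit of \<open>relator_eq_one\<close> up to this corner. Starting with the
  unit at corner \<open>0\<close>, the values are forced by compatibility with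
  \<open>side_val\<close>.\<close>

definition corner_val ::
    "('k, 'm) monoid_scheme \<Rightarrow> (nat \<Rightarrow> 'k) \<Rightarrow> (nat \<Rightarrow> 'k) \<Rightarrow> nat \<Rightarrow> 'k" where
  "corner_val K \<xi> \<eta> n = (let i = n div 4; r = surface_relator K \<xi> \<eta> i in
     if n mod 4 = 0 then r
     else if n mod 4 = 1 then r \<otimes>\<^bsub>K\<^esub> (\<xi> i \<otimes>\<^bsub>K\<^esub> inv\<^bsub>K\<^esub> \<eta> i \<otimes>\<^bsub>K\<^esub> inv\<^bsub>K\<^esub> \<xi> i)
     else if n mod 4 = 2 then r \<otimes>\<^bsub>K\<^esub> (\<xi> i \<otimes>\<^bsub>K\<^esub> inv\<^bsub>K\<^esub> \<eta> i)
     else r \<otimes>\<^bsub>K\<^esub> \<xi> i)"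

text \<open>By \<open>Hol_jump\<close> the holonomy of a pair of sides is the quotient of their two
  values; so one side gets the unit and its partner the desired image of the generator.\<close>

definition side_val ::
    "('k, 'm) monoid_scheme \<Rightarrow> (nat \<Rightarrow> 'k) \<Rightarrow> (nat \<Rightarrow> 'k) \<Rightarrow> nat \<Rightarrow> 'k" where
  "side_val K \<xi> \<eta> n = (if n mod 4 = 2 then \<xi> (n div 4) else if n mod 4 = 3 then \<eta> (n div 4) else \<one>\<^bsub>K\<^esub>)"

lemma corner_val_simps:
  "corner_val K \<xi> \<eta> (4 * i) = surface_relator K \<xi> \<eta> i"
  "corner_val K \<xi> \<eta> (4 * i + 1) = surface_relator K \<xi> \<eta> i \<otimes>\<^bsub>K\<^esub> (\<xi> i \<otimes>\<^bsub>K\<^esub> inv\<^bsub>K\<^esub> \<eta> i \<otimes>\<^bsub>K\<^esub> inv\<^bsub>K\<^esub> \<xi> i)"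
  "corner_val K \<xi> \<eta> (4 * i + 2) = surface_relator K \<xi> \<eta> i \<otimes>\<^bsub>K\<^esub> (\<xi> i \<otimes>\<^bsub>K\<^esub> inv\<^bsub>K\<^esub> \<eta> i)"
  "corner_val K \<xi> \<eta> (4 * i + 3) = surface_relator K \<xi> \<eta> i \<otimes>\<^bsub>K\<^esub> \<xi> i"
proof -
  have m: "(4 * i + 1) mod 4 = 1" "(4 * i + 2) mod 4 = 2" "(4 * i + 3) mod 4 = 3"
    "(4 * i + 1) div 4 = i" "(4 * i + 2) div 4 = i" "(4 * i + 3) div 4 = i" by presburger+
  show "corner_val K \<xi> \<eta> (4 * i) = surface_relator K \<xi> \<eta> i"
    "corner_val K \<xi> \<eta> (4 * i + 1) = surface_relator K \<xi> \<eta> i \<otimes>\<^bsub>K\<^esub> (\<xi> i \<otimes>\<^bsub>K\<^esub> inv\<^bsub>K\<^esub> \<eta> i \<otimes>\<^bsub>K\<^esub> inv\<^bsub>K\<^esub> \<xi> i)"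
    "corner_val K \<xi> \<eta> (4 * i + 2) = surface_relator K \<xi> \<eta> i \<otimes>\<^bsub>K\<^esub> (\<xi> i \<otimes>\<^bsub>K\<^esub> inv\<^bsub>K\<^esub> \<eta> i)"
    "corner_val K \<xi> \<eta> (4 * i + 3) = surface_relator K \<xi> \<eta> i \<otimes>\<^bsub>K\<^esub> \<xi> i"
    unfolding corner_val_def m Let_def by simp_all
qed

lemma side_val_simps:
  "side_val K \<xi> \<eta> (4 * i) = \<one>\<^bsub>K\<^esub>" "side_val K \<xi> \<eta> (4 * i + 1) = \<one>\<^bsub>K\<^esub>"
  "side_val K \<xi> \<eta> (4 * i + 2) = \<xi> i" "side_val K \<xi> \<eta> (4 * i + 3) = \<eta> i"
proof -
  have m: "(4 * i + 1) mod 4 = 1" "(4 * i + 2) mod 4 = 2" "(4 * i + 3) mod 4 = 3"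
    "(4 * i + 2) div 4 = i" "(4 * i + 3) div 4 = i" by presburger+
  show "side_val K \<xi> \<eta> (4 * i) = \<one>\<^bsub>K\<^esub>" "side_val K \<xi> \<eta> (4 * i + 1) = \<one>\<^bsub>K\<^esub>"
    "side_val K \<xi> \<eta> (4 * i + 2) = \<xi> i" "side_val K \<xi> \<eta> (4 * i + 3) = \<eta> i"
    unfolding side_val_def m by simp_all
qed

section \<open>Homomorphisms from the surface group with prescribed values on the generators\<close>

context glued_polygon
begin

text \<open>The covering is trivialized over the open disc, the corner sectors and the side sectors.
  Points of the open disc are alone in their fibres, so compatibility is at stake only where corner
  and side sectors overlap. Along the circuit of corners it holds by construction until the last
  corner meets the first, where \<open>rel\<close> enters.\<close>

lemma holonomy_exists:
  fixes K :: "('k, 'm) monoid_scheme"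
  assumes K: "group K" and gens: "\<And>i. i < g \<Longrightarrow> \<xi> i \<in> carrier K \<and> \<eta> i \<in> carrier K"
    and rel: "surface_relator K \<xi> \<eta> g = \<one>\<^bsub>K\<^esub>"
  shows "\<exists>\<psi>\<in>hom \<pi> K. \<forall>i<g. \<psi> (gen_x i) = \<xi> i \<and> \<psi> (gen_y i) = \<eta> i"
proof -
  interpret K: group K by (rule K)
  define S where "S = (\<lambda>j :: nat. if j = 0 then ball 0 1 else if j = 1 then sectors 0 else sectors (1/2))"
  define v where "v = corner_val K \<xi> \<eta>"
  define e where "e = side_val K \<xi> \<eta>"
  define \<Phi> where "\<Phi> = (\<lambda>(j :: nat) z. if j = 0 then \<one>\<^bsub>K\<^esub> else if j = 1 then v (idx 0 z) else e (idx (1/2) z))"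
  have relK: "surface_relator K \<xi> \<eta> i \<in> carrier K" if "i \<le> g" for i
    using that gens by (intro K.surface_relator_closed) auto
  have val_closed: "v n \<in> carrier K" "e n \<in> carrier K" if "n < 4 * g" for n
  proof -
    have i: "n div 4 < g" using that by (simp add: less_mult_imp_div_less mult.commute)
    then show "v n \<in> carrier K" "e n \<in> carrier K"
      using gens[OF i] relK[of "n div 4"] by (auto simp: v_def e_def corner_val_def side_val_def Let_def)
  qed
  have d: "(0 :: real) = 0 \<or> (0 :: real) = 1/2" "(1/2 :: real) = 0 \<or> (1/2 :: real) = 1/2" by auto
  have idxc: "idx \<delta> z < 4 * g" if "z \<in> sectors \<delta>" for \<delta> z
    using that idx_less by (auto simp: sectors_def)
  have \<Phi>_closed: "\<Phi> j z \<in> carrier K" if "j \<in> {0, 1, 2}" "z \<in> S j" for j z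
    using that val_closed idxc by (auto simp: \<Phi>_def S_def)
  have idx_loc: "\<exists>U. open U \<and> z \<in> U \<and> (\<forall>w\<in>U \<inter> sectors \<delta>. idx \<delta> w = idx \<delta> z)" if zs: "z \<in> sectors \<delta>" for \<delta> z
  proof -
    obtain n v where n: "in_sector \<delta> z n v" using zs by (auto simp: sectors_def)
    obtain U where U: "open U" "z \<in> U" "\<And>w. w \<in> U \<Longrightarrow> \<exists>v'. in_sector \<delta> w n v'"
      using sector_locally_constant[OF n] by metis
    have "idx \<delta> w = idx \<delta> z" if "w \<in> U" for w using U(3)[OF that] idx_eq idx_eq[OF n] by auto
    then show ?thesis using U(1,2) by blast
  qed
  \<comment> \<open>The coordinate change between corner and side sectors; at glued points its
    values are compared near the two ends \<open>c = 0\<close> and \<open>c = 1\<close> of the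
    sides.\<close>
  define R where "R = (\<lambda>z. v (idx 0 z) \<otimes>\<^bsub>K\<^esub> inv\<^bsub>K\<^esub> e (idx (1/2) z))"
  have R_glued: "R a = R b" if ab: "glued g a b" and sec: "a \<in> sectors 0" "a \<in> sectors (1/2)" for a b
  proof -
    obtain k k' t where t: "t \<in> {0..1}" and a: "a = pt (real k + t)" and b: "b = pt (real k' + 1 - t)"
      and kk: "\<exists>i<g. k = 4 * i \<and> k' = 4 * i + 2 \<or> k = 4 * i + 1 \<and> k' = 4 * i + 3"
      using glued_cases[OF ab] by metis
    then obtain i where i: "i < g" and ki: "k = 4 * i \<and> k' = 4 * i + 2 \<or> k = 4 * i + 1 \<and> k' = 4 * i + 3" by blast
    obtain c :: real where c: "c = 0 \<or> c = 1" and ia: "in_sector 0 a (int k + \<lfloor>c\<rfloor>) (real k + t)"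
      and ib: "in_sector 0 b (int k' + \<lfloor>1 - c\<rfloor>) (real k' + 1 - t)"
      by (rule glued_sectors[OF d(1) t sec(1)[unfolded a], where k' = k']) (auto simp: a b)
    have half: "in_sector (1/2) a (int k) (real k + t)" "in_sector (1/2) b (int k') (real k' + 1 - t)"
    proof -
      obtain c :: real where c: "c = 1/2" and ia: "in_sector (1/2) a (int k + \<lfloor>c\<rfloor>) (real k + t)"
        and ib: "in_sector (1/2) b (int k' + \<lfloor>1 - c\<rfloor>) (real k' + 1 - t)"
        by (rule glued_sectors[OF d(2) t sec(2)[unfolded a], where k' = k']) (auto simp: a b)
      show "in_sector (1/2) a (int k) (real k + t)" "in_sector (1/2) b (int k') (real k' + 1 - t)"
        using ia ib unfolding c by simp_all
    qed
    have idx_nat: "idx \<delta> z = n mod (4 * g)" if "in_sector \<delta> z (int n) x" for \<delta> z n x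
      using idx_eq[OF that] by (simp add: nat_mod_distrib nat_mult_distrib)
    have ih: "idx (1/2) a = k" "idx (1/2) b = k'"
      using idx_nat[OF half(1)] idx_nat[OF half(2)] ki i by auto
    have gi: "\<xi> i \<in> carrier K" "\<eta> i \<in> carrier K" "surface_relator K \<xi> \<eta> i \<in> carrier K"
      using gens[OF i] relK[of i] i by auto
    \<comment> \<open>Corner \<open>4 * i + 4\<close> opens the next block, except after the last
      block, where it is corner \<open>0\<close> and the relation is used.\<close>
    have v4: "v ((4 * i + 4) mod (4 * g)) = surface_relator K \<xi> \<eta> i \<otimes>\<^bsub>K\<^esub>
        (\<xi> i \<otimes>\<^bsub>K\<^esub> inv\<^bsub>K\<^esub> \<eta> i \<otimes>\<^bsub>K\<^esub> inv\<^bsub>K\<^esub> \<xi> i \<otimes>\<^bsub>K\<^esub> \<eta> i)"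
    proof (cases "Suc i < g")
      case True
      then have "(4 * i + 4) mod (4 * g) = 4 * Suc i" by simp
      then show ?thesis unfolding v_def by (simp only: corner_val_simps surface_relator.simps)
    next
      case False
      then have g: "g = Suc i" using i by simp
      have "4 * i + 4 = 4 * g" unfolding g by simp
      then have m: "(4 * i + 4) mod (4 * g) = 4 * 0" by simp
      have rel': "surface_relator K \<xi> \<eta> (Suc i) = \<one>\<^bsub>K\<^esub>" using rel unfolding g .
      show ?thesis unfolding v_def m corner_val_simps surface_relator.simps(1) rel'[unfolded surface_relator.simps] ..
    qed
    note vs = corner_val_simps[of K \<xi> \<eta> i, folded v_def] side_val_simps[of K \<xi> \<eta> i, folded e_def]
    have canc: "x \<otimes>\<^bsub>K\<^esub> y \<otimes>\<^bsub>K\<^esub> inv\<^bsub>K\<^esub> y = x" if "x \<in> carrier K" "y \<in> carrier K" for x y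
      using that by (simp add: K.m_assoc)
    show ?thesis
      using c
    proof
      assume c0: "c = 0"
      have "idx 0 a = k mod (4 * g)" using idx_nat[of 0 a k] ia c0 by simp
      moreover have "idx 0 b = (k' + 1) mod (4 * g)" using idx_nat[of 0 b "k' + 1"] ib c0 by (simp add: add_ac)
      ultimately have R: "R a = v (k mod (4 * g)) \<otimes>\<^bsub>K\<^esub> inv\<^bsub>K\<^esub> e k" "R b = v ((k' + 1) mod (4 * g)) \<otimes>\<^bsub>K\<^esub> inv\<^bsub>K\<^esub> e k'"
        by (simp_all add: R_def ih)
      show ?thesis
        using ki
      proof (elim disjE conjE)
        assume k: "k = 4 * i" "k' = 4 * i + 2"
        then have "k mod (4 * g) = 4 * i" "(k' + 1) mod (4 * g) = 4 * i + 3" using i by auto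
        then show ?thesis unfolding R k vs(1,4,5,7) using gi by (simp add: vs canc)
      next
        assume k: "k = 4 * i + 1" "k' = 4 * i + 3"
        then have m: "k mod (4 * g) = 4 * i + 1" "k' + 1 = 4 * i + 4" using i by auto
        have "R a = surface_relator K \<xi> \<eta> i \<otimes>\<^bsub>K\<^esub> (\<xi> i \<otimes>\<^bsub>K\<^esub> inv\<^bsub>K\<^esub> \<eta> i \<otimes>\<^bsub>K\<^esub> inv\<^bsub>K\<^esub> \<xi> i)"
          unfolding R m unfolding k(1) vs using gi by simp
        moreover have "R b = surface_relator K \<xi> \<eta> i \<otimes>\<^bsub>K\<^esub>
            (\<xi> i \<otimes>\<^bsub>K\<^esub> inv\<^bsub>K\<^esub> \<eta> i \<otimes>\<^bsub>K\<^esub> inv\<^bsub>K\<^esub> \<xi> i \<otimes>\<^bsub>K\<^esub> \<eta> i) \<otimes>\<^bsub>K\<^esub> inv\<^bsub>K\<^esub> \<eta> i"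
          unfolding R m v4 unfolding k(2) vs ..
        ultimately show ?thesis using gi by (simp add: K.m_assoc)
      qed
    next
      assume c1: "c = 1"
      have "idx 0 a = (k + 1) mod (4 * g)" using idx_nat[of 0 a "k + 1"] ia c1 by (simp add: add_ac)
      moreover have "idx 0 b = k' mod (4 * g)" using idx_nat[of 0 b k'] ib c1 by simp
      ultimately have R: "R a = v ((k + 1) mod (4 * g)) \<otimes>\<^bsub>K\<^esub> inv\<^bsub>K\<^esub> e k" "R b = v (k' mod (4 * g)) \<otimes>\<^bsub>K\<^esub> inv\<^bsub>K\<^esub> e k'"
        by (simp_all add: R_def ih)
      show ?thesis
        using ki
      proof (elim disjE conjE)
        assume k: "k = 4 * i" "k' = 4 * i + 2"
        then have m: "(k + 1) mod (4 * g) = 4 * i + 1" "k' mod (4 * g) = 4 * i + 2" using i by auto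
        show ?thesis unfolding R m unfolding k vs using gi by (simp add: K.m_assoc)
      next
        assume k: "k = 4 * i + 1" "k' = 4 * i + 3"
        then have m: "(k + 1) mod (4 * g) = 4 * i + 2" "k' mod (4 * g) = 4 * i + 3" using i by auto
        show ?thesis unfolding R m unfolding k vs using gi by (simp add: K.m_assoc)
      qed
    qed
  qed
  have R_inv: "R z = R w" if "z \<in> sectors 0" "z \<in> sectors (1/2)" "w \<in> cball 0 1" "f z = f w" for z w
  proof -
    have z: "z \<in> cball 0 1" using that by (simp add: sectors_def)
    have w: "w \<in> sectors 0" "w \<in> sectors (1/2)"
      using saturatedD[OF saturated_sectors[OF d(1)] that(1,3)] saturatedD[OF saturated_sectors[OF d(2)] that(2,3)] that(4)
      by simp_all
    have "(if z \<in> sectors 0 \<inter> sectors (1/2) then R z else \<one>\<^bsub>K\<^esub>) = (if w \<in> sectors 0 \<inter> sectors (1/2) then R w else \<one>\<^bsub>K\<^esub>)"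
    proof (rule fibre_invariant[OF z that(3,4)])
      fix a b assume ab: "glued g a b"
      then show "(if a \<in> sectors 0 \<inter> sectors (1/2) then R a else \<one>\<^bsub>K\<^esub>) = (if b \<in> sectors 0 \<inter> sectors (1/2) then R b else \<one>\<^bsub>K\<^esub>)"
        using glued_sectors_contract(1)[OF d(1) ab] glued_sectors_contract(1)[OF d(2) ab] R_glued[OF ab] by simp
    qed
    then show ?thesis using that(1,2) w by simp
  qed
  have compat: "\<Phi> j z \<otimes>\<^bsub>K\<^esub> inv\<^bsub>K\<^esub> \<Phi> j' z = \<Phi> j w \<otimes>\<^bsub>K\<^esub> inv\<^bsub>K\<^esub> \<Phi> j' w"
    if j: "j \<in> {0, 1, 2}" "j' \<in> {0, 1, 2}" and z: "z \<in> S j" "z \<in> S j'" and w: "w \<in> cball 0 1" "f z = f w" for j j' z w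
  proof (cases "j = 0 \<or> j' = 0")
    case True
    then have zb: "cmod z < 1" using z by (auto simp: S_def)
    then have "w = z" using w by (intro fibre_interior) auto
    then show ?thesis by simp
  next
    case False
    have sat: "saturated_open (S j)"
      using saturated_sectors[OF d(1)] saturated_sectors[OF d(2)] saturated_ball by (simp add: S_def)
    have wS: "w \<in> S j" using saturatedD[OF sat z(1) w(1)] w(2) by simp
    have cl: "\<Phi> j z \<in> carrier K" "\<Phi> j w \<in> carrier K" using \<Phi>_closed j(1) z(1) wS by auto
    show ?thesis
    proof (cases "j = j'")
      case True
      then show ?thesis using cl by simp
    next
      case neq: False
      then have sec: "z \<in> sectors 0" "z \<in> sectors (1/2)" using False j z by (auto simp: S_def)
      have R: "R z = R w" by (rule R_inv[OF sec w])
      have w': "w \<in> sectors 0" "w \<in> sectors (1/2)"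
        using saturatedD[OF saturated_sectors[OF d(1)] sec(1) w(1)] saturatedD[OF saturated_sectors[OF d(2)] sec(2) w(1)] w(2)
        by simp_all
      have vc: "v (idx 0 z) \<in> carrier K" "e (idx (1/2) z) \<in> carrier K" "v (idx 0 w) \<in> carrier K" "e (idx (1/2) w) \<in> carrier K"
        using val_closed idxc sec w' by auto
      consider "j = 1" "j' = 2" | "j = 2" "j' = 1" using False neq j by auto
      then show ?thesis
      proof cases
        case 1
        then show ?thesis using R by (simp add: \<Phi>_def R_def)
      next
        case 2
        have "inv\<^bsub>K\<^esub> R z = inv\<^bsub>K\<^esub> R w" using R by simp
        then show ?thesis using 2 vc by (simp add: \<Phi>_def R_def K.inv_mult_group)
      qed
    qed
  qed
  have hol: "holonomy (cball 0 1) X f z0 K {0, 1, 2} S \<Phi>"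
  proof (unfold_locales)
    show "saturated_open (S j)" if "j \<in> {0, 1, 2}" for j
      using saturated_sectors[OF d(1)] saturated_sectors[OF d(2)] saturated_ball by (simp add: S_def)
    show "\<exists>j\<in>{0, 1, 2}. z \<in> S j" if "z \<in> cball 0 1" for z
      using sectors_cover[OF that] by (auto simp: S_def)
    show "\<Phi> j z \<in> carrier K" if "j \<in> {0, 1, 2}" "z \<in> S j" for j z by (rule \<Phi>_closed[OF that])
    show "\<exists>U. open U \<and> z \<in> U \<and> (\<forall>w\<in>U \<inter> S j. \<Phi> j w = \<Phi> j z)" if j: "j \<in> {0, 1, 2}" and z: "z \<in> S j" for j z
    proof -
      consider "j = 0" | "j = 1" | "j = 2" using j by auto
      then show ?thesis
      proof cases
        case 1
        then show ?thesis by (intro exI[of _ UNIV]) (simp add: \<Phi>_def)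
      next
        case 2
        then have "z \<in> sectors 0" using z by (simp add: S_def)
        from idx_loc[OF this] show ?thesis using 2 by (fastforce simp: \<Phi>_def S_def)
      next
        case 3
        then have "z \<in> sectors (1/2)" using z by (simp add: S_def)
        from idx_loc[OF this] show ?thesis using 3 by (fastforce simp: \<Phi>_def S_def)
      qed
    qed
    show "\<Phi> j z \<otimes>\<^bsub>K\<^esub> inv\<^bsub>K\<^esub> \<Phi> j' z = \<Phi> j w \<otimes>\<^bsub>K\<^esub> inv\<^bsub>K\<^esub> \<Phi> j' w"
      if "j \<in> {0, 1, 2}" "j' \<in> {0, 1, 2}" "z \<in> S j" "z \<in> S j'" "w \<in> cball 0 1" "f z = f w" for j j' z w
      by (rule compat[OF that])
  qed
  interpret hol: holonomy "cball 0 1" X f z0 K "{0, 1, 2}" S \<Phi> by (rule hol)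
  have "hol.Hol (jump (pt (real k + 1/2)) (pt (real k' + 1 - 1/2))) = inv\<^bsub>K\<^esub> e k \<otimes>\<^bsub>K\<^esub> e k'"
    if kk: "k < 4 * g" "k' < 4 * g" "glued g (pt (real k + 1/2)) (pt (real k' + 1 - 1/2))" for k k'
  proof -
    have a: "\<bar>real k + 1/2 - (of_int (int k) + 1/2)\<bar> < 1/2" "\<bar>real k' + 1 - 1/2 - (of_int (int k') + 1/2)\<bar> < 1/2" by simp_all
    note s = in_sectors_pt[OF a(1)] in_sectors_pt[OF a(2)]
    have i: "idx (1/2) (pt (real k + 1/2)) = k" "idx (1/2) (pt (real k' + 1 - 1/2)) = k'"
      using idx_eq[OF s(1)] idx_eq[OF s(3)] kk by (simp_all add: nat_mod_distrib nat_mult_distrib)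
    have j: "(2 :: nat) \<in> {0, 1, 2}" "S 2 = sectors (1/2)" by (simp_all add: S_def)
    have "hol.Hol (jump (pt (real k + 1/2)) (pt (real k' + 1 - 1/2))) =
        inv\<^bsub>K\<^esub> \<Phi> 2 (pt (real k + 1/2)) \<otimes>\<^bsub>K\<^esub> \<Phi> 2 (pt (real k' + 1 - 1/2))"
      by (rule hol.Hol_jump[OF j(1)]) (use j(2) s glued_imp_eq[OF kk(3)] in simp_all)
    then show ?thesis unfolding \<Phi>_def using i by simp
  qed
  note Hj = this
  have half: "(1/2 :: real) \<in> {0..1}" by simp
  have "hol.Hol (gen_x i) = \<xi> i \<and> hol.Hol (gen_y i) = \<eta> i" if i: "i < g" for i
  proof
    have "hol.Hol (gen_x i) = inv\<^bsub>K\<^esub> e (4 * i) \<otimes>\<^bsub>K\<^esub> e (4 * i + 2)"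
      unfolding gen_x_def by (rule Hj[OF _ _ glued_pt(1)[OF i half]]) (use i in simp_all)
    then show "hol.Hol (gen_x i) = \<xi> i" using gens[OF i] unfolding e_def side_val_simps by simp
    have "hol.Hol (gen_y i) = inv\<^bsub>K\<^esub> e (4 * i + 1) \<otimes>\<^bsub>K\<^esub> e (4 * i + 3)"
      unfolding gen_y_def by (rule Hj[OF _ _ glued_pt(2)[OF i half]]) (use i in simp_all)
    then show "hol.Hol (gen_y i) = \<eta> i" using gens[OF i] unfolding e_def side_val_simps by simp
  qed
  then show ?thesis using hol.Hol_hom by blast
qed

end

text \<open>A point of the surface is represented by a chosen point of the disc.\<close>

lemma closed_oriented_surface_exists: "\<exists>X :: complex topology. closed_oriented_surface g X"
proof -
  define r where "r = (\<lambda>z. SOME w. equivclp (glued g) z w)"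
  have r: "equivclp (glued g) z (r z)" for z
    unfolding r_def by (rule someI[of _ z]) simp
  have r_eq: "r z = r w \<longleftrightarrow> equivclp (glued g) z w" for z w
  proof
    assume "r z = r w"
    then show "equivclp (glued g) z w"
      using equivclp_trans[OF r[of z], of w] equivclp_sym[OF r[of w]] by simp
  next
    assume "equivclp (glued g) z w"
    then have "equivclp (glued g) z u \<longleftrightarrow> equivclp (glued g) w u" for u
      using equivclp_trans[of "glued g" z w u] equivclp_trans[of "glued g" w z u] equivclp_sym[of "glued g" z w] by blast
    then have "equivclp (glued g) z = equivclp (glued g) w" by (intro ext)
    then show "r z = r w" by (simp add: r_def)
  qed
  let ?D = "top_of_set (cball (0 :: complex) 1)"
  define pre where "pre = (\<lambda>U. {z \<in> cball 0 1. r z \<in> U})"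
  define P where "P = (\<lambda>U. U \<subseteq> r ` cball 0 1 \<and> openin ?D (pre U))"
  have "istopology P"
    unfolding istopology_def
  proof (intro conjI allI impI)
    fix U V assume UV: "P U" "P V"
    have "pre (U \<inter> V) = pre U \<inter> pre V" by (auto simp: pre_def)
    moreover have "openin ?D (pre U \<inter> pre V)" using UV unfolding P_def by (intro openin_Int) simp_all
    ultimately show "P (U \<inter> V)" using UV(1) unfolding P_def by (simp add: le_infI1)
  next
    fix \<U> assume U: "\<forall>U\<in>\<U>. P U"
    have "pre (\<Union>\<U>) = \<Union>(pre ` \<U>)" by (auto simp: pre_def)
    moreover have "openin ?D (\<Union>(pre ` \<U>))"
      using U unfolding P_def by (intro openin_Union) auto
    moreover have "\<Union>\<U> \<subseteq> r ` cball 0 1" using U unfolding P_def by (intro Union_least) simp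
    ultimately show "P (\<Union>\<U>)" unfolding P_def by simp
  qed
  then have op: "openin (topology P) = P" by (rule topology_inverse')
  have "pre (r ` cball 0 1) = cball 0 1" by (auto simp: pre_def)
  then have "P (r ` cball 0 1)" unfolding P_def using openin_topspace[of ?D] by simp
  moreover have "U \<subseteq> r ` cball 0 1" if "P U" for U using that by (simp add: P_def)
  ultimately have top: "topspace (topology P) = r ` cball 0 1"
    unfolding topspace_def op by (intro equalityI Union_least Union_upper) simp_all
  have "quotient_map ?D (topology P) r"
    unfolding quotient_map_def top op by (simp add: P_def pre_def)
  then show ?thesis unfolding closed_oriented_surface_def using r_eq by (intro exI[of _ "topology P"] exI[of _ r] conjI ballI) simp_all
qed

subsection \<open>The boundary word of a surface with one boundary component\<close>

lemma surface_relator_cong: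
  "(\<And>i. i < n \<Longrightarrow> \<xi> i = \<xi>' i \<and> \<eta> i = \<eta>' i) \<Longrightarrow> surface_relator K \<xi> \<eta> n = surface_relator K \<xi>' \<eta>' n"
  by (induction n) simp_all

text \<open>Gluing two copies of the surface of genus \<open>r\<close> with one boundary component, the second one
  with reversed orientation, gives the closed surface of genus \<open>2 * r\<close>.\<close>

lemma (in group) surface_relator_double:
  assumes cl: "\<And>i. i < 2 * r \<Longrightarrow> \<xi> i \<in> carrier G \<and> \<eta> i \<in> carrier G"
  shows "surface_relator G \<xi> \<eta> (2 * r) = surface_relator G \<xi> \<eta> r \<otimes>
    inv (surface_relator G (\<lambda>k. inv \<eta> (2 * r - 1 - k)) (\<lambda>k. inv \<xi> (2 * r - 1 - k)) r)"
proof -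
  define B where "B = surface_relator G (\<lambda>k. inv \<eta> (2 * r - 1 - k)) (\<lambda>k. inv \<xi> (2 * r - 1 - k))"
  have B: "B k \<in> carrier G" if "k \<le> r" for k
    unfolding B_def using cl that by (intro surface_relator_closed) auto
  have A: "surface_relator G \<xi> \<eta> k \<in> carrier G" if "k \<le> 2 * r" for k
    using cl that by (intro surface_relator_closed) auto
  \<comment> \<open>Interchanging and inverting the two entries turns a block into its inverse, so
    each further block of the second half cancels the last remaining block of
    \<open>B (r - j)\<close>.\<close>
  have "surface_relator G \<xi> \<eta> (r + j) = surface_relator G \<xi> \<eta> r \<otimes> inv (B r) \<otimes> B (r - j)" if "j \<le> r" for j
    using that
  proof (induction j)
    case 0
    then show ?case using A[of r] B[of r] by (simp add: m_assoc)
  next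
    case (Suc j)
    let ?k = "r - Suc j"
    define a b where "a = \<xi> (r + j)" and "b = \<eta> (r + j)"
    have ab: "a \<in> carrier G" "b \<in> carrier G" using cl[of "r + j"] Suc.prems by (simp_all add: a_def b_def)
    have k: "2 * r - 1 - ?k = r + j" "r - j = Suc ?k" using Suc.prems by auto
    have "B (r - j) = B ?k \<otimes> (inv b \<otimes> inv (inv a) \<otimes> inv (inv b) \<otimes> inv a)"
      unfolding k(2) by (simp only: B_def surface_relator.simps k(1) a_def b_def)
    then have Bk: "B (r - j) = B ?k \<otimes> (inv b \<otimes> a \<otimes> b \<otimes> inv a)" using ab by simp
    have cancel: "inv b \<otimes> a \<otimes> b \<otimes> inv a \<otimes> (a \<otimes> inv b \<otimes> inv a \<otimes> b) = \<one>"
    proof -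
      have "a \<otimes> inv b \<otimes> inv a \<otimes> b = inv (inv b \<otimes> a \<otimes> b \<otimes> inv a)"
        using ab by (simp add: inv_mult_group m_assoc)
      then show ?thesis using ab by simp
    qed
    have cl': "B ?k \<in> carrier G" "inv (B r) \<in> carrier G" "surface_relator G \<xi> \<eta> r \<in> carrier G"
      using B[of ?k] B[of r] A[of r] by simp_all
    have "surface_relator G \<xi> \<eta> (r + Suc j) = surface_relator G \<xi> \<eta> (r + j) \<otimes> (a \<otimes> inv b \<otimes> inv a \<otimes> b)"
      by (simp add: a_def b_def)
    also have "\<dots> = surface_relator G \<xi> \<eta> r \<otimes> inv (B r) \<otimes> (B ?k \<otimes> (inv b \<otimes> a \<otimes> b \<otimes> inv a)) \<otimes>
        (a \<otimes> inv b \<otimes> inv a \<otimes> b)"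
      using Suc by (simp only: Bk Suc_leD)
    also have "\<dots> = surface_relator G \<xi> \<eta> r \<otimes> inv (B r) \<otimes> (B ?k \<otimes>
        (inv b \<otimes> a \<otimes> b \<otimes> inv a \<otimes> (a \<otimes> inv b \<otimes> inv a \<otimes> b)))"
      using ab cl' by (simp add: m_assoc del: r_inv l_inv)
    finally show ?case unfolding cancel using cl' by simp
  qed
  from this[of r] show ?thesis using A[of r] B[of r] by (simp add: B_def mult_2)
qed

primrec boundary_word :: "nat \<Rightarrow> nat \<Rightarrow> (nat \<times> bool) list" where
  "boundary_word r 0 = []"
| "boundary_word r (Suc n) =
     boundary_word r n @ [(n, True), (r + n, False), (n, False), (r + n, True)]"

lemma fst_set_boundary_word: "fst ` set (boundary_word r n) = {..<n} \<union> {r..<r + n}"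
  by (induction n) auto

lemma (in group) eval_boundary_word:
  assumes "\<And>i. i < n \<Longrightarrow> z i \<in> carrier G \<and> z (r + i) \<in> carrier G"
  shows "eval_word G z (boundary_word r n) = surface_relator G z (\<lambda>i. z (r + i)) n"
  using assms
proof (induction n)
  case (Suc n)
  have "i \<in> {..<n} \<union> {r..<r + n} \<Longrightarrow> z i \<in> carrier G" for i
    using Suc.prems[of i] Suc.prems[of "i - r"] by auto
  then have "z ` fst ` set (boundary_word r n) \<subseteq> carrier G" unfolding fst_set_boundary_word by auto
  then have "eval_word G z (boundary_word r (Suc n)) = eval_word G z (boundary_word r n) \<otimes>
      eval_word G z [(n, True), (r + n, False), (n, False), (r + n, True)]"
    unfolding boundary_word.simps using Suc.prems[of n] by (intro eval_word_append) simp_all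
  also have "eval_word G z [(n, True), (r + n, False), (n, False), (r + n, True)] =
      z n \<otimes> inv (z (r + n)) \<otimes> inv (z n) \<otimes> z (r + n)"
    using Suc.prems[of n] by (simp add: eval_word_Cons m_assoc)
  finally show ?case using Suc by simp
qed simp

lemma cyclic_word_boundary_word:
  assumes "r \<ge> 1"
  shows "cyclic_word (boundary_word r r)"
proof
  have "distinct (boundary_word r n)" if "n \<le> r" for n
    using that
  proof (induction n)
    case (Suc n)
    have "n \<notin> fst ` set (boundary_word r n)" "r + n \<notin> fst ` set (boundary_word r n)"
      using Suc.prems unfolding fst_set_boundary_word by auto
    then have "(n, b) \<notin> set (boundary_word r n)" "(r + n, b) \<notin> set (boundary_word r n)" for b
      by force+
    then show ?case using Suc by simp
  qed simp
  then show "distinct (boundary_word r r)" by simp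
  \<comment> \<open>Every block begins and ends with a positive letter, so nothing cancels where
    blocks meet, including the cyclic junction.\<close>
  have "reduced_word (boundary_word r n) \<and>
      (n \<noteq> 0 \<longrightarrow> boundary_word r n \<noteq> [] \<and> hd (boundary_word r n) = (0, True) \<and> snd (last (boundary_word r n)))" for n
  proof (induction n)
    case (Suc n)
    then show ?case using assms
      by (cases "n = 0") (auto simp: reduced_word_append reduced_word_Cons inv_letter_def prod_eq_iff)
  qed simp
  from this[of r] show "boundary_word r r \<noteq> []" "reduced_word (boundary_word r r @ boundary_word r r)"
    using assms by (auto simp: reduced_word_append inv_letter_def)
qed

subsection \<open>The group of reduced words\<close>

definition reduced_words :: "('x \<times> bool) list monoid" where
  "reduced_words = \<lparr>carrier = Collect reduced_word, mult = act_word, one = []\<rparr>"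

lemma group_reduced_words: "group reduced_words"
proof (rule groupI)
  fix u v w :: "('x \<times> bool) list"
  assume uvw: "u \<in> carrier reduced_words" "v \<in> carrier reduced_words" "w \<in> carrier reduced_words"
  then show "u \<otimes>\<^bsub>reduced_words\<^esub> v \<in> carrier reduced_words"
    by (auto simp: reduced_words_def)
  have "act_word (act_word u v) w = act_word u (act_word v w)"
    using uvw by (induction u) (auto simp: reduced_words_def reduced_word_Cons act_cons_letter reduced_act_word)
  then show "u \<otimes>\<^bsub>reduced_words\<^esub> v \<otimes>\<^bsub>reduced_words\<^esub> w = u \<otimes>\<^bsub>reduced_words\<^esub> (v \<otimes>\<^bsub>reduced_words\<^esub> w)"
    by (simp add: reduced_words_def)
next
  fix w :: "('x \<times> bool) list"
  assume "w \<in> carrier reduced_words"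
  then have w: "reduced_word w" by (simp add: reduced_words_def)
  show "\<one>\<^bsub>reduced_words\<^esub> \<otimes>\<^bsub>reduced_words\<^esub> w = w" by (simp add: reduced_words_def)
  have "act_word (inv_word w) w = []" using act_inv_word_cancel(1)[of "[]" w] w by simp
  then show "\<exists>v\<in>carrier reduced_words. v \<otimes>\<^bsub>reduced_words\<^esub> w = \<one>\<^bsub>reduced_words\<^esub>"
    using w by (intro bexI[of _ "inv_word w"]) (simp_all add: reduced_words_def)
qed (simp add: reduced_words_def)

lemma free_family_reduced_words: "free_family reduced_words (\<lambda>x. [(x, True)]) UNIV"
proof -
  interpret K: group reduced_words by (rule group_reduced_words)
  have inv: "inv\<^bsub>reduced_words\<^esub> [(x, True)] = [(x, False)]" for x
    by (rule K.inv_equality) (simp_all add: reduced_words_def cons_letter_def inv_letter_def)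
  have eval: "eval_word reduced_words (\<lambda>x. [(x, True)]) w = reduce_word w" for w
  proof (induction w)
    case (Cons l w)
    have "eval_letter reduced_words (\<lambda>x. [(x, True)]) l = [l]"
      by (cases l) (simp add: eval_letter_def inv)
    then show ?case using Cons by (simp add: eval_word_Cons reduced_words_def)
  qed (simp add: reduced_words_def)
  show ?thesis unfolding free_family_def eval by (auto simp: reduced_words_def)
qed

subsection \<open>From surface groups to free groups\<close>

lemma (in group) free_group_of_rank_enumeration:
  assumes H: "subgroup H G" and free: "free_group_of_rank (G\<lparr>carrier := H\<rparr>) n"
  obtains z :: "nat \<Rightarrow> 'a" where "free_family G z {..<n}" "generate G (z ` {..<n}) = H" "z ` {..<n} \<subseteq> H"
proof -
  obtain S where S: "finite S" "card S = n" and basis: "free_basis (G\<lparr>carrier := H\<rparr>) S"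
    using free unfolding free_group_of_rank_def by metis
  obtain z where z: "bij_betw z {..<n} S"
    using ex_bij_betw_nat_finite[OF S(1)] S(2) by (auto simp: atLeast0LessThan)
  have im: "z ` {..<n} = S" and inj: "inj_on z {..<n}" using z by (simp_all add: bij_betw_def)
  have SH: "S \<subseteq> H" and gen: "generate (G\<lparr>carrier := H\<rparr>) S = H"
    and free: "\<And>w. fst ` set w \<subseteq> S \<Longrightarrow> reduced_word w \<Longrightarrow> w \<noteq> [] \<Longrightarrow> word_value (G\<lparr>carrier := H\<rparr>) w \<noteq> \<one>"
    using basis unfolding free_basis_def by auto
  have "eval_word G z w \<noteq> \<one>" if w: "fst ` set w \<subseteq> {..<n}" "reduced_word w" "w \<noteq> []" for w
  proof -
    let ?w = "map (\<lambda>(x, e). (z x, e)) w"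
    have fst_w: "fst ` set ?w = z ` fst ` set w" by force
    have "z ` fst ` set w \<subseteq> S" using image_mono[OF w(1), of z] im by simp
    then have sub: "fst ` set ?w \<subseteq> S" "z ` fst ` set w \<subseteq> H" using fst_w SH by auto
    have "successively (\<lambda>(x, e) (y, d). z x = z y \<longrightarrow> e = d) w"
      using w(2) unfolding reduced_word_def
    proof (rule successively_mono)
      fix l l' assume "l \<in> set w" "l' \<in> set w" and red: "(case l of (x, e) \<Rightarrow> \<lambda>(y, d). x = y \<longrightarrow> e = d) l'"
      then show "(case l of (x, e) \<Rightarrow> \<lambda>(y, d). z x = z y \<longrightarrow> e = d) l'"
        using inj_onD[OF inj, of "fst l" "fst l'"] subsetD[OF w(1), of "fst l"] subsetD[OF w(1), of "fst l'"]
        by (simp add: case_prod_beta')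
    qed
    then have "reduced_word ?w"
      unfolding reduced_word_def successively_map by (rule successively_mono) auto
    then have "word_value (G\<lparr>carrier := H\<rparr>) ?w \<noteq> \<one>" using free[OF sub(1)] w(3) by simp
    then show ?thesis using eval_word_subgroup[OF H sub(2)] by (simp add: eval_word_def)
  qed
  then have "free_family G z {..<n}"
    using SH im subgroup.subset[OF H] by (auto simp: free_family_def)
  then show thesis using that gen generate_consistent[OF SH H] im SH by simp
qed

text \<open>Sending all \<open>gen_y i\<close> and all but two of the \<open>gen_x i\<close> to the
  unit respects the relation, as every commutator then has a trivial entry. Generators in the kernel
  are multiplied by \<open>gen_x 0\<close>, so that each member of the new tuple goes to a free
  generator, as \<open>dense_free_subgroup\<close> requires.\<close>

lemma (in glued_polygon) two_generated_free_quotient: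
  assumes g2: "g \<ge> 2"
  obtains \<psi> e where "\<psi> \<in> hom \<pi> (reduced_words :: (bool \<times> bool) list monoid)"
    "generate \<pi> (e ` {..2 * g}) = carrier \<pi>" "e ` {..2 * g} \<subseteq> carrier \<pi>"
    "\<And>n. n \<le> 2 * g \<Longrightarrow> \<psi> (e n) = [(n \<noteq> 0, True)]"
proof -
  interpret K: group "reduced_words :: (bool \<times> bool) list monoid" by (rule group_reduced_words)
  let ?K = "reduced_words :: (bool \<times> bool) list monoid"
  define \<xi> where "\<xi> = (\<lambda>i :: nat. if i = 0 then [(True, True)] else if i = 1 then [(False, True)] else \<one>\<^bsub>?K\<^esub>)"
  have \<xi>: "\<xi> i \<in> carrier ?K" for i by (simp add: \<xi>_def reduced_words_def)
  have "surface_relator ?K \<xi> (\<lambda>_. \<one>\<^bsub>?K\<^esub>) n = \<one>\<^bsub>?K\<^esub>" for n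
    using \<xi> by (induction n) simp_all
  then obtain \<psi> where \<psi>: "\<psi> \<in> hom \<pi> ?K" "\<And>i. i < g \<Longrightarrow> \<psi> (gen_x i) = \<xi> i \<and> \<psi> (gen_y i) = \<one>\<^bsub>?K\<^esub>"
    using holonomy_exists[OF K.is_group, of \<xi> "\<lambda>_. \<one>\<^bsub>?K\<^esub>"] \<xi> by auto
  \<comment> \<open>The place \<open>2\<close> would belong to \<open>gen_x 1\<close>, which is
    already \<open>e 0\<close>; repeating \<open>gen_x 0\<close> there keeps the numbering
    uniform.\<close>
  define e where "e = (\<lambda>n. if n = 0 then gen_x 1 else if n = 1 \<or> n = 2 then gen_x 0
    else if n \<le> g then gen_x (n - 1) \<otimes>\<^bsub>\<pi>\<^esub> gen_x 0 else gen_y (n - g - 1) \<otimes>\<^bsub>\<pi>\<^esub> gen_x 0)"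
  have e_closed: "e n \<in> carrier \<pi>" if "n \<le> 2 * g" for n
    using that g2 gen_closed by (simp add: e_def)
  then have sub: "e ` {..2 * g} \<subseteq> carrier \<pi>" by auto
  have \<psi>e: "\<psi> (e n) = [(n \<noteq> 0, True)]" if "n \<le> 2 * g" for n
  proof -
    have "\<psi> (gen_x 0) = [(True, True)]" "\<psi> (gen_x 1) = [(False, True)]"
      using \<psi>(2)[of 0] \<psi>(2)[of 1] g2 by (simp_all add: \<xi>_def)
    moreover have "\<psi> (gen_x (n - 1)) = \<one>\<^bsub>?K\<^esub>" if "2 < n" "n \<le> g"
    proof -
      have "n - 1 < g" "n - 1 \<noteq> 0" "n - 1 \<noteq> 1" using that by simp_all
      then show ?thesis using \<psi>(2)[of "n - 1"] unfolding \<xi>_def by simp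
    qed
    moreover have "\<psi> (gen_y (n - g - 1)) = \<one>\<^bsub>?K\<^esub>" if "g < n"
      using that \<open>n \<le> 2 * g\<close> \<psi>(2)[of "n - g - 1"] by simp
    moreover have "[(True, True)] \<in> carrier ?K" by (simp add: reduced_words_def)
    moreover have "\<psi> (a \<otimes>\<^bsub>\<pi>\<^esub> b) = \<psi> a \<otimes>\<^bsub>?K\<^esub> \<psi> b" if "a \<in> carrier \<pi>" "b \<in> carrier \<pi>" for a b
      using \<psi>(1) that by (simp add: hom_def)
    ultimately show ?thesis using gen_closed g2 \<open>n \<le> 2 * g\<close> by (auto simp: e_def)
  qed
  let ?M = "generate \<pi> (e ` {..2 * g})"
  have M: "subgroup ?M \<pi>" using sub by (rule generate_is_subgroup)
  have eM: "e n \<in> ?M" if "n \<le> 2 * g" for n using that by (intro generate.incl) simp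
  have x0: "gen_x 0 \<in> ?M" using eM[of 1] g2 by (simp add: e_def)
  have cancel: "a \<in> ?M" if "a \<otimes>\<^bsub>\<pi>\<^esub> gen_x 0 \<in> ?M" "a \<in> carrier \<pi>" for a
  proof -
    have "a \<otimes>\<^bsub>\<pi>\<^esub> gen_x 0 \<otimes>\<^bsub>\<pi>\<^esub> inv\<^bsub>\<pi>\<^esub> gen_x 0 \<in> ?M"
      by (intro subgroup.m_closed[OF M] subgroup.m_inv_closed[OF M] that(1) x0)
    then show ?thesis using that(2) gen_closed[of 0] g2 by (simp add: m_assoc)
  qed
  have "gen_x i \<in> ?M" if i: "i < g" for i
  proof -
    consider "i = 0" | "i = 1" | "i \<ge> 2" by linarith
    then show ?thesis
    proof cases
      case 1
      then show ?thesis using x0 by simp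
    next
      case 2
      then show ?thesis using eM[of 0] by (simp add: e_def)
    next
      case 3
      have "e (Suc i) = gen_x i \<otimes>\<^bsub>\<pi>\<^esub> gen_x 0" using 3 i by (simp add: e_def)
      then show ?thesis using cancel[OF _ gen_closed(1)[OF i]] eM[of "Suc i"] i by simp
    qed
  qed
  moreover have "gen_y i \<in> ?M" if i: "i < g" for i
  proof -
    have "e (Suc (g + i)) = gen_y i \<otimes>\<^bsub>\<pi>\<^esub> gen_x 0" using g2 by (simp add: e_def)
    then show ?thesis using cancel[OF _ gen_closed(2)[OF i]] eM[of "Suc (g + i)"] i by simp
  qed
  ultimately have "gen_x ` {..<g} \<union> gen_y ` {..<g} \<subseteq> ?M" by auto
  then have "carrier \<pi> \<subseteq> ?M" unfolding generated[symmetric] by (rule generate_subgroup_incl[OF _ M])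
  then have "?M = carrier \<pi>" using subgroup.subset[OF M] by blast
  then show thesis using that \<psi>(1) sub \<psi>e by blast
qed

lemma (in compact_group) dense_free_from_surface:
  assumes H: "dense_subgroup H G T" and surf: "surface_group (G\<lparr>carrier := H\<rparr>)"
  shows "\<exists>H'. dense_subgroup H' G T \<and> (\<exists>r\<ge>2. free_group_of_rank (G\<lparr>carrier := H'\<rparr>) r)"
proof -
  let ?H = "G\<lparr>carrier := H\<rparr>"
  have HG: "subgroup H G" using H by (simp add: dense_subgroup_def)
  interpret H: group ?H using HG by (rule subgroup_imp_group)
  obtain g and X :: "complex topology" and x where g2: "g \<ge> 2" and X: "closed_oriented_surface g X"
    and x: "x \<in> topspace X" and "?H \<cong> fundamental_group X x"
    using surf unfolding surface_group_def by blast
  then obtain \<theta> where \<theta>: "\<theta> \<in> iso ?H (fundamental_group X x)" unfolding is_iso_def by blast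
  obtain f where f: "quotient_map (top_of_set (cball 0 1)) X f"
      "\<And>z w. z \<in> cball 0 1 \<Longrightarrow> w \<in> cball 0 1 \<Longrightarrow> f z = f w \<longleftrightarrow> equivclp (glued g) z w"
    using X unfolding closed_oriented_surface_def by blast
  obtain z0 where z0: "z0 \<in> cball 0 1" "x = f z0"
  proof -
    have "x \<in> f ` cball 0 1" using x quotient_imp_surjective_map[OF f(1)] by simp
    then show thesis using that by blast
  qed
  interpret P: glued_polygon g X f z0
    using g2 f z0 by unfold_locales auto
  have \<theta>: "\<theta> \<in> iso ?H P.\<pi>" using \<theta> z0(2) by simp
  obtain \<psi> e where \<psi>: "\<psi> \<in> hom P.\<pi> (reduced_words :: (bool \<times> bool) list monoid)"
    and e: "generate P.\<pi> (e ` {..2 * g}) = carrier P.\<pi>" "e ` {..2 * g} \<subseteq> carrier P.\<pi>"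
    and \<psi>e: "\<And>n. n \<le> 2 * g \<Longrightarrow> \<psi> (e n) = [(n \<noteq> 0, True)]"
    using P.two_generated_free_quotient[OF g2] by blast
  define \<phi> where "\<phi> = inv_into H \<theta>"
  have \<phi>: "\<phi> \<in> iso P.\<pi> ?H" using H.iso_set_sym[OF \<theta>] by (simp add: \<phi>_def)
  then interpret \<phi>: group_hom P.\<pi> ?H \<phi> by unfold_locales (simp add: iso_iff)
  have im: "\<phi> ` carrier P.\<pi> = H" using \<phi> by (simp add: iso_iff)
  have sub: "(\<phi> \<circ> e) ` {..2 * g} \<subseteq> H" using e(2) im by (auto simp: image_comp[symmetric])
  have "generate ?H (\<phi> ` e ` {..2 * g}) = \<phi> ` generate P.\<pi> (e ` {..2 * g})"
    by (rule \<phi>.generate_img[OF e(2)])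
  then have gen: "generate G ((\<phi> \<circ> e) ` {..2 * g}) = H"
    using generate_consistent[OF sub HG] e(1) im by (simp add: image_comp)
  have "\<exists>H'. dense_subgroup H' G T \<and> free_group_of_rank (G\<lparr>carrier := H'\<rparr>) (Suc (2 * g))"
  proof (rule dense_free_subgroup[OF H gen sub group_reduced_words _ free_family_reduced_words])
    show "\<psi> \<circ> \<theta> \<in> hom ?H reduced_words"
      by (rule Group.hom_compose[OF iso_imp_homomorphism[OF \<theta>] \<psi>])
    show "(\<lambda>n :: nat. n \<noteq> 0) ` {..2 * g} \<subseteq> UNIV" by simp
    fix n assume n: "n \<le> 2 * g"
    have "\<theta> (\<phi> (e n)) = e n"
      unfolding \<phi>_def using e(2) n \<theta> by (intro f_inv_into_f) (auto simp: iso_iff)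
    then show "(\<psi> \<circ> \<theta>) ((\<phi> \<circ> e) n) = [(n \<noteq> 0, True)]" using \<psi>e[OF n] by simp
  qed simp
  moreover have "Suc (2 * g) \<ge> 2" using g2 by simp
  ultimately show ?thesis by blast
qed

subsection \<open>From free groups to surface groups\<close>

text \<open>This is \<open>dense_free_subgroup\<close> with the inclusion as \<open>\<psi>\<close>:
  the basis is lengthened by copies of \<open>b 1\<close>, which the distinct twists make
  independent. The rank \<open>2 * r\<close> is the number of generators in
  \<open>boundary_word r r\<close>.\<close>

lemma (in compact_group) dense_free_even_rank:
  assumes H: "dense_subgroup H G T" and free: "free_group_of_rank (G\<lparr>carrier := H\<rparr>) r" and r: "r \<ge> 2"
  obtains z :: "nat \<Rightarrow> 'a" where "free_family G z {..<2 * r}" "dense_subgroup (generate G (z ` {..<2 * r})) G T"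
proof -
  have HG: "subgroup H G" using H by (simp add: dense_subgroup_def)
  obtain b :: "nat \<Rightarrow> 'a" where b: "free_family G b {..<r}" "generate G (b ` {..<r}) = H" "b ` {..<r} \<subseteq> H"
    using free_group_of_rank_enumeration[OF HG free] by blast
  define t where "t = (\<lambda>i. if i < r then i else 1)"
  have t: "t ` {..2 * r - 1} = {..<r}" using r by (force simp: t_def)
  have bt: "(b \<circ> t) ` {..2 * r - 1} = b ` {..<r}" unfolding image_comp[symmetric] t ..
  have "\<exists>H'. dense_subgroup H' G T \<and> free_group_of_rank (G\<lparr>carrier := H'\<rparr>) (Suc (2 * r - 1))"
  proof (rule dense_free_subgroup[OF H _ _ is_group _ b(1)])
    show "generate G ((b \<circ> t) ` {..2 * r - 1}) = H" "(b \<circ> t) ` {..2 * r - 1} \<subseteq> H"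
      unfolding bt by (fact b)+
    show "(\<lambda>x. x) \<in> hom (G\<lparr>carrier := H\<rparr>) G" using subgroup.subset[OF HG] by (auto simp: hom_def)
    show "t ` {..2 * r - 1} \<subseteq> {..<r}" using t by (rule equalityD1)
    show "t i \<noteq> t 0" if "1 \<le> i" for i using that r by (simp add: t_def)
  qed simp
  then obtain H' where H': "dense_subgroup H' G T" "free_group_of_rank (G\<lparr>carrier := H'\<rparr>) (2 * r)"
    using r by auto
  then have H'G: "subgroup H' G" by (simp add: dense_subgroup_def)
  show thesis
  proof (rule free_group_of_rank_enumeration[OF H'G H'(2)])
    fix z :: "nat \<Rightarrow> 'a" assume z: "free_family G z {..<2 * r}" "generate G (z ` {..<2 * r}) = H'"
    show thesis by (rule that[OF z(1)]) (simp add: z(2) H'(1))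
  qed
qed

lemma (in group_hom) hom_syllable_value:
  assumes "\<And>b. p b ` A \<subseteq> carrier G" "syllables_over A l"
  shows "h (syllable_value G p l) = syllable_value H (\<lambda>b x. h (p b x)) l"
  using assms(2)
proof (induction l)
  case (Cons x l)
  have A: "fst ` set (snd x) \<subseteq> A" using Cons.prems by simp
  then have sub: "p (fst x) ` fst ` set (snd x) \<subseteq> carrier G"
    using assms(1)[of "fst x"] image_mono[OF A, of "p (fst x)"] by simp
  have "syllable_value G p l \<in> carrier G"
    using Cons.prems by (intro G.syllable_value_closed[OF assms(1)]) simp_all
  then show ?case
    using Cons sub by (simp add: G.eval_word_closed hom_eval_word)
qed simp

lemma syllable_value_cong:
  assumes "\<And>b x. x \<in> A \<Longrightarrow> p b x = q b x" "syllables_over A l"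
  shows "syllable_value G p l = syllable_value G q l"
  using assms(2)
proof (induction l)
  case (Cons y l)
  have "eval_word G (p (fst y)) (snd y) = eval_word G (q (fst y)) (snd y)"
    using Cons.prems assms(1) by (intro eval_word_cong) auto
  then show ?case using Cons by simp
qed simp

lemma (in group) syllable_value_append:
  assumes "\<And>b. p b ` A \<subseteq> carrier G" "syllables_over A l" "syllables_over A l'"
  shows "syllable_value G p (l @ l') = syllable_value G p l \<otimes> syllable_value G p l'"
  using assms(2)
proof (induction l)
  case Nil
  then show ?case using syllable_value_closed[OF assms(1,3)] by simp
next
  case (Cons x l)
  have A: "fst ` set (snd x) \<subseteq> A" using Cons.prems by simp
  then have "p (fst x) ` fst ` set (snd x) \<subseteq> carrier G"
    using assms(1)[of "fst x"] image_mono[OF A, of "p (fst x)"] by simp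
  moreover have "syllable_value G p l \<in> carrier G" "syllable_value G p l' \<in> carrier G"
    using Cons.prems assms(3) by (simp_all add: syllable_value_closed[OF assms(1)])
  ultimately show ?case using Cons by (simp add: eval_word_closed m_assoc)
qed

lemma (in hausdorff_topological_group) closedin_syllable_value_eq_one:
  assumes z: "z ` A \<subseteq> carrier G" and l: "syllables_over A l"
  shows "closedin T {s \<in> topspace T. syllable_value G (conjugate_copy G z s) l = \<one>}"
proof -
  have "continuous_map T T (\<lambda>s. syllable_value G (conjugate_copy G z s) l)"
    using l
  proof (induction l)
    case Nil
    show ?case unfolding syllable_value_simps by (rule continuous_map_const_carrier[OF one_closed])
  next
    case (Cons y l)
    have "continuous_map T T (\<lambda>s. eval_word G (conjugate_copy G z s (fst y)) (snd y))"
    proof (rule continuous_map_eval_word)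
      fix i assume "i \<in> fst ` set (snd y)"
      then have i: "z i \<in> carrier G" using Cons.prems z by auto
      have id: "continuous_map T T (\<lambda>s. s)" using continuous_map_id[of T] by (simp add: id_def)
      show "continuous_map T T (\<lambda>s. conjugate_copy G z s (fst y) i)"
        unfolding conjugate_copy_def
        using i continuous_map_mult[OF continuous_map_mult[OF id continuous_map_const_carrier[OF i]] continuous_map_inverse[OF id]]
        by (cases "fst y") (simp_all add: topspace_eq)
    qed
    then show ?case using Cons by (simp add: continuous_map_mult)
  qed
  moreover have "closedin T {\<one>}"
    using hausdorff by (simp add: closedin_Hausdorff_sing_eq topspace_eq)
  ultimately show ?thesis using closedin_continuous_map_preimage by fastforce
qed

lemma (in hausdorff_topological_group) commute_closure_of_powers:
  assumes c: "c \<in> carrier G" and s: "s \<in> T closure_of range (\<lambda>n :: nat. c [^] n)"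
  shows "s \<otimes> c = c \<otimes> s"
proof -
  have id: "continuous_map T T (\<lambda>s. s)" using continuous_map_id[of T] by (simp add: id_def)
  have "closedin T {s \<in> topspace T. s \<otimes> c = c \<otimes> s}"
    by (intro closedin_continuous_maps_eq[OF hausdorff] continuous_map_mult id continuous_map_const_carrier c)
  moreover have "range (\<lambda>n :: nat. c [^] n) \<subseteq> {s \<in> topspace T. s \<otimes> c = c \<otimes> s}"
  proof clarify
    fix n :: nat
    show "c [^] n \<in> topspace T \<and> c [^] n \<otimes> c = c \<otimes> c [^] n"
      using c nat_pow_comm[OF c, of n 1] by (simp add: topspace_eq)
  qed
  ultimately have "T closure_of range (\<lambda>n :: nat. c [^] n) \<subseteq> {s \<in> topspace T. s \<otimes> c = c \<otimes> s}"
    by (rule closure_of_minimal[rotated])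
  then show ?thesis using s by blast
qed

section \<open>The surface group of even genus as a double\<close>

context glued_polygon
begin

text \<open>The generators of the two halves as two copies of \<open>2 * r\<close> letters. In the
  second copy the order of blocks is reversed and the entries are interchanged and inverted, as in
  \<open>surface_relator_double\<close>; thus the surface relation says that both copies agree on
  the boundary word.\<close>

definition half_gen :: "bool \<Rightarrow> nat \<Rightarrow> (real \<Rightarrow> 'a) set" where
  "half_gen b a = (let r = g div 2 in
     if b then if a < r then gen_x a else gen_y (a - r)
     else if a < r then inv\<^bsub>\<pi>\<^esub> gen_y (2 * r - 1 - a) else inv\<^bsub>\<pi>\<^esub> gen_x (2 * r - 1 - (a - r)))"

context
  fixes r assumes r: "g = 2 * r"
begin

lemma half_genus: "g div 2 = r" using r by simp

lemma half_gen_simps: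
  "a < r \<Longrightarrow> half_gen True a = gen_x a" "a < r \<Longrightarrow> half_gen True (r + a) = gen_y a"
  "a < r \<Longrightarrow> half_gen False a = inv\<^bsub>\<pi>\<^esub> gen_y (2 * r - 1 - a)"
  "a < r \<Longrightarrow> half_gen False (r + a) = inv\<^bsub>\<pi>\<^esub> gen_x (2 * r - 1 - a)"
  unfolding half_gen_def half_genus Let_def by simp_all

lemma half_gen_closed: "a < 2 * r \<Longrightarrow> half_gen b a \<in> carrier \<pi>"
proof -
  assume a: "a < 2 * r"
  have cl: "gen_x i \<in> carrier \<pi>" "gen_y i \<in> carrier \<pi>" if "i < 2 * r" for i
    using that gen_closed[of i] unfolding r by simp_all
  show ?thesis unfolding half_gen_def half_genus Let_def using a by (simp add: cl)
qed

lemma half_gen_agree: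
  "eval_word \<pi> (half_gen True) (boundary_word r r) = eval_word \<pi> (half_gen False) (boundary_word r r)"
proof -
  let ?A = "surface_relator \<pi> gen_x gen_y r"
  let ?B = "surface_relator \<pi> (\<lambda>k. inv\<^bsub>\<pi>\<^esub> gen_y (2 * r - 1 - k)) (\<lambda>k. inv\<^bsub>\<pi>\<^esub> gen_x (2 * r - 1 - k)) r"
  have cl: "gen_x i \<in> carrier \<pi>" "gen_y i \<in> carrier \<pi>" if "i < 2 * r" for i using that gen_closed r by auto
  have AB: "?A \<in> carrier \<pi>" "?B \<in> carrier \<pi>" by (intro surface_relator_closed; use cl in simp)+
  have "?A \<otimes>\<^bsub>\<pi>\<^esub> inv\<^bsub>\<pi>\<^esub> ?B = \<one>\<^bsub>\<pi>\<^esub>"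
    using surface_relator_double[of r gen_x gen_y] cl relator_eq_one r by simp
  then have "?A = ?B" using AB by (metis inv_closed inv_equality inv_inv)
  have eval: "eval_word \<pi> (half_gen b) (boundary_word r r) =
      surface_relator \<pi> (half_gen b) (\<lambda>i. half_gen b (r + i)) r" for b
    by (rule eval_boundary_word) (simp add: half_gen_closed)
  have "surface_relator \<pi> (half_gen True) (\<lambda>i. half_gen True (r + i)) r = ?A"
    by (rule surface_relator_cong) (simp add: half_gen_simps)
  moreover have "surface_relator \<pi> (half_gen False) (\<lambda>i. half_gen False (r + i)) r = ?B"
    by (rule surface_relator_cong) (simp add: half_gen_simps)
  ultimately show ?thesis unfolding eval using \<open>?A = ?B\<close> by simp
qed

lemma syllable_value_surj:
  assumes "v \<in> carrier \<pi>"
  obtains l where "syllables_over {..<2 * r} l" "syllable_value \<pi> half_gen l = v"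
proof -
  have hc: "half_gen b ` {..<2 * r} \<subseteq> carrier \<pi>" for b using half_gen_closed by auto
  have letter: "\<exists>b a e. a < 2 * r \<and> y = eval_letter \<pi> (half_gen b) (a, e)"
    if y: "y \<in> gen_x ` {..<g} \<union> gen_y ` {..<g}" for y
  proof -
    have *: "\<exists>b a e. a < 2 * r \<and> y = eval_letter \<pi> (half_gen b) (a, e)"
      if "a < 2 * r" "y = half_gen True a \<or> y = inv\<^bsub>\<pi>\<^esub> half_gen False a" for a
      using that(2)
    proof
      assume "y = half_gen True a"
      then show ?thesis using that(1) by (intro exI[of _ True] exI[of _ a]) auto
    next
      assume "y = inv\<^bsub>\<pi>\<^esub> half_gen False a"
      then show ?thesis using that(1) by (intro exI[of _ False] exI[of _ a] conjI) simp_all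
    qed
    obtain i where i: "i < 2 * r" "y = gen_x i \<or> y = gen_y i" using y r by auto
    show ?thesis
    proof (cases "i < r")
      case True
      then show ?thesis using i(2) *[of i] *[of "r + i"] half_gen_simps(1,2)[of i] by auto
    next
      case False
      define j where "j = 2 * r - 1 - i"
      have j: "j < r" "2 * r - 1 - j = i" using False i(1) by (auto simp: j_def)
      have "gen_y i = inv\<^bsub>\<pi>\<^esub> half_gen False j" "gen_x i = inv\<^bsub>\<pi>\<^esub> half_gen False (r + j)"
        using half_gen_simps(3,4)[OF j(1)] gen_closed[of i] i(1) r unfolding j(2) by simp_all
      then show ?thesis using i(2) *[of j] *[of "r + j"] j(1) by auto
    qed
  qed
  have single: "\<exists>l. syllables_over {..<2 * r} l \<and> syllable_value \<pi> half_gen l = eval_letter \<pi> (half_gen b) (a, e)"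
    if a: "a < 2 * r" for a b e
  proof (intro exI conjI)
    show "syllables_over {..<2 * r} [(b, [(a, e)])]" using a by simp
    show "syllable_value \<pi> half_gen [(b, [(a, e)])] = eval_letter \<pi> (half_gen b) (a, e)"
      using half_gen_closed[OF a, of b] by (simp add: eval_word_Cons)
  qed
  have "v \<in> generate \<pi> (gen_x ` {..<g} \<union> gen_y ` {..<g})" using assms generated by simp
  then have "\<exists>l. syllables_over {..<2 * r} l \<and> syllable_value \<pi> half_gen l = v"
  proof (induction rule: generate.induct)
    case one
    then show ?case by (intro exI[of _ "[]"]) simp
  next
    case (incl y)
    then show ?case using letter single by metis
  next
    case (inv y)
    then obtain b a e where a: "a < 2 * r" and y: "y = eval_letter \<pi> (half_gen b) (a, e)" using letter by metis
    have "inv\<^bsub>\<pi>\<^esub> y = eval_letter \<pi> (half_gen b) (a, \<not> e)"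
      unfolding y using half_gen_closed[OF a, of b] by (simp add: eval_letter_def)
    then show ?case using single[OF a] by simp
  next
    case (eng v v')
    then obtain l l' where l: "syllables_over {..<2 * r} l" "syllable_value \<pi> half_gen l = v"
      "syllables_over {..<2 * r} l'" "syllable_value \<pi> half_gen l' = v'" by blast
    then show ?case using syllable_value_append[OF hc l(1,3)]
      by (intro exI[of _ "l @ l'"]) (auto simp: syllables_over_def)
  qed
  then show thesis using that by blast
qed

end

end

text \<open>An element of the kernel of \<open>\<rho>\<close> is the value of some list
  \<open>l\<close> of syllables. Then \<open>s \<in> E l\<close>, so by the choice of
  \<open>s\<close> this value is the unit. Density is immediate here, as the image contains the
  original elements \<open>z a\<close>, coming from the first half.\<close>

lemma (in compact_group) dense_surface_from_free:
  fixes r :: nat and z :: "nat \<Rightarrow> 'a"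
  assumes r: "r \<ge> 1" and z: "free_family G z {..<2 * r}" and dense: "dense_subgroup (generate G (z ` {..<2 * r})) G T"
  shows "\<exists>H. dense_subgroup H G T \<and> surface_group (G\<lparr>carrier := H\<rparr>)"
proof -
  obtain X :: "complex topology" where X: "closed_oriented_surface (2 * r) X"
    using closed_oriented_surface_exists by blast
  obtain f where f: "quotient_map (top_of_set (cball 0 1)) X f"
      "\<And>z w. z \<in> cball 0 1 \<Longrightarrow> w \<in> cball 0 1 \<Longrightarrow> f z = f w \<longleftrightarrow> equivclp (glued (2 * r)) z w"
    using X unfolding closed_oriented_surface_def by blast
  interpret P: glued_polygon "2 * r" X f 0
    using r f by unfold_locales auto
  let ?u = "boundary_word r r"
  interpret u: cyclic_word ?u by (rule cyclic_word_boundary_word[OF r])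
  have zc: "z ` {..<2 * r} \<subseteq> carrier G" using z by (simp add: free_family_def)
  then have zc': "z i \<in> carrier G" if "i < 2 * r" for i using that by auto
  have uX: "fst ` set ?u \<subseteq> {..<2 * r}" unfolding fst_set_boundary_word by auto
  have zu: "z ` fst ` set ?u \<subseteq> carrier G" using image_mono[OF uX, of z] zc by simp
  define c where "c = eval_word G z ?u"
  have c: "c \<in> carrier G" unfolding c_def by (rule eval_word_closed[OF zu])
  have hc: "P.half_gen b ` {..<2 * r} \<subseteq> carrier P.\<pi>" for b using P.half_gen_closed[OF refl] by auto
  \<comment> \<open>Lists are selected by their value in the surface group;
    \<open>double_dichotomy\<close> with that group as \<open>K\<close> then leaves only finitely
    many powers of \<open>c\<close> in each \<open>E l\<close>.\<close>
  define W where "W = {l. syllables_over {..<2 * r} l \<and> syllable_value P.\<pi> P.half_gen l \<noteq> \<one>\<^bsub>P.\<pi>\<^esub>}"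
  define E where "E = (\<lambda>l. {s \<in> topspace T. syllable_value G (conjugate_copy G z s) l = \<one>})"
  obtain s where s: "s \<in> T closure_of range (\<lambda>n :: nat. c [^] n)" and sW: "\<And>l. l \<in> W \<Longrightarrow> s \<notin> E l"
  proof (rule generic_element[OF c, of W E])
    show "countable W" by simp
    fix l assume l: "l \<in> W"
    then have lX: "syllables_over {..<2 * r} l" by (simp add: W_def)
    show "closedin T (E l)" unfolding E_def by (rule closedin_syllable_value_eq_one[OF zc lX])
    have "finite {n :: nat. syllable_value G (conjugate_copy G z (c [^] n)) l = \<one>}"
      using u.double_dichotomy[OF is_group z uX P.is_group hc P.half_gen_agree[OF refl] lX] l
      by (simp add: W_def c_def)
    then show "finite {n :: nat. c [^] n \<in> E l}" by (rule rev_finite_subset) (auto simp: E_def)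
  qed blast
  have sc: "s \<in> carrier G" using s closure_of_subset_topspace[of T] by (auto simp: topspace_eq)
  have comm: "s \<otimes> c \<otimes> inv s = c"
    using commute_closure_of_powers[OF c s] c sc by (simp add: m_assoc)
  \<comment> \<open>For \<open>i \<ge> r\<close> these values are chosen so that
    \<open>half_gen False\<close> is mapped to the conjugates of \<open>z\<close> by
    \<open>s\<close>.\<close>
  define \<xi> where "\<xi> = (\<lambda>i. if i < r then z i else s \<otimes> inv z (r + (2 * r - 1 - i)) \<otimes> inv s)"
  define \<eta> where "\<eta> = (\<lambda>i. if i < r then z (r + i) else s \<otimes> inv z (2 * r - 1 - i) \<otimes> inv s)"
  have cl: "\<xi> i \<in> carrier G \<and> \<eta> i \<in> carrier G" if "i < 2 * r" for i
    using that zc' sc by (auto simp: \<xi>_def \<eta>_def)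
  have inv_conj: "inv (s \<otimes> inv a \<otimes> inv s) = s \<otimes> a \<otimes> inv s" if "a \<in> carrier G" for a
    using that sc by (simp add: inv_mult_group m_assoc)
  have flip: "inv \<eta> (2 * r - 1 - k) = s \<otimes> z k \<otimes> inv s" "inv \<xi> (2 * r - 1 - k) = s \<otimes> z (r + k) \<otimes> inv s" if "k < r" for k
  proof -
    have "\<not> 2 * r - 1 - k < r" "2 * r - 1 - (2 * r - 1 - k) = k" using that by auto
    then show "inv \<eta> (2 * r - 1 - k) = s \<otimes> z k \<otimes> inv s" "inv \<xi> (2 * r - 1 - k) = s \<otimes> z (r + k) \<otimes> inv s"
      using that inv_conj zc' by (simp_all add: \<xi>_def \<eta>_def)
  qed
  have A: "surface_relator G \<xi> \<eta> r = c"
  proof -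
    have "surface_relator G \<xi> \<eta> r = surface_relator G z (\<lambda>i. z (r + i)) r"
      by (rule surface_relator_cong) (simp add: \<xi>_def \<eta>_def)
    then show ?thesis unfolding c_def using zc' by (subst eval_boundary_word) simp_all
  qed
  have B: "surface_relator G (\<lambda>k. inv \<eta> (2 * r - 1 - k)) (\<lambda>k. inv \<xi> (2 * r - 1 - k)) r = c"
  proof -
    let ?z = "\<lambda>k. s \<otimes> z k \<otimes> inv s"
    have "surface_relator G (\<lambda>k. inv \<eta> (2 * r - 1 - k)) (\<lambda>k. inv \<xi> (2 * r - 1 - k)) r =
        surface_relator G ?z (\<lambda>i. ?z (r + i)) r"
      by (rule surface_relator_cong) (intro conjI flip)
    also have "\<dots> = eval_word G ?z ?u" using zc' sc by (subst eval_boundary_word) simp_all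
    also have "\<dots> = c" using eval_word_conjugate[OF sc zu] comm by (simp add: c_def)
    finally show ?thesis .
  qed
  have "surface_relator G \<xi> \<eta> (2 * r) = \<one>"
    using surface_relator_double[of r \<xi> \<eta>] cl c unfolding A B by simp
  then obtain \<rho> where \<rho>: "\<rho> \<in> hom P.\<pi> G" "\<And>i. i < 2 * r \<Longrightarrow> \<rho> (P.gen_x i) = \<xi> i \<and> \<rho> (P.gen_y i) = \<eta> i"
    using P.holonomy_exists[OF is_group, of \<xi> \<eta>] cl by blast
  interpret \<rho>: group_hom P.\<pi> G \<rho> by unfold_locales (rule \<rho>(1))
  have \<rho>_half: "\<rho> (P.half_gen b a) = conjugate_copy G z s b a" if a: "a < 2 * r" for a b
  proof -
    have x: "\<rho> (P.half_gen b a) = conjugate_copy G z s b a \<and> \<rho> (P.half_gen b (r + a)) = conjugate_copy G z s b (r + a)"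
      if "a < r" for a
    proof (cases b)
      case True
      then show ?thesis using that \<rho>(2)[of a] by (simp add: P.half_gen_simps[OF refl] conjugate_copy_def \<xi>_def \<eta>_def)
    next
      case False
      then show ?thesis using that \<rho>(2)[of "2 * r - 1 - a"] P.gen_closed[of "2 * r - 1 - a"] flip[OF that]
        by (simp add: P.half_gen_simps[OF refl] conjugate_copy_def)
    qed
    show ?thesis
    proof (cases "a < r")
      case True
      then show ?thesis using x by blast
    next
      case False
      then show ?thesis using x[of "a - r"] a by simp
    qed
  qed
  have "v = \<one>\<^bsub>P.\<pi>\<^esub>" if v: "v \<in> carrier P.\<pi>" "\<rho> v = \<one>" for v
  proof -
    obtain l where l: "syllables_over {..<2 * r} l" "syllable_value P.\<pi> P.half_gen l = v"
      using P.syllable_value_surj[OF refl v(1)] by blast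
    have "\<rho> v = syllable_value G (\<lambda>b x. \<rho> (P.half_gen b x)) l"
      using \<rho>.hom_syllable_value[where p = P.half_gen, OF hc l(1)] l(2) by simp
    also have "\<dots> = syllable_value G (conjugate_copy G z s) l"
      by (rule syllable_value_cong[OF _ l(1)]) (simp add: \<rho>_half)
    finally have "s \<in> E l" using v(2) sc by (simp add: E_def topspace_eq)
    then have "l \<notin> W" using sW by blast
    then show ?thesis using l by (simp add: W_def)
  qed
  then have inj: "inj_on \<rho> (carrier P.\<pi>)" by (simp add: \<rho>.inj_on_one_iff)
  let ?H = "\<rho> ` carrier P.\<pi>"
  have H: "subgroup ?H G" by (rule \<rho>.img_is_subgroup)
  have "z a \<in> ?H" if "a < 2 * r" for a
    using \<rho>_half[OF that, of True] P.half_gen_closed[OF refl that, of True]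
    by (metis image_eqI conjugate_copy_def)
  then have "z ` {..<2 * r} \<subseteq> ?H" by auto
  then have "generate G (z ` {..<2 * r}) \<subseteq> ?H" by (rule generate_subgroup_incl[OF _ H])
  also have "?H \<subseteq> T closure_of ?H"
    using subgroup.subset[OF H] by (intro closure_of_subset) (simp add: topspace_eq)
  finally have dense_H: "dense_subgroup ?H G T" by (rule dense_subgroup_supset[OF dense H])
  have "surface_group (G\<lparr>carrier := ?H\<rparr>)"
    unfolding surface_group_def
  proof (intro conjI exI)
    show "group (G\<lparr>carrier := ?H\<rparr>)" using H by (rule subgroup_imp_group)
    have "\<rho> \<in> iso P.\<pi> (G\<lparr>carrier := ?H\<rparr>)"
      using \<rho>(1) inj by (auto simp: iso_iff hom_def)
    then show "G\<lparr>carrier := ?H\<rparr> \<cong> P.\<pi>" by (intro P.iso_sym is_isoI)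
    show "f 0 \<in> topspace X" using quotient_imp_surjective_map[OF f(1)] by auto
  qed (use r X in simp_all)
  then show ?thesis using dense_H by blast
qed

theorem theorem1p1:
  fixes G :: "('a, 'b) monoid_scheme" and T :: "'a topology"
  assumes "compact_group G T"
  shows "(\<exists>H. dense_subgroup H G T \<and> (\<exists>r\<ge>2. free_group_of_rank (G\<lparr>carrier := H\<rparr>) r))
     \<longleftrightarrow> (\<exists>H. dense_subgroup H G T \<and> surface_group (G\<lparr>carrier := H\<rparr>))"
proof
  assume "\<exists>H. dense_subgroup H G T \<and> (\<exists>r\<ge>2. free_group_of_rank (G\<lparr>carrier := H\<rparr>) r)"
  then obtain H r where H: "dense_subgroup H G T" "free_group_of_rank (G\<lparr>carrier := H\<rparr>) r" and r: "r \<ge> 2"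
    by blast
  obtain z :: "nat \<Rightarrow> 'a" where "free_family G z {..<2 * r}" "dense_subgroup (generate G (z ` {..<2 * r})) G T"
    using compact_group.dense_free_even_rank[OF assms H r] by blast
  then show "\<exists>H. dense_subgroup H G T \<and> surface_group (G\<lparr>carrier := H\<rparr>)"
    using r by (intro compact_group.dense_surface_from_free[OF assms]) simp_all
next
  assume "\<exists>H. dense_subgroup H G T \<and> surface_group (G\<lparr>carrier := H\<rparr>)"
  then show "\<exists>H. dense_subgroup H G T \<and> (\<exists>r\<ge>2. free_group_of_rank (G\<lparr>carrier := H\<rparr>) r)"
    using compact_group.dense_free_from_surface[OF assms] by blast
qed

end
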